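(* Let $\underline\sigma$ be a vincular pattern of length $k$ with $j$ blocks, and let $X_n$ be the number of occurrences of $\underline\sigma$ in a uniformly random permutation of length $n$. Then the statement "there exists $c>0$ such that $\operatorname{Var}(X_n)\ge c\,n^{2j-1}$ for all $n\ge k$" is equivalent to the inequality $$\sum_{l=1}^{M_{\underline\sigma}}(2k)_l\,b_\sigma(2k-l,2j-1)>\binom{2k}{k}\binom{2j-1}{j}\,j.$$
   Context: $[n]=\{1,\dots,n\}$ and $S_n$ is the set of permutations of $[n]$; for a permutation $\pi$, $A(\pi)=\{(u,v):u=\pi_i,\ v=\pi_j,\ i<j\}$. A vincular pattern of length $k$ is a pair $\underline P=(P,\boldsymbol C(\underline P))$ with $P=p_1\cdots p_k\in S_k$ and $\boldsymbol C(\underline P)\subseteq[k-1]$. An occurrence of $\underline P$ in $\sigma\in S_n$ is a tuple $(t_1,\dots,t_k)\in[n]^k$ with $t_1<\dots<t_k$, such that $(t_a,t_b)\in A(\sigma)$ iff $(a,b)\in A(P)$, and $\sigma^{-1}(t_{p_{i+1}})=\sigma^{-1}(t_{p_i})+1$ for every $i\in\boldsymbol C(\underline P)$. The blocks of $\underline P$ are the maximal groups of consecutive positions of $P$ linked through $\boldsymbol C(\underline P)$ (positions $i,i+1$ lie in the same block iff $i\in\boldsymbol C(\underline P)$), so the number of blocks is $k-|\boldsymbol C(\underline P)|$. $M_{\underline\sigma}$ is the maximum size of a block of $\underline\sigma$. A merge of vincular patterns $\underline{P_1}=(x,\boldsymbol C(\underline{P_1}))$ and $\underline{P_2}=(y,\boldsymbol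 C(\underline{P_2}))$ of lengths $k_1,k_2$ onto a vincular pattern $\underline{P_3}=(z,\boldsymbol C(\underline{P_3}))$ of length $k_3$ is a pair of strictly increasing functions $m_1:[k_1]\to[k_3]$, $m_2:[k_2]\to[k_3]$ such that: (1) $m_1([k_1])\cup m_2([k_2])=[k_3]$; (2) $(m_1(a),m_1(b))\in A(z)$ iff $(a,b)\in A(x)$ for all $a,b\in[k_1]$, and $(m_2(a),m_2(b))\in A(z)$ iff $(a,b)\in A(y)$ for all $a,b\in[k_2]$; (3) $z^{-1}(m_1(x_{i+1}))=z^{-1}(m_1(x_i))+1$ for $i\in\boldsymbol C(\underline{P_1})$, $z^{-1}(m_2(y_{i+1}))=z^{-1}(m_2(y_i))+1$ for $i\in\boldsymbol C(\underline{P_2})$, and $\boldsymbol C(\underline{P_3})=\{z^{-1}(m_1(x_i)):i\in\boldsymbol C(\underline{P_1})\}\cup\{z^{-1}(m_2(y_i)):i\in\boldsymbol C(\underline{P_2})\}$. $b_\sigma(p,q)$ is the number of merges of two copies of $\underline\sigma$ (i.e. triples $(\underline{P_3},m_1,m_2)$ with $\underline{P_1}=\underline{P_2}=\underline\sigma$) for which the resulting pattern $\underline{P_3}$ has length $p$ and $q$ blocks. $(2k)_l=2k(2k-1)\cdots(2k-l+1)$ is the falling factorial. *)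

theory Defs
  imports "HOL-Probability.Probability" "HOL-Combinatorics.Permutations"
begin

text \<open>The set \<open>A(\<pi>)\<close> of a permutation \<open>\<pi>\<close> of \<open>{1..n}\<close>: pairs of values in order of appearance.\<close>

definition appearance_order :: "nat \<Rightarrow> (nat \<Rightarrow> nat) \<Rightarrow> (nat \<times> nat) set" where
  "appearance_order n \<pi> = {(\<pi> i, \<pi> j) | i j. i \<in> {1..n} \<and> j \<in> {1..n} \<and> i < j}"

text \<open>The permutation is a function that fixes everything outside \<open>{1..length}\<close>,
  so the length has to be a component of its own.\<close>

datatype vincular_pattern =
  Vincular (pat_length: nat) (pat_perm: "nat \<Rightarrow> nat") (pat_adj: "nat set")

definition is_vincular_pattern :: "vincular_pattern \<Rightarrow> bool" where
  "is_vincular_pattern P \<longleftrightarrow>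
     pat_length P \<ge> 1 \<and>
     pat_perm P permutes {1..pat_length P} \<and>
     pat_adj P \<subseteq> {1..pat_length P - 1}"

text \<open>Tuples \<open>(t\<^sub>1, \<dots>, t\<^sub>k)\<close> are extensional functions on \<open>{1..k}\<close>, so that they can be counted.\<close>

definition occurrences :: "vincular_pattern \<Rightarrow> nat \<Rightarrow> (nat \<Rightarrow> nat) \<Rightarrow> (nat \<Rightarrow> nat) set" where
  "occurrences P n \<pi> =
     {t \<in> {1..pat_length P} \<rightarrow>\<^sub>E {1..n}.
        strict_mono_on {1..pat_length P} t \<and>
        (\<forall>a\<in>{1..pat_length P}. \<forall>b\<in>{1..pat_length P}.
           (t a, t b) \<in> appearance_order n \<pi> \<longleftrightarrow>
           (a, b) \<in> appearance_order (pat_length P) (pat_perm P)) \<and>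
        (\<forall>i\<in>pat_adj P. inv \<pi> (t (pat_perm P (i + 1))) = inv \<pi> (t (pat_perm P i)) + 1)}"

definition linked_groups :: "vincular_pattern \<Rightarrow> nat set set" where
  "linked_groups P =
     {{a..b} | a b. 1 \<le> a \<and> a \<le> b \<and> b \<le> pat_length P \<and> {a..<b} \<subseteq> pat_adj P}"

definition blocks :: "vincular_pattern \<Rightarrow> nat set set" where
  "blocks P = {B \<in> linked_groups P. \<forall>B'\<in>linked_groups P. B \<subseteq> B' \<longrightarrow> B' = B}"

definition num_blocks :: "vincular_pattern \<Rightarrow> nat" where
  "num_blocks P = card (blocks P)"

definition max_block_size :: "vincular_pattern \<Rightarrow> nat" where
  "max_block_size P = Max (card ` blocks P)"

definition is_merge ::
  "vincular_pattern \<Rightarrow> vincular_pattern \<Rightarrow> vincular_pattern \<Rightarrow> (nat \<Rightarrow> nat) \<Rightarrow> (nat \<Rightarrow> nat) \<Rightarrow> bool"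
where
  "is_merge P\<^sub>1 P\<^sub>2 P\<^sub>3 m\<^sub>1 m\<^sub>2 \<longleftrightarrow>
     (let k\<^sub>1 = pat_length P\<^sub>1; k\<^sub>2 = pat_length P\<^sub>2; k\<^sub>3 = pat_length P\<^sub>3;
          x = pat_perm P\<^sub>1; y = pat_perm P\<^sub>2; z = pat_perm P\<^sub>3 in
      m\<^sub>1 \<in> {1..k\<^sub>1} \<rightarrow>\<^sub>E {1..k\<^sub>3} \<and> strict_mono_on {1..k\<^sub>1} m\<^sub>1 \<and>
      m\<^sub>2 \<in> {1..k\<^sub>2} \<rightarrow>\<^sub>E {1..k\<^sub>3} \<and> strict_mono_on {1..k\<^sub>2} m\<^sub>2 \<and>
      m\<^sub>1 ` {1..k\<^sub>1} \<union> m\<^sub>2 ` {1..k\<^sub>2} = {1..k\<^sub>3} \<and>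
      (\<forall>a\<in>{1..k\<^sub>1}. \<forall>b\<in>{1..k\<^sub>1}.
         (m\<^sub>1 a, m\<^sub>1 b) \<in> appearance_order k\<^sub>3 z \<longleftrightarrow> (a, b) \<in> appearance_order k\<^sub>1 x) \<and>
      (\<forall>a\<in>{1..k\<^sub>2}. \<forall>b\<in>{1..k\<^sub>2}.
         (m\<^sub>2 a, m\<^sub>2 b) \<in> appearance_order k\<^sub>3 z \<longleftrightarrow> (a, b) \<in> appearance_order k\<^sub>2 y) \<and>
      (\<forall>i\<in>pat_adj P\<^sub>1. inv z (m\<^sub>1 (x (i + 1))) = inv z (m\<^sub>1 (x i)) + 1) \<and>
      (\<forall>i\<in>pat_adj P\<^sub>2. inv z (m\<^sub>2 (y (i + 1))) = inv z (m\<^sub>2 (y i)) + 1) \<and>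
      pat_adj P\<^sub>3 = (\<lambda>i. inv z (m\<^sub>1 (x i))) ` pat_adj P\<^sub>1 \<union> (\<lambda>i. inv z (m\<^sub>2 (y i))) ` pat_adj P\<^sub>2)"

definition num_self_merges :: "vincular_pattern \<Rightarrow> nat \<Rightarrow> nat \<Rightarrow> nat" where
  "num_self_merges P p q =
     card {(P\<^sub>3, m\<^sub>1, m\<^sub>2). is_vincular_pattern P\<^sub>3 \<and> is_merge P P P\<^sub>3 m\<^sub>1 m\<^sub>2 \<and>
                        pat_length P\<^sub>3 = p \<and> num_blocks P\<^sub>3 = q}"

text \<open>For \<open>l > n\<close> the product contains the factor \<open>n - n = 0\<close>, so truncated subtraction is harmless.\<close>

definition falling_factorial :: "nat \<Rightarrow> nat \<Rightarrow> nat" where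
  "falling_factorial n l = (\<Prod>i<l. n - i)"

definition occurrence_variance :: "vincular_pattern \<Rightarrow> nat \<Rightarrow> real" where
  "occurrence_variance P n =
     measure_pmf.variance (pmf_of_set {\<pi>. \<pi> permutes {1..n}})
       (\<lambda>\<pi>. real (card (occurrences P n \<pi>)))"

end

theory Submission
  imports Defs
begin

text \<open>
  The two sides of the equivalence are not linked by a formula for the variance: for length
  \<open>k \<ge> 2\<close> both are true, and for \<open>k = 1\<close> both are false, because then \<open>X\<^sub>n = n\<close> is constant.
  For \<open>k \<ge> 2\<close> the growth of the variance is shown first, and the inequality between merge
  numbers is deduced from it.

  An occurrence is recorded by its positions instead of its values. The position tuples are the
  increasing maps \<open>u\<close> from \<open>{1..k}\<close> to \<open>{1..n}\<close> that take consecutive values along every block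
  (\<open>embeddings\<close>), and \<open>X\<^sub>n\<close> counts those \<open>u\<close> on which the permutation has the order type of the
  pattern. The adjacency conditions concern \<open>u\<close> alone, so by symmetry each \<open>u\<close> is an occurrence
  with probability \<open>1 / k!\<close>, and \<open>u\<close>, \<open>v\<close> with disjoint ranges are independent. Therefore the
  variance is the sum of \<open>Pr(u and v occur) - 1 / k!\<^sup>2\<close> over the pairs \<open>(u, v)\<close> whose ranges meet
  (\<open>occurrence_variance_overlapping\<close>).

  \<^bold>\<open>From growth to the inequality.\<close> If \<open>u\<close> and \<open>v\<close> both occur and their ranges meet, the pattern that
  the permutation induces on the union of the ranges is a merge of two copies of the pattern with
  fewer than \<open>2k\<close> letters. A merge with \<open>p\<close> letters and \<open>q\<close> blocks accounts for at most
  \<open>(n choose q) / p!\<close> of the sum. Sharing \<open>l \<ge> 1\<close> letters costs at least one block, so \<open>q \<le> 2j - 1\<close>;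
  when \<open>q = 2j - 1\<close> the shared letters form a run inside one block, so \<open>l\<close> is at most the maximal
  block size (\<open>merge_num_blocks\<close>). On the other hand, choosing \<open>2j - 1\<close> well separated block starts,
  of which one is common to \<open>u\<close> and \<open>v\<close>, gives at least
  \<open>((2j - 1) choose j) * j * n^(2j - 1) / (2j - 1)!\<close> overlapping pairs up to lower order
  (\<open>card_overlapping_pairs_ge\<close>). Comparing the coefficients of \<open>n^(2j - 1)\<close> and multiplying by
  \<open>(2k)!\<close> turns a lower bound \<open>c * n^(2j - 1)\<close>, \<open>c > 0\<close>, for the variance into the strict inequality
  (\<open>merge_inequality_if_variance_growth\<close>). If some block has more
  than one letter, there are further pairs that meet without sharing a block start, so the
  inequality says less than that the coefficient of \<open>n^(2j - 1)\<close> in the variance is positive; it is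
  this positivity that the proof establishes.

  \<^bold>\<open>Growth for several blocks.\<close> By Cauchy--Schwarz it suffices to find a statistic \<open>Y\<close> with
  \<open>Var(Y) \<le> n\<close> whose covariance with \<open>X\<^sub>n\<close> is of order \<open>n^j\<close>. Take for \<open>Y\<close> the number of positions
  \<open>p \<le> m\<close> carrying a value \<open>\<le> m\<close>, where \<open>m\<close> is a small constant fraction of \<open>n\<close>. Only embeddings
  that reach down to \<open>{1..m}\<close> contribute to the covariance, and for most of them exactly the first
  block lies there. A small value at a position of \<open>u\<close> favours the occurrence if this position
  plays the role of the smallest letter and disfavours it otherwise. If the smallest letter lies
  in the first block, its gain outweighs the losses of the at most \<open>k - 2\<close> other letters of this
  block; if not, there are only losses. In either case all these embeddings contribute with the
  same sign (\<open>covariance_bound\<close>).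

  \<^bold>\<open>Growth for one block.\<close> Each embedding overlaps at most \<open>2k - 1\<close> embeddings, so the diagonal pairs
  alone give a variance of at least a multiple of \<open>k! - (2k - 1)\<close> times \<open>n\<close>, which is enough for
  \<open>k \<ge> 3\<close>. For \<open>k = 2\<close> the neighbouring pairs, which occur together with probability \<open>1/6\<close>, tip
  the balance.

  Finally the variance is positive for every \<open>n \<ge> k\<close> (\<open>variance_positive\<close>), which turns growth for
  large \<open>n\<close> into growth for all \<open>n \<ge> k\<close>.
\<close>

section \<open>Ranks in finite sets and the symmetry of a random permutation\<close>

definition rank_in :: "nat set \<Rightarrow> nat \<Rightarrow> nat" where
  "rank_in V v = card {y \<in> V. y \<le> v}"

definition enum_of :: "nat set \<Rightarrow> nat \<Rightarrow> nat" where
  "enum_of V = inv_into V (rank_in V)"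

lemma rank_in_strict_mono:
  assumes "finite V"
  shows "strict_mono_on V (rank_in V)"
proof (rule strict_mono_onI)
  fix r s assume *: "r \<in> V" "s \<in> V" "r < s"
  have "s \<in> {y \<in> V. y \<le> s} - {y \<in> V. y \<le> r}" "{y \<in> V. y \<le> r} \<subseteq> {y \<in> V. y \<le> s}" using * by auto
  hence "{y \<in> V. y \<le> r} \<subset> {y \<in> V. y \<le> s}" by blast
  thus "rank_in V r < rank_in V s" unfolding rank_in_def using assms by (intro psubset_card_mono) auto
qed

lemma rank_in_bij:
  assumes "finite V"
  shows "bij_betw (rank_in V) V {1..card V}"
proof -
  have inj: "inj_on (rank_in V) V"
    using rank_in_strict_mono[OF assms] strict_mono_on_imp_inj_on by blast
  have "rank_in V v \<in> {1..card V}" if "v \<in> V" for v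
  proof -
    have "card {v} \<le> rank_in V v" unfolding rank_in_def
      using assms that by (intro card_mono) auto
    moreover have "rank_in V v \<le> card V" unfolding rank_in_def
      using assms by (intro card_mono) auto
    ultimately show ?thesis by simp
  qed
  hence "rank_in V ` V \<subseteq> {1..card V}" by blast
  moreover have "card (rank_in V ` V) = card {1..card V}" using inj by (simp add: card_image)
  ultimately have "rank_in V ` V = {1..card V}" by (simp add: card_subset_eq)
  with inj show ?thesis by (simp add: bij_betw_def)
qed

lemma rank_in_range: "finite V \<Longrightarrow> v \<in> V \<Longrightarrow> rank_in V v \<in> {1..card V}"
  using rank_in_bij bij_betwE by blast

lemma enum_of_bij: "finite V \<Longrightarrow> bij_betw (enum_of V) {1..card V} V"
  unfolding enum_of_def by (intro bij_betw_inv_into rank_in_bij)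

lemma enum_of_mem: "finite V \<Longrightarrow> i \<in> {1..card V} \<Longrightarrow> enum_of V i \<in> V"
  using enum_of_bij bij_betwE by blast

lemma rank_enum: "finite V \<Longrightarrow> i \<in> {1..card V} \<Longrightarrow> rank_in V (enum_of V i) = i"
  unfolding enum_of_def by (rule bij_betw_inv_into_right[OF rank_in_bij])

lemma enum_rank: "finite V \<Longrightarrow> v \<in> V \<Longrightarrow> enum_of V (rank_in V v) = v"
  unfolding enum_of_def by (rule bij_betw_inv_into_left[OF rank_in_bij])

lemma rank_in_less_iff: "finite V \<Longrightarrow> v \<in> V \<Longrightarrow> w \<in> V \<Longrightarrow> rank_in V v < rank_in V w \<longleftrightarrow> v < w"
  using rank_in_strict_mono unfolding strict_mono_on_def by (metis less_asym linorder_neqE_nat)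

lemma enum_of_strict_mono: "finite V \<Longrightarrow> strict_mono_on {1..card V} (enum_of V)"
  unfolding strict_mono_on_def by (metis enum_of_mem rank_enum rank_in_less_iff)

lemma rank_in_image:
  assumes "strict_mono_on S f" "x \<in> S"
  shows "rank_in (f ` S) (f x) = rank_in S x"
proof -
  have le: "f y \<le> f x \<longleftrightarrow> y \<le> x" if "y \<in> S" for y
    using assms that strict_mono_on_less_eq by blast
  have "{y \<in> f ` S. y \<le> f x} = f ` {y \<in> S. y \<le> x}" using le by auto
  moreover have "inj_on f {y \<in> S. y \<le> x}"
    using strict_mono_on_imp_inj_on[OF assms(1)] by (rule inj_on_subset) auto
  ultimately show ?thesis unfolding rank_in_def by (simp add: card_image)
qed

text \<open>On a finite set a strictly increasing map sends each element to the element of the image with the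
  same rank.\<close>

lemma strict_mono_on_same_image:
  fixes f g :: "nat \<Rightarrow> nat"
  assumes "finite S" "strict_mono_on S f" "strict_mono_on S g" "f ` S = g ` S" "x \<in> S"
  shows "f x = g x"
proof -
  have "rank_in (f ` S) (f x) = rank_in (f ` S) (g x)"
    using rank_in_image[OF assms(2,5)] rank_in_image[OF assms(3,5)] assms(4) by simp
  moreover have "f x \<in> f ` S" "g x \<in> f ` S" using assms by auto
  ultimately show ?thesis using assms(1) enum_rank finite_imageI by metis
qed

text \<open>If \<open>A\<close> is stable under permuting the positions in the range of \<open>w\<close>, then rearranging these
  positions shows that every order type along \<open>w\<close> is attained equally often in \<open>A\<close>. All
  probabilities below are computed with this lemma; the set \<open>A\<close> allows conditioning on events that
  concern the other positions.\<close>

lemma card_increasing_along: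
  fixes w :: "nat \<Rightarrow> nat"
  assumes inj: "inj_on w {1..p}"
    and A: "A \<subseteq> {\<pi>. \<pi> permutes {1..n}}"
    and inv: "\<And>\<pi> \<rho>. \<pi> \<in> A \<Longrightarrow> \<rho> permutes (w ` {1..p}) \<Longrightarrow> \<pi> \<circ> \<rho> \<in> A"
  shows "card {\<pi>\<in>A. strict_mono_on {1..p} (\<lambda>a. \<pi> (w a))} * fact p = card A"
proof -
  let ?T = "{\<tau>. \<tau> permutes {1..p}}"
  let ?F = "\<lambda>\<tau>. {\<pi>\<in>A. strict_mono_on {1..p} (\<lambda>a. \<pi> (w (\<tau> a)))}"
  have finA: "finite A" using A finite_permutations[of "{1..n}"] finite_subset by blast
  have inj\<pi>: "inj_on (\<lambda>a. \<pi> (w a)) {1..p}" if "\<pi> \<in> A" for \<pi>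
  proof -
    have "inj \<pi>" using that A permutes_inj by blast
    thus ?thesis using inj unfolding inj_on_def by (meson UNIV_I)
  qed
  have part: "A = (\<Union>\<tau>\<in>?T. ?F \<tau>)"
  proof (intro equalityI subsetI)
    fix \<pi> assume \<pi>: "\<pi> \<in> A"
    define f where "f = (\<lambda>a. \<pi> (w a))"
    define V where "V = f ` {1..p}"
    have fV: "finite V" and cV: "card V = p"
      using inj\<pi>[OF \<pi>] by (auto simp: V_def f_def card_image)
    define \<tau> where "\<tau> = (\<lambda>i. if i \<in> {1..p} then inv_into {1..p} f (enum_of V i) else i)"
    have b1: "bij_betw (inv_into {1..p} f) V {1..p}"
      unfolding V_def f_def using inj\<pi>[OF \<pi>] by (intro bij_betw_inv_into) (simp add: bij_betw_def)
    have b2: "bij_betw (enum_of V) {1..p} V" using enum_of_bij[OF fV] cV by simp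
    have "bij_betw (inv_into {1..p} f \<circ> enum_of V) {1..p} {1..p}"
      using b1 b2 bij_betw_trans by blast
    hence "bij_betw \<tau> {1..p} {1..p}" by (rule bij_betw_cong[THEN iffD1, rotated]) (simp add: \<tau>_def)
    hence "\<tau> permutes {1..p}" by (intro bij_imp_permutes) (auto simp: \<tau>_def)
    moreover have "f (\<tau> i) = enum_of V i" if "i \<in> {1..p}" for i
      using that enum_of_mem[OF fV] cV unfolding \<tau>_def by (simp add: V_def f_inv_into_f)
    hence "strict_mono_on {1..p} (\<lambda>i. f (\<tau> i))"
      using enum_of_strict_mono[OF fV] cV unfolding strict_mono_on_def by simp
    ultimately show "\<pi> \<in> (\<Union>\<tau>\<in>?T. ?F \<tau>)" using \<pi> by (auto simp: f_def)
  qed auto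
  have disj: "?F \<tau> \<inter> ?F \<tau>' = {}" if "\<tau> \<in> ?T" "\<tau>' \<in> ?T" "\<tau> \<noteq> \<tau>'" for \<tau> \<tau>'
  proof (rule ccontr)
    assume "?F \<tau> \<inter> ?F \<tau>' \<noteq> {}"
    then obtain \<pi> where \<pi>: "\<pi> \<in> A" and s: "strict_mono_on {1..p} (\<lambda>a. \<pi> (w (\<tau> a)))"
       "strict_mono_on {1..p} (\<lambda>a. \<pi> (w (\<tau>' a)))" by auto
    have im: "\<tau> ` {1..p} = {1..p}" "\<tau>' ` {1..p} = {1..p}"
      using that permutes_image by auto
    have "\<tau> a = \<tau>' a" if a: "a \<in> {1..p}" for a
    proof -
      have "(\<lambda>a. \<pi> (w (\<tau> a))) ` {1..p} = (\<lambda>b. \<pi> (w b)) ` (\<tau> ` {1..p})" by auto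
      moreover have "(\<lambda>a. \<pi> (w (\<tau>' a))) ` {1..p} = (\<lambda>b. \<pi> (w b)) ` (\<tau>' ` {1..p})" by auto
      ultimately have "\<pi> (w (\<tau> a)) = \<pi> (w (\<tau>' a))"
        using strict_mono_on_same_image[OF _ s _ a] im by simp
      moreover have "\<tau> a \<in> {1..p}" "\<tau>' a \<in> {1..p}" using im a by blast+
      ultimately show ?thesis using inj\<pi>[OF \<pi>] by (auto dest: inj_onD)
    qed
    moreover have "\<tau> a = \<tau>' a" if "a \<notin> {1..p}" for a
      using \<open>\<tau> \<in> ?T\<close> \<open>\<tau>' \<in> ?T\<close> that permutes_not_in by (metis mem_Collect_eq)
    ultimately have "\<tau> = \<tau>'" by blast
    with that show False by simp
  qed
  have same: "card (?F \<tau>) = card (?F id)" if \<tau>: "\<tau> \<in> ?T" for \<tau>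
  proof -
    let ?W = "w ` {1..p}"
    define \<rho> where "\<rho> = (\<lambda>x. if x \<in> ?W then w (\<tau> (inv_into {1..p} w x)) else x)"
    have \<rho>: "\<rho> permutes ?W" unfolding \<rho>_def using \<tau> inj
      by (intro permutes_bij_inv_into) (auto simp: bij_betw_def)
    have \<rho>w: "\<rho> (w i) = w (\<tau> i)" if "i \<in> {1..p}" for i
      using that inj unfolding \<rho>_def by simp
    have \<rho>i: "inv \<rho> (w (\<tau> i)) = w i" if "i \<in> {1..p}" for i
      using \<rho>w[OF that] \<rho> by (metis permutes_inverses(2))
    have c: "\<rho> \<circ> inv \<rho> = id" "inv \<rho> \<circ> \<rho> = id" using \<rho> permutes_inv_o by blast+
    have "bij_betw (\<lambda>\<pi>. \<pi> \<circ> \<rho>) (?F \<tau>) (?F id)"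
    proof (rule bij_betw_byWitness[where f' = "\<lambda>\<pi>. \<pi> \<circ> inv \<rho>"])
      show "\<forall>a\<in>?F \<tau>. a \<circ> \<rho> \<circ> inv \<rho> = a" by (simp add: comp_assoc c)
      show "\<forall>a\<in>?F id. a \<circ> inv \<rho> \<circ> \<rho> = a" by (simp add: comp_assoc c)
      show "(\<lambda>\<pi>. \<pi> \<circ> \<rho>) ` ?F \<tau> \<subseteq> ?F id"
        using inv \<rho> \<rho>w by (auto simp: strict_mono_on_def)
      show "(\<lambda>\<pi>. \<pi> \<circ> inv \<rho>) ` ?F id \<subseteq> ?F \<tau>"
        using inv permutes_inv[OF \<rho>] \<rho>i by (auto simp: strict_mono_on_def)
    qed
    thus ?thesis by (rule bij_betw_same_card)
  qed
  have "card A = card (\<Union>\<tau>\<in>?T. ?F \<tau>)" using part by simp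
  also have "\<dots> = (\<Sum>\<tau>\<in>?T. card (?F \<tau>))"
    using finA disj finite_permutations[of "{1..p}"] by (intro card_UN_disjoint) auto
  also have "\<dots> = (\<Sum>\<tau>\<in>?T. card (?F id))" by (intro sum.cong same) auto
  also have "\<dots> = card ?T * card (?F id)" by simp
  also have "card ?T = fact p" by (rule card_permutations) auto
  finally show ?thesis by (simp add: mult.commute)
qed

definition perm_prob :: "nat \<Rightarrow> ((nat \<Rightarrow> nat) \<Rightarrow> bool) \<Rightarrow> real" where
  "perm_prob n Q = real (card {\<pi>. \<pi> permutes {1..n} \<and> Q \<pi>}) / fact n"

lemma finite_perm_set: "finite {\<pi>. \<pi> permutes {1..n::nat} \<and> Q \<pi>}"
  by (rule finite_subset[OF _ finite_permutations[of "{1..n}"]]) auto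

lemma perm_prob_mono:
  "(\<And>\<pi>. \<pi> permutes {1..n} \<Longrightarrow> Q \<pi> \<Longrightarrow> R \<pi>) \<Longrightarrow> perm_prob n Q \<le> perm_prob n R"
  unfolding perm_prob_def
  by (intro divide_right_mono of_nat_mono card_mono finite_perm_set) auto

lemma perm_prob_nonneg: "0 \<le> perm_prob n Q"
  unfolding perm_prob_def by simp

lemma perm_prob_disj:
  "perm_prob n (\<lambda>\<pi>. Q \<pi> \<or> R \<pi>) \<le> perm_prob n Q + perm_prob n R"
proof -
  have "{\<pi>. \<pi> permutes {1..n} \<and> (Q \<pi> \<or> R \<pi>)} = {\<pi>. \<pi> permutes {1..n} \<and> Q \<pi>} \<union> {\<pi>. \<pi> permutes {1..n} \<and> R \<pi>}"
    by auto
  hence "card {\<pi>. \<pi> permutes {1..n} \<and> (Q \<pi> \<or> R \<pi>)} \<le> card {\<pi>. \<pi> permutes {1..n} \<and> Q \<pi>} + card {\<pi>. \<pi> permutes {1..n} \<and> R \<pi>}"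
    by (simp add: card_Un_le)
  thus ?thesis unfolding perm_prob_def
    by (simp add: add_divide_distrib[symmetric] divide_right_mono)
qed

lemma perm_prob_True: "perm_prob n (\<lambda>_. True) = 1"
proof -
  have "card {\<pi>. \<pi> permutes {1..n}} = fact n" by (rule card_permutations) auto
  thus ?thesis unfolding perm_prob_def by simp
qed

lemma perm_prob_increasing_along:
  assumes "inj_on w {1..p}" "w ` {1..p} \<subseteq> {1..n}"
    and "\<And>\<pi> \<rho>. \<pi> permutes {1..n} \<Longrightarrow> Q \<pi> \<Longrightarrow> \<rho> permutes (w ` {1..p}) \<Longrightarrow> Q (\<pi> \<circ> \<rho>)"
  shows "perm_prob n (\<lambda>\<pi>. Q \<pi> \<and> strict_mono_on {1..p} (\<lambda>a. \<pi> (w a))) = perm_prob n Q / fact p"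
proof -
  let ?A = "{\<pi>. \<pi> permutes {1..n} \<and> Q \<pi>}"
  have "card {\<pi>\<in>?A. strict_mono_on {1..p} (\<lambda>a. \<pi> (w a))} * fact p = card ?A"
  proof (rule card_increasing_along[OF assms(1)])
    fix \<pi> \<rho> assume *: "\<pi> \<in> ?A" "\<rho> permutes (w ` {1..p})"
    hence "\<rho> permutes {1..n}" using assms(2) permutes_subset by blast
    thus "\<pi> \<circ> \<rho> \<in> ?A" using * assms(3) by (simp add: permutes_compose)
  qed auto
  hence "real (card {\<pi>\<in>?A. strict_mono_on {1..p} (\<lambda>a. \<pi> (w a))}) * fact p = card ?A"
    using arg_cong[where f=real] by fastforce
  moreover have "{\<pi>. \<pi> permutes {1..n} \<and> (Q \<pi> \<and> strict_mono_on {1..p} (\<lambda>a. \<pi> (w a)))}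
     = {\<pi>\<in>?A. strict_mono_on {1..p} (\<lambda>a. \<pi> (w a))}" by auto
  ultimately show ?thesis unfolding perm_prob_def by (simp add: field_simps)
qed

section \<open>Occurrences as embeddings, and the variance as a sum over overlapping pairs\<close>

text \<open>Position tuples of possible occurrences: only the adjacency condition, which does not involve
  the permutation, is imposed.\<close>

definition embeddings :: "vincular_pattern \<Rightarrow> nat \<Rightarrow> (nat \<Rightarrow> nat) set" where
  "embeddings P n =
     {u \<in> {1..pat_length P} \<rightarrow>\<^sub>E {1..n}. strict_mono_on {1..pat_length P} u \<and>
        (\<forall>i\<in>pat_adj P. u (i + 1) = u i + 1)}"

text \<open>The letter \<open>a\<close> of the pattern stands at position \<open>inv (pat_perm P) a\<close> of the pattern, hence at
  position \<open>u (inv (pat_perm P) a)\<close> of the permutation.\<close>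

definition occurs_at :: "vincular_pattern \<Rightarrow> (nat \<Rightarrow> nat) \<Rightarrow> (nat \<Rightarrow> nat) \<Rightarrow> bool" where
  "occurs_at P u \<pi> \<longleftrightarrow> strict_mono_on {1..pat_length P} (\<lambda>a. \<pi> (u (inv (pat_perm P) a)))"

lemma finite_embeddings: "finite (embeddings P n)"
  unfolding embeddings_def by (rule finite_subset[OF _ finite_PiE[of "{1..pat_length P}" "\<lambda>_. {1..n}"]]) auto

lemma pattern_adj_range:
  assumes "is_vincular_pattern P" "i \<in> pat_adj P"
  shows "i \<in> {1..pat_length P}" "i + 1 \<in> {1..pat_length P}"
proof -
  have "i \<in> {1..pat_length P - 1}" using assms unfolding is_vincular_pattern_def by blast
  thus "i \<in> {1..pat_length P}" "i + 1 \<in> {1..pat_length P}" by auto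
qed

lemma appearance_order_iff:
  assumes \<pi>: "\<pi> permutes {1..n}" and uv: "u \<in> {1..n}" "v \<in> {1..n}"
  shows "(u, v) \<in> appearance_order n \<pi> \<longleftrightarrow> inv \<pi> u < inv \<pi> v"
proof
  assume "(u, v) \<in> appearance_order n \<pi>"
  then obtain i j where "u = \<pi> i" "v = \<pi> j" "i < j" unfolding appearance_order_def by auto
  thus "inv \<pi> u < inv \<pi> v" using permutes_inverses(2)[OF \<pi>] by simp
next
  assume *: "inv \<pi> u < inv \<pi> v"
  have "inv \<pi> u \<in> {1..n}" "inv \<pi> v \<in> {1..n}"
    using uv permutes_in_image[OF permutes_inv[OF \<pi>]] by blast+
  moreover have "u = \<pi> (inv \<pi> u)" "v = \<pi> (inv \<pi> v)" using permutes_inverses(1)[OF \<pi>] by simp_all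
  ultimately show "(u, v) \<in> appearance_order n \<pi>" using * unfolding appearance_order_def by blast
qed

text \<open>Passing from the values \<open>t\<close> of an occurrence to their positions and back. The condition on
  appearance orders becomes monotonicity of the positions.\<close>

lemma card_occurrences:
  assumes P: "is_vincular_pattern P" and \<pi>: "\<pi> permutes {1..n}"
  shows "card (occurrences P n \<pi>) = card {u \<in> embeddings P n. occurs_at P u \<pi>}"
proof -
  let ?k = "pat_length P" and ?s = "pat_perm P"
  have s: "?s permutes {1..?k}" using P unfolding is_vincular_pattern_def by blast
  have si: "inv ?s permutes {1..?k}" by (rule permutes_inv[OF s])
  have pi: "inv \<pi> permutes {1..n}" by (rule permutes_inv[OF \<pi>])
  have sin: "?s i \<in> {1..?k} \<longleftrightarrow> i \<in> {1..?k}" "inv ?s i \<in> {1..?k} \<longleftrightarrow> i \<in> {1..?k}" for i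
    using permutes_in_image[OF s] permutes_in_image[OF si] by blast+
  have pin: "\<pi> i \<in> {1..n} \<longleftrightarrow> i \<in> {1..n}" "inv \<pi> i \<in> {1..n} \<longleftrightarrow> i \<in> {1..n}" for i
    using permutes_in_image[OF \<pi>] permutes_in_image[OF pi] by blast+
  have sinv: "?s (inv ?s a) = a" "inv ?s (?s a) = a" for a using permutes_inverses[OF s] by auto
  have pinv: "\<pi> (inv \<pi> a) = a" "inv \<pi> (\<pi> a) = a" for a using permutes_inverses[OF \<pi>] by auto
  define F where "F = (\<lambda>t. \<lambda>i\<in>{1..?k}. inv \<pi> (t (?s i)))"
  define G where "G = (\<lambda>u. \<lambda>a\<in>{1..?k}. \<pi> (u (inv ?s a)))"
  have "bij_betw F (occurrences P n \<pi>) {u \<in> embeddings P n. occurs_at P u \<pi>}"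
  proof (rule bij_betw_byWitness[where f' = G])
    show "\<forall>t\<in>occurrences P n \<pi>. G (F t) = t"
    proof
      fix t assume "t \<in> occurrences P n \<pi>"
      hence "t \<in> extensional {1..?k}" unfolding occurrences_def PiE_def by blast
      moreover have "G (F t) \<in> extensional {1..?k}" by (simp add: G_def)
      moreover have "G (F t) a = t a" if "a \<in> {1..?k}" for a
        using that sin(2)[of a] by (simp add: F_def G_def sinv pinv)
      ultimately show "G (F t) = t" by (intro extensionalityI[of _ "{1..?k}"]) auto
    qed
    show "\<forall>u\<in>{u \<in> embeddings P n. occurs_at P u \<pi>}. F (G u) = u"
    proof
      fix u assume "u \<in> {u \<in> embeddings P n. occurs_at P u \<pi>}"
      hence "u \<in> extensional {1..?k}" unfolding embeddings_def PiE_def by blast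
      moreover have "F (G u) \<in> extensional {1..?k}" by (simp add: F_def)
      moreover have "F (G u) a = u a" if "a \<in> {1..?k}" for a
        using that sin(1)[of a] by (simp add: F_def G_def sinv pinv)
      ultimately show "F (G u) = u" by (intro extensionalityI[of _ "{1..?k}"]) auto
    qed
    show "F ` occurrences P n \<pi> \<subseteq> {u \<in> embeddings P n. occurs_at P u \<pi>}"
    proof
      fix u assume "u \<in> F ` occurrences P n \<pi>"
      then obtain t where t: "t \<in> occurrences P n \<pi>" and u: "u = F t" by blast
      have tin: "t a \<in> {1..n}" if "a \<in> {1..?k}" for a
        using t that unfolding occurrences_def by blast
      have tm: "strict_mono_on {1..?k} t" using t unfolding occurrences_def by blast
      have ord: "inv \<pi> (t a) < inv \<pi> (t b) \<longleftrightarrow> inv ?s a < inv ?s b" if "a \<in> {1..?k}" "b \<in> {1..?k}" for a b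
        using t that tin appearance_order_iff[OF \<pi>] appearance_order_iff[OF s]
        unfolding occurrences_def by blast
      have ui: "u i = inv \<pi> (t (?s i))" if "i \<in> {1..?k}" for i using that by (simp add: u F_def)
      have "u \<in> {1..?k} \<rightarrow>\<^sub>E {1..n}"
        unfolding u F_def using tin sin(1) pin(2) by (intro restrict_PiE_iff[THEN iffD2]) blast
      moreover have "strict_mono_on {1..?k} u"
      proof (rule strict_mono_onI)
        fix i i' assume "i \<in> {1..?k}" "i' \<in> {1..?k}" "i < i'"
        thus "u i < u i'" using ord[of "?s i" "?s i'"] sin(1) ui sinv(2) by simp
      qed
      moreover have "u (i + 1) = u i + 1" if "i \<in> pat_adj P" for i
        using t that ui pattern_adj_range[OF P that] unfolding occurrences_def by simp
      moreover have "\<pi> (u (inv ?s a)) = t a" if "a \<in> {1..?k}" for a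
        using that ui[of "inv ?s a"] sin(2)[of a] by (simp add: sinv pinv)
      hence "occurs_at P u \<pi>" using tm unfolding occurs_at_def strict_mono_on_def by simp
      ultimately show "u \<in> {u \<in> embeddings P n. occurs_at P u \<pi>}" unfolding embeddings_def by blast
    qed
    show "G ` {u \<in> embeddings P n. occurs_at P u \<pi>} \<subseteq> occurrences P n \<pi>"
    proof
      fix t assume "t \<in> G ` {u \<in> embeddings P n. occurs_at P u \<pi>}"
      then obtain u where u: "u \<in> embeddings P n" "occurs_at P u \<pi>" and t: "t = G u" by blast
      have uin: "u a \<in> {1..n}" if "a \<in> {1..?k}" for a
        using u that unfolding embeddings_def by blast
      have um: "strict_mono_on {1..?k} u" using u unfolding embeddings_def by blast
      have ta: "t a = \<pi> (u (inv ?s a))" if "a \<in> {1..?k}" for a using that by (simp add: t G_def)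
      have tP: "t \<in> {1..?k} \<rightarrow>\<^sub>E {1..n}"
        unfolding t G_def using uin sin(2) pin(1) by (intro restrict_PiE_iff[THEN iffD2]) blast
      moreover have "strict_mono_on {1..?k} t"
        using u(2) ta unfolding occurs_at_def strict_mono_on_def by simp
      moreover have "(t a, t b) \<in> appearance_order n \<pi> \<longleftrightarrow> (a, b) \<in> appearance_order ?k ?s"
        if ab: "a \<in> {1..?k}" "b \<in> {1..?k}" for a b
      proof -
        have "t a \<in> {1..n}" "t b \<in> {1..n}" using tP ab by blast+
        hence "(t a, t b) \<in> appearance_order n \<pi> \<longleftrightarrow> u (inv ?s a) < u (inv ?s b)"
          using appearance_order_iff[OF \<pi>] ta ab pinv by simp
        also have "\<dots> \<longleftrightarrow> inv ?s a < inv ?s b"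
          using um ab sin(2) strict_mono_on_less by blast
        also have "\<dots> \<longleftrightarrow> (a, b) \<in> appearance_order ?k ?s" using appearance_order_iff[OF s] ab by simp
        finally show ?thesis .
      qed
      moreover have "inv \<pi> (t (?s (i + 1))) = inv \<pi> (t (?s i)) + 1" if i: "i \<in> pat_adj P" for i
      proof -
        have "t (?s (i + 1)) = \<pi> (u (i + 1))" "t (?s i) = \<pi> (u i)"
          using ta sin(1) sinv(2) pattern_adj_range[OF P i] by metis+
        thus ?thesis using u(1) i pinv unfolding embeddings_def by simp
      qed
      ultimately show "t \<in> occurrences P n \<pi>" unfolding occurrences_def by blast
    qed
  qed
  thus ?thesis by (rule bij_betw_same_card)
qed

abbreviation range_of :: "vincular_pattern \<Rightarrow> (nat \<Rightarrow> nat) \<Rightarrow> nat set" where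
  "range_of P u \<equiv> u ` {1..pat_length P}"

lemma embedding_in: "u \<in> embeddings P n \<Longrightarrow> i \<in> {1..pat_length P} \<Longrightarrow> u i \<in> {1..n}"
  unfolding embeddings_def by blast

lemma embedding_mono: "u \<in> embeddings P n \<Longrightarrow> strict_mono_on {1..pat_length P} u"
  unfolding embeddings_def by blast

lemma embedding_less_iff: "u \<in> embeddings P n \<Longrightarrow> i \<in> {1..pat_length P} \<Longrightarrow> i' \<in> {1..pat_length P} \<Longrightarrow> u i < u i' \<longleftrightarrow> i < i'"
  by (rule strict_mono_on_less[OF embedding_mono])

lemma embedding_inj: "u \<in> embeddings P n \<Longrightarrow> inj_on u {1..pat_length P}"
  by (rule strict_mono_on_imp_inj_on[OF embedding_mono])

lemma embedding_adj: "u \<in> embeddings P n \<Longrightarrow> i \<in> pat_adj P \<Longrightarrow> u (i + 1) = u i + 1"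
  unfolding embeddings_def by blast

lemma pattern_perm: "is_vincular_pattern P \<Longrightarrow> pat_perm P permutes {1..pat_length P}"
  unfolding is_vincular_pattern_def by blast

lemma embedding_values_inj:
  assumes "is_vincular_pattern P" "u \<in> embeddings P n"
  shows "inj_on (\<lambda>a. u (inv (pat_perm P) a)) {1..pat_length P}"
    "(\<lambda>a. u (inv (pat_perm P) a)) ` {1..pat_length P} = range_of P u"
proof -
  have s: "inv (pat_perm P) permutes {1..pat_length P}"
    using pattern_perm[OF assms(1)] by (rule permutes_inv)
  have "bij_betw (inv (pat_perm P)) {1..pat_length P} {1..pat_length P}" by (rule permutes_imp_bij[OF s])
  moreover have "bij_betw u {1..pat_length P} (range_of P u)" using embedding_inj[OF assms(2)] by (simp add: bij_betw_def)
  ultimately have "bij_betw (u \<circ> inv (pat_perm P)) {1..pat_length P} (range_of P u)" by (rule bij_betw_trans)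
  thus "inj_on (\<lambda>a. u (inv (pat_perm P) a)) {1..pat_length P}"
    "(\<lambda>a. u (inv (pat_perm P) a)) ` {1..pat_length P} = range_of P u"
    unfolding bij_betw_def comp_def by auto
qed

lemma perm_prob_occurs_and:
  assumes P: "is_vincular_pattern P" and u: "u \<in> embeddings P n"
    and Q: "\<And>\<pi> \<rho>. \<pi> permutes {1..n} \<Longrightarrow> Q \<pi> \<Longrightarrow> \<rho> permutes range_of P u \<Longrightarrow> Q (\<pi> \<circ> \<rho>)"
  shows "perm_prob n (\<lambda>\<pi>. Q \<pi> \<and> occurs_at P u \<pi>) = perm_prob n Q / fact (pat_length P)"
  unfolding occurs_at_def
proof (rule perm_prob_increasing_along)
  show "inj_on (\<lambda>a. u (inv (pat_perm P) a)) {1..pat_length P}" by (rule embedding_values_inj[OF P u])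
  show "(\<lambda>a. u (inv (pat_perm P) a)) ` {1..pat_length P} \<subseteq> {1..n}"
    unfolding embedding_values_inj(2)[OF P u] by (rule image_subsetI) (rule embedding_in[OF u])
  fix \<pi> \<rho> assume "\<pi> permutes {1..n}" "Q \<pi>" "\<rho> permutes (\<lambda>a. u (inv (pat_perm P) a)) ` {1..pat_length P}"
  thus "Q (\<pi> \<circ> \<rho>)" unfolding embedding_values_inj(2)[OF P u] by (rule Q)
qed

lemma perm_prob_occurs:
  assumes P: "is_vincular_pattern P" and u: "u \<in> embeddings P n"
  shows "perm_prob n (occurs_at P u) = 1 / fact (pat_length P)"
  using perm_prob_occurs_and[OF P u, of "\<lambda>_. True"] by (simp add: perm_prob_True)

text \<open>Permuting the positions of \<open>v\<close> does not affect whether \<open>u\<close> occurs, so the two events are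
  independent.\<close>

lemma perm_prob_occurs_disjoint:
  assumes P: "is_vincular_pattern P" and u: "u \<in> embeddings P n" and v: "v \<in> embeddings P n"
    and disj: "range_of P u \<inter> range_of P v = {}"
  shows "perm_prob n (\<lambda>\<pi>. occurs_at P u \<pi> \<and> occurs_at P v \<pi>) = (1 / fact (pat_length P)) ^ 2"
proof -
  have "perm_prob n (\<lambda>\<pi>. occurs_at P u \<pi> \<and> occurs_at P v \<pi>)
     = perm_prob n (occurs_at P u) / fact (pat_length P)"
  proof (rule perm_prob_occurs_and[OF P v])
    fix \<pi> \<rho> assume \<pi>: "occurs_at P u \<pi>" and \<rho>: "\<rho> permutes range_of P v"
    have "\<rho> (u (inv (pat_perm P) a)) = u (inv (pat_perm P) a)" if "a \<in> {1..pat_length P}" for a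
    proof -
      have "u (inv (pat_perm P) a) \<in> range_of P u" using that embedding_values_inj(2)[OF P u] by blast
      hence "u (inv (pat_perm P) a) \<notin> range_of P v" using disj by blast
      thus ?thesis by (rule permutes_not_in[OF \<rho>])
    qed
    thus "occurs_at P u (\<pi> \<circ> \<rho>)" using \<pi> unfolding occurs_at_def strict_mono_on_def by simp
  qed
  thus ?thesis by (simp add: perm_prob_occurs[OF P u] power2_eq_square)
qed

definition perm_mean :: "nat \<Rightarrow> ((nat \<Rightarrow> nat) \<Rightarrow> real) \<Rightarrow> real" where
  "perm_mean n f = (\<Sum>\<pi> | \<pi> permutes {1..n}. f \<pi>) / fact n"

lemma finite_perms: "finite {\<pi>. \<pi> permutes {1..n::nat}}"
  by (rule finite_permutations) simp

lemma card_perms: "card {\<pi>. \<pi> permutes {1..n::nat}} = fact n"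
  by (rule card_permutations) auto

lemma expectation_perms:
  "measure_pmf.expectation (pmf_of_set {\<pi>. \<pi> permutes {1..n::nat}}) f = perm_mean n f"
proof -
  let ?S = "{\<pi>. \<pi> permutes {1..n::nat}}"
  have "id \<in> ?S" by (simp add: permutes_id)
  hence "?S \<noteq> {}" by (metis empty_iff)
  hence "measure_pmf.expectation (pmf_of_set ?S) f = sum f ?S / card ?S"
    by (rule integral_pmf_of_set[OF _ finite_perms])
  thus ?thesis unfolding perm_mean_def card_perms by simp
qed

lemma perm_mean_of_bool: "perm_mean n (\<lambda>\<pi>. of_bool (Q \<pi>)) = perm_prob n Q"
proof -
  have "(\<Sum>\<pi> | \<pi> permutes {1..n}. of_bool (Q \<pi>)) = real (card {\<pi>. \<pi> permutes {1..n} \<and> Q \<pi>})"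
    using finite_perms[of n] by (simp add: Int_def conj_commute)
  thus ?thesis unfolding perm_mean_def perm_prob_def by simp
qed

lemma perm_mean_sum: "perm_mean n (\<lambda>\<pi>. \<Sum>x\<in>S. f x \<pi>) = (\<Sum>x\<in>S. perm_mean n (f x))"
  unfolding perm_mean_def by (subst sum.swap) (simp add: sum_divide_distrib)

lemma perm_mean_add: "perm_mean n (\<lambda>\<pi>. f \<pi> + g \<pi>) = perm_mean n f + perm_mean n g"
  unfolding perm_mean_def by (simp add: sum.distrib add_divide_distrib)

lemma perm_mean_cmult: "perm_mean n (\<lambda>\<pi>. c * f \<pi>) = c * perm_mean n f"
  unfolding perm_mean_def by (simp add: sum_distrib_left)

lemma perm_mean_const: "perm_mean n (\<lambda>\<pi>. c) = c"
  unfolding perm_mean_def sum_constant card_perms by simp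

lemma perm_mean_centered:
  "perm_mean n (\<lambda>\<pi>. (f \<pi> - perm_mean n f) * (g \<pi> - perm_mean n g))
     = perm_mean n (\<lambda>\<pi>. f \<pi> * g \<pi>) - perm_mean n f * perm_mean n g"
proof -
  let ?a = "perm_mean n f" and ?b = "perm_mean n g"
  have "perm_mean n (\<lambda>\<pi>. (f \<pi> - ?a) * (g \<pi> - ?b))
     = perm_mean n (\<lambda>\<pi>. f \<pi> * g \<pi> + ((- ?a) * g \<pi> + ((- ?b) * f \<pi> + ?a * ?b)))"
    by (simp add: algebra_simps)
  also have "\<dots> = perm_mean n (\<lambda>\<pi>. f \<pi> * g \<pi>) + ((- ?a) * ?b + ((- ?b) * ?a + ?a * ?b))"
    by (simp only: perm_mean_add perm_mean_cmult perm_mean_const)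
  finally show ?thesis by (simp add: algebra_simps)
qed

lemma perm_mean_Cauchy_Schwarz:
  "(perm_mean n (\<lambda>\<pi>. f \<pi> * g \<pi>))\<^sup>2 \<le> perm_mean n (\<lambda>\<pi>. (f \<pi>)\<^sup>2) * perm_mean n (\<lambda>\<pi>. (g \<pi>)\<^sup>2)"
proof -
  let ?S = "{\<pi>. \<pi> permutes {1..n}}"
  have "(\<Sum>\<pi>\<in>?S. f \<pi> * g \<pi>)\<^sup>2 \<le> (\<Sum>\<pi>\<in>?S. (f \<pi>)\<^sup>2) * (\<Sum>\<pi>\<in>?S. (g \<pi>)\<^sup>2)"
    by (rule Cauchy_Schwarz_ineq_sum)
  thus ?thesis unfolding perm_mean_def
    by (simp add: power_divide power2_eq_square divide_right_mono)
qed

definition num_occurring :: "vincular_pattern \<Rightarrow> nat \<Rightarrow> (nat \<Rightarrow> nat) \<Rightarrow> real" where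
  "num_occurring P n \<pi> = (\<Sum>u\<in>embeddings P n. of_bool (occurs_at P u \<pi>))"

lemma num_occurring_card: "num_occurring P n \<pi> = real (card {u \<in> embeddings P n. occurs_at P u \<pi>})"
  unfolding num_occurring_def using finite_embeddings[of P n] by (simp add: Int_def conj_commute)

lemma mean_num_occurring:
  assumes "is_vincular_pattern P"
  shows "perm_mean n (num_occurring P n) = card (embeddings P n) / fact (pat_length P)"
proof -
  have "perm_mean n (num_occurring P n) = (\<Sum>u\<in>embeddings P n. perm_prob n (occurs_at P u))"
    unfolding num_occurring_def by (simp add: perm_mean_sum perm_mean_of_bool)
  also have "\<dots> = (\<Sum>u\<in>embeddings P n. 1 / fact (pat_length P))"
    by (intro sum.cong refl perm_prob_occurs[OF assms])
  finally show ?thesis by simp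
qed

lemma occurrence_variance_centered:
  assumes P: "is_vincular_pattern P"
  shows "occurrence_variance P n =
    perm_mean n (\<lambda>\<pi>. (num_occurring P n \<pi> - perm_mean n (num_occurring P n))\<^sup>2)"
proof -
  have eq: "real (card (occurrences P n \<pi>)) = num_occurring P n \<pi>" if "\<pi> permutes {1..n}" for \<pi>
    using card_occurrences[OF P that] num_occurring_card by simp
  have m: "perm_mean n (\<lambda>\<pi>. real (card (occurrences P n \<pi>))) = perm_mean n (num_occurring P n)"
    unfolding perm_mean_def using eq by simp
  show ?thesis unfolding occurrence_variance_def expectation_perms m
    unfolding perm_mean_def[of n "\<lambda>\<pi>. (_ \<pi>)\<^sup>2"] using eq by (simp add: perm_mean_def[of n "\<lambda>\<pi>. _ \<pi> ^ 2"])
qed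

definition overlapping_pairs :: "vincular_pattern \<Rightarrow> nat \<Rightarrow> ((nat \<Rightarrow> nat) \<times> (nat \<Rightarrow> nat)) set" where
  "overlapping_pairs P n =
     {(u, v). u \<in> embeddings P n \<and> v \<in> embeddings P n \<and> range_of P u \<inter> range_of P v \<noteq> {}}"

lemma finite_overlapping_pairs: "finite (overlapping_pairs P n)"
  by (rule finite_subset[of _ "embeddings P n \<times> embeddings P n"])
     (auto simp: overlapping_pairs_def finite_embeddings)

text \<open>Only pairs with a common position contribute, because disjoint pairs are independent.\<close>

lemma occurrence_variance_overlapping:
  assumes P: "is_vincular_pattern P"
  shows "occurrence_variance P n = (\<Sum>(u, v)\<in>overlapping_pairs P n.
     perm_prob n (\<lambda>\<pi>. occurs_at P u \<pi> \<and> occurs_at P v \<pi>) - (1 / fact (pat_length P))\<^sup>2)"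
proof -
  let ?U = "embeddings P n" and ?X = "num_occurring P n"
  let ?d = "\<lambda>(u, v). perm_prob n (\<lambda>\<pi>. occurs_at P u \<pi> \<and> occurs_at P v \<pi>) - (1 / fact (pat_length P))\<^sup>2"
  have XX: "?X \<pi> * ?X \<pi> = (\<Sum>u\<in>?U. \<Sum>v\<in>?U. of_bool (occurs_at P u \<pi> \<and> occurs_at P v \<pi>))" for \<pi>
    unfolding num_occurring_def sum_product by (simp only: of_bool_conj)
  have "occurrence_variance P n = perm_mean n (\<lambda>\<pi>. ?X \<pi> * ?X \<pi>) - perm_mean n ?X * perm_mean n ?X"
    using perm_mean_centered[of n ?X ?X] occurrence_variance_centered[OF P]
    by (simp add: power2_eq_square)
  also have "perm_mean n (\<lambda>\<pi>. ?X \<pi> * ?X \<pi>)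
     = (\<Sum>u\<in>?U. \<Sum>v\<in>?U. perm_prob n (\<lambda>\<pi>. occurs_at P u \<pi> \<and> occurs_at P v \<pi>))"
    by (simp only: XX perm_mean_sum perm_mean_of_bool)
  also have "perm_mean n ?X * perm_mean n ?X = (\<Sum>u\<in>?U. \<Sum>v\<in>?U. (1 / fact (pat_length P))\<^sup>2)"
    by (simp add: mean_num_occurring[OF P] power2_eq_square)
  also have "(\<Sum>u\<in>?U. \<Sum>v\<in>?U. perm_prob n (\<lambda>\<pi>. occurs_at P u \<pi> \<and> occurs_at P v \<pi>))
      - (\<Sum>u\<in>?U. \<Sum>v\<in>?U. (1 / fact (pat_length P))\<^sup>2) = (\<Sum>x\<in>?U \<times> ?U. ?d x)"
    by (simp only: sum.cartesian_product sum_subtractf[symmetric] case_prod_unfold)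
  also have "\<dots> = (\<Sum>x\<in>overlapping_pairs P n. ?d x)"
  proof (rule sum.mono_neutral_right)
    show "finite (?U \<times> ?U)" by (simp add: finite_embeddings)
    show "overlapping_pairs P n \<subseteq> ?U \<times> ?U" by (auto simp: overlapping_pairs_def)
    show "\<forall>x\<in>?U \<times> ?U - overlapping_pairs P n. ?d x = 0"
    proof
      fix x assume x: "x \<in> ?U \<times> ?U - overlapping_pairs P n"
      obtain u v where [simp]: "x = (u, v)" by (cases x)
      have "u \<in> ?U" "v \<in> ?U" "range_of P u \<inter> range_of P v = {}" using x by (auto simp: overlapping_pairs_def)
      thus "?d x = 0" using perm_prob_occurs_disjoint[OF P] by simp
    qed
  qed
  finally show ?thesis .
qed

section \<open>Block structure of a vincular pattern\<close>

definition block_starts :: "vincular_pattern \<Rightarrow> nat set" where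
  "block_starts P = {i \<in> {1..pat_length P}. i - 1 \<notin> pat_adj P}"

text \<open>The first position of the block that contains \<open>i\<close>.\<close>

definition start_of :: "vincular_pattern \<Rightarrow> nat \<Rightarrow> nat" where
  "start_of P i = Max {b \<in> block_starts P. b \<le> i}"

lemma finite_block_starts: "finite (block_starts P)"
  unfolding block_starts_def by simp

lemma block_starts_range: "b \<in> block_starts P \<Longrightarrow> b \<in> {1..pat_length P}"
  unfolding block_starts_def by simp

lemma finite_adj: "is_vincular_pattern P \<Longrightarrow> finite (pat_adj P)"
  unfolding is_vincular_pattern_def by (meson finite_atLeastAtMost finite_subset)

lemma zero_not_adj: "is_vincular_pattern P \<Longrightarrow> 0 \<notin> pat_adj P"
  using pattern_adj_range(1) by fastforce

lemma one_block_start: "is_vincular_pattern P \<Longrightarrow> 1 \<in> block_starts P"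
  using zero_not_adj unfolding block_starts_def is_vincular_pattern_def by auto

lemma card_block_starts_adj:
  assumes P: "is_vincular_pattern P"
  shows "card (block_starts P) + card (pat_adj P) = pat_length P"
proof -
  have "{1..pat_length P} = block_starts P \<union> Suc ` pat_adj P"
  proof (intro equalityI subsetI)
    fix i assume i: "i \<in> {1..pat_length P}"
    show "i \<in> block_starts P \<union> Suc ` pat_adj P"
    proof (cases "i - 1 \<in> pat_adj P")
      case True
      hence "Suc (i - 1) \<in> Suc ` pat_adj P" by blast
      thus ?thesis using i by simp
    next
      case False thus ?thesis using i unfolding block_starts_def by simp
    qed
  next
    fix i assume "i \<in> block_starts P \<union> Suc ` pat_adj P"
    thus "i \<in> {1..pat_length P}"
      using block_starts_range pattern_adj_range(2)[OF P] by fastforce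
  qed
  moreover have "block_starts P \<inter> Suc ` pat_adj P = {}" unfolding block_starts_def by auto
  moreover have "card (Suc ` pat_adj P) = card (pat_adj P)" by (simp add: card_image)
  ultimately have "card {1..pat_length P} = card (block_starts P) + card (pat_adj P)"
    using finite_adj[OF P] finite_block_starts by (metis card_Un_disjoint finite_imageI)
  thus ?thesis by simp
qed

context
  fixes P assumes P: "is_vincular_pattern P"
begin

lemma start_of_props:
  assumes "i \<in> {1..pat_length P}"
  shows "start_of P i \<in> block_starts P" "start_of P i \<le> i"
proof -
  let ?S = "{b \<in> block_starts P. b \<le> i}"
  have "1 \<in> ?S" using one_block_start[OF P] assms by simp
  hence "Max ?S \<in> ?S" using finite_block_starts[of P] by (intro Max_in) auto
  thus "start_of P i \<in> block_starts P" "start_of P i \<le> i" unfolding start_of_def by auto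
qed

lemma start_of_greatest:
  assumes "b \<in> block_starts P" "b \<le> i"
  shows "b \<le> start_of P i"
  unfolding start_of_def using assms finite_block_starts[of P] by (intro Max_ge) auto

lemma start_of_range: "i \<in> {1..pat_length P} \<Longrightarrow> start_of P i \<in> {1..pat_length P}"
  using start_of_props(1) block_starts_range by blast

lemma start_of_start: "b \<in> block_starts P \<Longrightarrow> start_of P b = b"
  using start_of_props(2)[of b] start_of_greatest[of b b] block_starts_range[of b P] by simp

lemma start_of_mono:
  assumes "i \<in> {1..pat_length P}" "i \<le> i'"
  shows "start_of P i \<le> start_of P i'"
  using start_of_props[OF assms(1)] assms(2) by (intro start_of_greatest) auto

lemma start_of_adj:
  assumes "i \<in> pat_adj P"
  shows "start_of P (i + 1) = start_of P i"
proof (rule antisym)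
  have r: "i \<in> {1..pat_length P}" "i + 1 \<in> {1..pat_length P}" using pattern_adj_range[OF P assms] by auto
  have "start_of P (i + 1) \<noteq> i + 1" using start_of_props(1)[OF r(2)] assms unfolding block_starts_def by auto
  hence "start_of P (i + 1) \<le> i" using start_of_props(2)[OF r(2)] by linarith
  thus "start_of P (i + 1) \<le> start_of P i" using start_of_props(1)[OF r(2)] by (rule start_of_greatest[rotated])
  show "start_of P i \<le> start_of P (i + 1)" using r by (intro start_of_mono) auto
qed

lemma between_start_adj:
  assumes "i \<in> {1..pat_length P}" "start_of P i \<le> x" "x < i"
  shows "x \<in> pat_adj P"
proof (rule ccontr)
  assume "x \<notin> pat_adj P"
  hence "x + 1 \<in> block_starts P" using assms start_of_range[OF assms(1)] unfolding block_starts_def by auto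
  hence "x + 1 \<le> start_of P i" using assms by (intro start_of_greatest) auto
  thus False using assms by simp
qed

lemma start_of_linked:
  assumes "{a..<b} \<subseteq> pat_adj P" "a \<le> i" "i \<le> b"
  shows "start_of P i = start_of P a"
  using assms(2,3)
proof (induction i rule: dec_induct)
  case (step m)
  have "m \<in> pat_adj P" using assms(1) step by auto
  thus ?case using start_of_adj step by simp
qed simp

definition block_at :: "nat \<Rightarrow> nat set" where
  "block_at a = {i \<in> {1..pat_length P}. start_of P i = a}"

lemma block_at_linked:
  assumes a: "a \<in> block_starts P"
  shows "block_at a \<in> linked_groups P"
proof -
  define b where "b = Max (block_at a)"
  have a': "a \<in> block_at a" using a block_starts_range start_of_start unfolding block_at_def by auto
  have fin: "finite (block_at a)" unfolding block_at_def by simp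
  have b: "b \<in> block_at a" unfolding b_def using a' fin by (intro Max_in) auto
  have ab: "a \<le> b" unfolding b_def using a' fin by simp
  have eq: "block_at a = {a..b}"
  proof (intro equalityI subsetI)
    fix i assume i: "i \<in> block_at a"
    have "a \<le> i" using i start_of_props(2) unfolding block_at_def by auto
    moreover have "i \<le> b" unfolding b_def using i fin by simp
    ultimately show "i \<in> {a..b}" by simp
  next
    fix i assume i: "i \<in> {a..b}"
    have ir: "i \<in> {1..pat_length P}" using i b a block_starts_range[OF a] unfolding block_at_def by auto
    have "start_of P i \<le> start_of P b" using i ir by (intro start_of_mono) auto
    moreover have "a \<le> start_of P i" using i a by (intro start_of_greatest) auto
    ultimately show "i \<in> block_at a" using b ir unfolding block_at_def by auto
  qed
  have "{a..<b} \<subseteq> pat_adj P" using between_start_adj[of b] b unfolding block_at_def by auto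
  thus ?thesis unfolding linked_groups_def eq
    using ab b block_starts_range[OF a] unfolding block_at_def by auto
qed

lemma linked_subset_block_at:
  assumes "G \<in> linked_groups P" "a \<in> G"
  shows "G \<subseteq> block_at (start_of P a)"
proof -
  obtain c d where G: "G = {c..d}" "1 \<le> c" "c \<le> d" "d \<le> pat_length P" "{c..<d} \<subseteq> pat_adj P"
    using assms(1) unfolding linked_groups_def by blast
  have c: "start_of P i = start_of P c" if "i \<in> {c..d}" for i
    using that by (intro start_of_linked[OF G(5)]) auto
  have "start_of P i = start_of P a" if "i \<in> {c..d}" for i
    using c[OF that] c[of a] assms(2) G(1) by simp
  moreover have "{c..d} \<subseteq> {1..pat_length P}" using G by simp
  ultimately show ?thesis using G(1) unfolding block_at_def by blast
qed

text \<open>Blocks correspond to the positions that are not linked to their predecessor; this makes the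
  number of blocks computable from the adjacency set.\<close>

lemma blocks_eq: "blocks P = block_at ` block_starts P"
proof (intro equalityI subsetI)
  fix B assume B: "B \<in> blocks P"
  hence Bl: "B \<in> linked_groups P" unfolding blocks_def by blast
  then obtain c where c: "c \<in> B" "c \<in> {1..pat_length P}" unfolding linked_groups_def by fastforce
  have s: "start_of P c \<in> block_starts P" using start_of_props c by blast
  have "B = block_at (start_of P c)"
    using B linked_subset_block_at[OF Bl c(1)] block_at_linked[OF s] unfolding blocks_def by blast
  thus "B \<in> block_at ` block_starts P" using s by blast
next
  fix B assume "B \<in> block_at ` block_starts P"
  then obtain a where a: "a \<in> block_starts P" "B = block_at a" by blast
  have "a \<in> block_at a" using a block_starts_range start_of_start unfolding block_at_def by auto
  hence "B' = block_at a" if "B' \<in> linked_groups P" "block_at a \<subseteq> B'" for B'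
    using linked_subset_block_at[OF that(1), of a] that(2) start_of_start[OF a(1)] by auto
  thus "B \<in> blocks P" unfolding blocks_def using a block_at_linked by blast
qed

lemma num_blocks_eq: "num_blocks P = card (block_starts P)"
proof -
  have "inj_on block_at (block_starts P)"
  proof (rule inj_onI)
    fix a b assume ab: "a \<in> block_starts P" "b \<in> block_starts P" "block_at a = block_at b"
    have "a \<in> block_at a" using ab(1) block_starts_range start_of_start unfolding block_at_def by auto
    hence "start_of P a = b" using ab(3) unfolding block_at_def by blast
    thus "a = b" using start_of_start[OF ab(1)] by simp
  qed
  thus ?thesis unfolding num_blocks_def blocks_eq by (rule card_image)
qed

lemma num_blocks_adj: "num_blocks P + card (pat_adj P) = pat_length P"
  using card_block_starts_adj[OF P] num_blocks_eq by simp

lemma num_blocks_pos: "num_blocks P \<ge> 1"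
proof -
  have "block_starts P \<noteq> {}" using one_block_start[OF P] by blast
  thus ?thesis using num_blocks_eq finite_block_starts[of P] by (simp add: card_gt_0_iff Suc_le_eq)
qed

lemma linked_le_max_block_size:
  assumes "1 \<le> a" "a \<le> b" "b \<le> pat_length P" "{a..<b} \<subseteq> pat_adj P"
  shows "b - a + 1 \<le> max_block_size P"
proof -
  have G: "{a..b} \<in> linked_groups P" unfolding linked_groups_def using assms by blast
  have sub: "{a..b} \<subseteq> block_at (start_of P a)" using linked_subset_block_at[OF G, of a] assms by simp
  have "b - a + 1 = card {a..b}" using assms by simp
  also have "\<dots> \<le> card (block_at (start_of P a))" using sub by (intro card_mono) (auto simp: block_at_def)
  also have "\<dots> \<le> max_block_size P" unfolding max_block_size_def blocks_eq
    using finite_block_starts start_of_props(1)[of a] assms by (intro Max_ge) auto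
  finally show ?thesis .
qed

lemma max_block_size_le: "max_block_size P \<le> pat_length P"
proof -
  have "card (block_at a) \<le> pat_length P" for a
  proof -
    have "block_at a \<subseteq> {1..pat_length P}" unfolding block_at_def by blast
    hence "card (block_at a) \<le> card {1..pat_length P}" by (rule card_mono[rotated]) simp
    thus ?thesis by simp
  qed
  thus ?thesis unfolding max_block_size_def blocks_eq
    using finite_block_starts one_block_start[OF P] by (subst Max_le_iff) auto
qed

lemma embedding_start_of:
  assumes u: "u \<in> embeddings P n" and i: "i \<in> {1..pat_length P}"
  shows "u i = u (start_of P i) + (i - start_of P i)"
proof -
  have "u m = u (start_of P i) + (m - start_of P i)" if "start_of P i \<le> m" "m \<le> i" for m
    using that
  proof (induction m rule: dec_induct)
    case (step m)
    have "m \<in> pat_adj P" using between_start_adj[OF i] step by simp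
    thus ?case using embedding_adj[OF u, of m] step by simp
  qed simp
  from this[OF start_of_props(2)[OF i] order_refl] show ?thesis .
qed

lemma embedding_eqI:
  assumes u: "u \<in> embeddings P n" and v: "v \<in> embeddings P n'"
    and eq: "\<And>b. b \<in> block_starts P \<Longrightarrow> u b = v b"
  shows "u = v"
proof (rule extensionalityI[of _ "{1..pat_length P}"])
  show "u \<in> extensional {1..pat_length P}" "v \<in> extensional {1..pat_length P}"
    using u v unfolding embeddings_def PiE_def by blast+
  fix i assume i: "i \<in> {1..pat_length P}"
  show "u i = v i" using embedding_start_of[OF u i] embedding_start_of[OF v i] eq start_of_props(1)[OF i] by simp
qed

text \<open>An embedding is determined by where it sends the block starts.\<close>

lemma card_embeddings_le_prod:
  assumes F: "\<And>b. b \<in> block_starts P \<Longrightarrow> finite (F b)"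
  shows "card {u \<in> embeddings P n. \<forall>b\<in>block_starts P. u b \<in> F b} \<le> (\<Prod>b\<in>block_starts P. card (F b))"
proof -
  let ?E = "{u \<in> embeddings P n. \<forall>b\<in>block_starts P. u b \<in> F b}"
  have "inj_on (\<lambda>u. restrict u (block_starts P)) ?E"
  proof (rule inj_onI)
    fix u v assume u: "u \<in> ?E" and v: "v \<in> ?E" and eq: "restrict u (block_starts P) = restrict v (block_starts P)"
    have "u b = v b" if "b \<in> block_starts P" for b using fun_cong[OF eq, of b] that by simp
    thus "u = v" using embedding_eqI[of u n v n] u v by blast
  qed
  moreover have "(\<lambda>u. restrict u (block_starts P)) ` ?E \<subseteq> (\<Pi>\<^sub>E b\<in>block_starts P. F b)" by auto
  ultimately have "card ?E \<le> card (\<Pi>\<^sub>E b\<in>block_starts P. F b)"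
    using F finite_block_starts by (intro card_inj_on_le) (auto intro: finite_PiE)
  thus ?thesis by (simp add: card_PiE finite_block_starts)
qed

lemma card_embeddings_le_choose: "card (embeddings P n) \<le> n choose num_blocks P"
proof -
  let ?T = "{S. S \<subseteq> {1..n} \<and> card S = num_blocks P}"
  have sub: "block_starts P \<subseteq> {1..pat_length P}" using block_starts_range by blast
  have "inj_on (\<lambda>u. u ` block_starts P) (embeddings P n)"
  proof (rule inj_onI)
    fix u v assume u: "u \<in> embeddings P n" and v: "v \<in> embeddings P n" and eq: "u ` block_starts P = v ` block_starts P"
    have "strict_mono_on (block_starts P) u" "strict_mono_on (block_starts P) v"
      using embedding_mono[OF u] embedding_mono[OF v] sub
      unfolding strict_mono_on_def by blast+
    hence "u b = v b" if "b \<in> block_starts P" for b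
      using strict_mono_on_same_image[OF finite_block_starts _ _ eq that] by blast
    thus "u = v" using embedding_eqI[OF u v] by blast
  qed
  moreover have "(\<lambda>u. u ` block_starts P) ` embeddings P n \<subseteq> ?T"
  proof
    fix S assume "S \<in> (\<lambda>u. u ` block_starts P) ` embeddings P n"
    then obtain u where u: "u \<in> embeddings P n" "S = u ` block_starts P" by blast
    have "card S = num_blocks P" unfolding u(2) num_blocks_eq
      by (rule card_image[OF inj_on_subset[OF embedding_inj[OF u(1)] sub]])
    moreover have "S \<subseteq> {1..n}" using u embedding_in[OF u(1)] sub by blast
    ultimately show "S \<in> ?T" by blast
  qed
  ultimately have "card (embeddings P n) \<le> card ?T"
    by (intro card_inj_on_le[where f = "\<lambda>u. u ` block_starts P"]) auto
  also have "card ?T = n choose num_blocks P" using n_subsets[of "{1..n}"] by simp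
  finally show ?thesis .
qed

text \<open>Each block is laid out consecutively from its prescribed start \<open>e b\<close>.\<close>

definition embedding_with :: "(nat \<Rightarrow> nat) \<Rightarrow> nat \<Rightarrow> nat" where
  "embedding_with e = (\<lambda>i\<in>{1..pat_length P}. e (start_of P i) + (i - start_of P i))"

lemma embedding_with_starts: "b \<in> block_starts P \<Longrightarrow> embedding_with e b = e b"
  using start_of_start block_starts_range unfolding embedding_with_def by simp

lemma embedding_with_in:
  assumes r: "\<And>b. b \<in> block_starts P \<Longrightarrow> 1 \<le> e b \<and> e b + pat_length P \<le> n + 1"
    and sep: "\<And>b b'. b \<in> block_starts P \<Longrightarrow> b' \<in> block_starts P \<Longrightarrow> b < b' \<Longrightarrow> e b + pat_length P \<le> e b'"
  shows "embedding_with e \<in> embeddings P n"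
proof -
  let ?k = "pat_length P" and ?u = "embedding_with e"
  have ui: "?u i = e (start_of P i) + (i - start_of P i)" if "i \<in> {1..?k}" for i
    using that unfolding embedding_with_def by simp
  have off: "i - start_of P i + 1 \<le> ?k" if "i \<in> {1..?k}" for i
    using that start_of_range[OF that] by auto
  have "?u i \<in> {1..n}" if "i \<in> {1..?k}" for i
    using ui[OF that] off[OF that] r[OF start_of_props(1)[OF that]] by auto
  moreover have "?u \<in> extensional {1..?k}" unfolding embedding_with_def by simp
  ultimately have "?u \<in> {1..?k} \<rightarrow>\<^sub>E {1..n}" unfolding PiE_def by blast
  moreover have "strict_mono_on {1..?k} ?u"
  proof (rule strict_mono_onI)
    fix i i' assume i: "i \<in> {1..?k}" "i' \<in> {1..?k}" "i < i'"
    show "?u i < ?u i'"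
    proof (cases "start_of P i = start_of P i'")
      case True
      thus ?thesis using ui i start_of_props(2)[OF i(1)] by simp
    next
      case False
      hence "start_of P i < start_of P i'" using start_of_mono[OF i(1), of i'] i by simp
      hence "e (start_of P i) + ?k \<le> e (start_of P i')" using sep start_of_props(1) i by blast
      thus ?thesis using ui i off[OF i(1)] by simp
    qed
  qed
  moreover have "?u (i + 1) = ?u i + 1" if i: "i \<in> pat_adj P" for i
  proof -
    have r: "i \<in> {1..?k}" "i + 1 \<in> {1..?k}" using pattern_adj_range[OF P i] by auto
    show ?thesis using ui[OF r(1)] ui[OF r(2)] start_of_adj[OF i] start_of_props(2)[OF r(1)] by simp
  qed
  ultimately show ?thesis unfolding embeddings_def by blast
qed

end

section \<open>Many overlapping pairs: two embeddings sharing exactly one block start\<close>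

text \<open>Adding \<open>k\<close> times the rank opens a gap of at least \<open>k\<close> between any two elements. This turns
  arbitrary subsets of a slightly shorter interval injectively into sets with large gaps.\<close>

definition spread :: "nat \<Rightarrow> nat set \<Rightarrow> nat set" where
  "spread k D = (\<lambda>x. x + k * rank_in D x) ` D"

lemma spread_strict_mono:
  assumes "finite D"
  shows "strict_mono_on D (\<lambda>x. x + k * rank_in D x)"
proof (rule strict_mono_onI)
  fix r s assume "r \<in> D" "s \<in> D" "r < s"
  moreover hence "rank_in D r < rank_in D s" using rank_in_less_iff[OF assms] by blast
  ultimately show "r + k * rank_in D r < s + k * rank_in D s" by (intro add_less_le_mono) auto
qed

lemma spread_gap:
  assumes D: "finite D" and xy: "x \<in> spread k D" "y \<in> spread k D" "x < y"
  shows "x + k \<le> y"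
proof -
  obtain r s where rs: "r \<in> D" "s \<in> D" "x = r + k * rank_in D r" "y = s + k * rank_in D s"
    using xy unfolding spread_def by blast
  have "r < s" using strict_mono_on_less[OF spread_strict_mono[OF D]] rs xy(3) by blast
  moreover hence "rank_in D r + 1 \<le> rank_in D s" using rank_in_less_iff[OF D rs(1,2)] by simp
  hence "k * (rank_in D r + 1) \<le> k * rank_in D s" by (rule mult_le_mono2)
  ultimately show ?thesis using rs by (simp add: algebra_simps)
qed

lemma spread_inj:
  assumes "finite D" "finite D'" "spread k D = spread k D'"
  shows "D = D'"
proof -
  \<comment> \<open>Spreading preserves ranks, so it can be undone by subtracting \<open>k\<close> times the rank.\<close>
  have "(\<lambda>c. c - k * rank_in (spread k E) c) ` spread k E = E" if "finite E" for E
  proof -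
    have "rank_in (spread k E) (x + k * rank_in E x) = rank_in E x" if "x \<in> E" for x
      using rank_in_image[OF spread_strict_mono[OF \<open>finite E\<close>] that] unfolding spread_def .
    hence "(\<lambda>c. c - k * rank_in (spread k E) c) ` ((\<lambda>x. x + k * rank_in E x) ` E) = (\<lambda>x. x) ` E"
      unfolding image_image by (intro image_cong) auto
    thus ?thesis by (simp add: spread_def)
  qed
  thus ?thesis using assms by metis
qed

definition sparse_sets :: "nat \<Rightarrow> nat \<Rightarrow> nat \<Rightarrow> nat set set" where
  "sparse_sets n k q = {C. C \<subseteq> {1..n} \<and> card C = q \<and> (\<forall>x\<in>C. \<forall>y\<in>C. x < y \<longrightarrow> x + k \<le> y)}"

lemma finite_sparse_sets: "finite (sparse_sets n k q)"
  by (rule finite_subset[of _ "Pow {1..n}"]) (auto simp: sparse_sets_def)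

lemma card_sparse_sets_ge: "(n - q * k) choose q \<le> card (sparse_sets n k q)"
proof (cases "q * k \<le> n")
  case True
  let ?T = "{D. D \<subseteq> {1..n - q * k} \<and> card D = q}"
  have fin: "finite D" if "D \<in> ?T" for D using that finite_subset[of D "{1..n - q * k}"] by blast
  have "inj_on (spread k) ?T"
    by (rule inj_onI) (rule spread_inj[OF fin fin])
  moreover have "spread k ` ?T \<subseteq> sparse_sets n k q"
  proof
    fix C assume "C \<in> spread k ` ?T"
    then obtain D where D: "D \<subseteq> {1..n - q * k}" "card D = q" "C = spread k D" by blast
    have fD: "finite D" using D finite_subset by blast
    have "x + k * rank_in D x \<in> {1..n}" if "x \<in> D" for x
    proof -
      have "rank_in D x \<le> q" using rank_in_range[OF fD that] D by simp
      hence "k * rank_in D x \<le> q * k" by (simp add: mult.commute mult_le_mono2)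
      moreover have "1 \<le> x" "x \<le> n - q * k" using that D by auto
      ultimately show ?thesis unfolding atLeastAtMost_iff using True by linarith
    qed
    hence "C \<subseteq> {1..n}" unfolding D spread_def by blast
    moreover have "card C = q" unfolding D(3) spread_def using D(2)
      by (simp add: card_image strict_mono_on_imp_inj_on[OF spread_strict_mono[OF fD]])
    ultimately show "C \<in> sparse_sets n k q" unfolding sparse_sets_def D(3) using spread_gap[OF fD] by blast
  qed
  ultimately have "card ?T \<le> card (sparse_sets n k q)"
    by (intro card_inj_on_le[OF _ _ finite_sparse_sets])
  thus ?thesis using n_subsets[of "{1..n - q * k}" q] by simp
next
  case False
  hence "n - q * k < q" by (cases q) auto
  thus ?thesis by (simp add: binomial_eq_0)
qed

definition place_on :: "vincular_pattern \<Rightarrow> nat set \<Rightarrow> nat \<Rightarrow> nat" where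
  "place_on P A = embedding_with P (\<lambda>b. enum_of A (rank_in (block_starts P) b))"

lemma place_on_props:
  assumes P: "is_vincular_pattern P"
    and A: "A \<subseteq> {1..n}" "card A = num_blocks P" "\<forall>x\<in>A. \<forall>y\<in>A. x < y \<longrightarrow> x + pat_length P \<le> y"
  shows "place_on P A \<in> embeddings P (n + pat_length P)" "place_on P A ` block_starts P = A"
proof -
  let ?B = "block_starts P" and ?e = "\<lambda>b. enum_of A (rank_in (block_starts P) b)"
  have fA: "finite A" using A finite_subset by blast
  have cB: "card A = card ?B" using A num_blocks_eq[OF P] by simp
  have bij: "bij_betw (enum_of A \<circ> rank_in ?B) ?B A"
    using rank_in_bij[OF finite_block_starts] enum_of_bij[OF fA] cB by (intro bij_betw_trans) auto
  hence eA: "?e b \<in> A" if "b \<in> ?B" for b using that bij_betwE by fastforce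
  have emono: "?e b < ?e b'" if b: "b \<in> ?B" "b' \<in> ?B" "b < b'" for b b'
  proof -
    have "rank_in ?B b < rank_in ?B b'" using rank_in_less_iff[OF finite_block_starts] b by blast
    moreover have "rank_in ?B b \<in> {1..card A}" "rank_in ?B b' \<in> {1..card A}"
      using rank_in_range[OF finite_block_starts] b cB by auto
    ultimately show ?thesis using enum_of_strict_mono[OF fA] unfolding strict_mono_on_def by blast
  qed
  show "place_on P A \<in> embeddings P (n + pat_length P)" unfolding place_on_def
  proof (rule embedding_with_in[OF P])
    fix b assume "b \<in> ?B"
    hence "?e b \<in> {1..n}" using eA A by blast
    thus "1 \<le> ?e b \<and> ?e b + pat_length P \<le> n + pat_length P + 1" by simp
  next
    fix b b' assume "b \<in> ?B" "b' \<in> ?B" "b < b'"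
    thus "?e b + pat_length P \<le> ?e b'" using emono eA A(3) by blast
  qed
  have "place_on P A ` ?B = (enum_of A \<circ> rank_in ?B) ` ?B"
    unfolding place_on_def by (intro image_cong refl) (simp add: embedding_with_starts[OF P])
  thus "place_on P A ` ?B = A" using bij by (simp add: bij_betw_def)
qed

text \<open>A sparse set \<open>C\<close> of \<open>2 * j - 1\<close> points, a \<open>j\<close>-subset \<open>A\<close> of \<open>C\<close> and a point \<open>x\<close> of \<open>A\<close> give a pair
  of embeddings: one with block starts \<open>A\<close>, the other with block starts \<open>insert x (C - A)\<close>. They
  meet in \<open>x\<close>, and \<open>C\<close>, \<open>A\<close>, \<open>x\<close> can be read off as the union, the first set and the intersection
  of the two sets of block starts.\<close>

lemma card_overlapping_pairs_ge:
  assumes P: "is_vincular_pattern P" and k: "pat_length P = k" and j: "num_blocks P = j"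
  shows "((n - (2 * j - 1) * k) choose (2 * j - 1)) * (((2 * j - 1) choose j) * j)
           \<le> card (overlapping_pairs P (n + k))"
proof -
  let ?q = "2 * j - 1" and ?B = "block_starts P"
  let ?S = "sparse_sets n k ?q"
  let ?A = "\<lambda>C. {A. A \<subseteq> C \<and> card A = j}"
  let ?T = "SIGMA C:?S. SIGMA A:?A C. A"
  let ?f = "\<lambda>(C, A, x). (place_on P A, place_on P (insert x (C - A)))"
  have j1: "j \<ge> 1" using num_blocks_pos[OF P] j by simp
  have finC: "finite C" "card C = ?q" "C \<subseteq> {1..n}" "\<forall>x\<in>C. \<forall>y\<in>C. x < y \<longrightarrow> x + k \<le> y" if "C \<in> ?S" for C
    using that finite_subset[of C "{1..n}"] unfolding sparse_sets_def by auto
  have finA: "finite (?A C)" if "C \<in> ?S" for C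
    using finC(1)[OF that] by (intro finite_subset[of "?A C" "Pow C"]) auto
  have finA': "finite A" if "A \<in> ?A C" "C \<in> ?S" for A C using that finC(1) finite_subset by blast
  have in1: "place_on P A \<in> embeddings P (n + k)" "place_on P A ` ?B = A"
    "place_on P (insert x (C - A)) \<in> embeddings P (n + k)" "place_on P (insert x (C - A)) ` ?B = insert x (C - A)"
    if "C \<in> ?S" "A \<in> ?A C" "x \<in> A" for C A x
  proof -
    have "A \<subseteq> {1..n}" "card A = num_blocks P" "\<forall>x\<in>A. \<forall>y\<in>A. x < y \<longrightarrow> x + pat_length P \<le> y"
      using that finC[OF that(1)] j k by auto
    from place_on_props[OF P this] show "place_on P A \<in> embeddings P (n + k)" "place_on P A ` ?B = A"
      using k by simp_all
    have fA: "finite A" using finA'[OF that(2,1)] .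
    have "card (C - A) = ?q - j" using that finC(2)[OF that(1)] fA by (simp add: card_Diff_subset)
    hence c: "card (insert x (C - A)) = num_blocks P" using that finC(1)[OF that(1)] j j1 by simp
    have "insert x (C - A) \<subseteq> C" using that by blast
    hence r: "insert x (C - A) \<subseteq> {1..n}" "\<forall>y\<in>insert x (C - A). \<forall>z\<in>insert x (C - A). y < z \<longrightarrow> y + pat_length P \<le> z"
      using finC(3,4)[OF that(1)] k by blast+
    from place_on_props[OF P r(1) c r(2)]
    show "place_on P (insert x (C - A)) \<in> embeddings P (n + k)" "place_on P (insert x (C - A)) ` ?B = insert x (C - A)"
      using k by simp_all
  qed
  have "inj_on ?f ?T"
  proof (rule inj_onI)
    fix t t' assume t: "t \<in> ?T" "t' \<in> ?T" and eq: "?f t = ?f t'"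
    obtain C A x where [simp]: "t = (C, A, x)" by (cases t)
    obtain C' A' x' where [simp]: "t' = (C', A', x')" by (cases t')
    have m: "C \<in> ?S" "A \<in> ?A C" "x \<in> A" "C' \<in> ?S" "A' \<in> ?A C'" "x' \<in> A'" using t by auto
    from eq have e: "place_on P A = place_on P A'"
      "place_on P (insert x (C - A)) = place_on P (insert x' (C' - A'))" by simp_all
    have A: "A = A'" using arg_cong[OF e(1), of "\<lambda>u. u ` ?B"] unfolding in1(2)[OF m(1-3)] in1(2)[OF m(4-6)] .
    have B: "insert x (C - A) = insert x' (C' - A')"
      using arg_cong[OF e(2), of "\<lambda>u. u ` ?B"] unfolding in1(4)[OF m(1-3)] in1(4)[OF m(4-6)] .
    have "insert x (C - A) \<inter> A = {x}" "insert x' (C' - A') \<inter> A' = {x'}" using m by blast+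
    hence x: "x = x'" using A B by (metis singleton_inject)
    have "insert x (C - A) \<union> A = C" "insert x' (C' - A') \<union> A' = C'" using m by blast+
    hence "C = C'" using A B by metis
    thus "t = t'" using A x by simp
  qed
  moreover have "?f ` ?T \<subseteq> overlapping_pairs P (n + k)"
  proof
    fix y assume "y \<in> ?f ` ?T"
    then obtain C A x where m: "C \<in> ?S" "A \<in> ?A C" "x \<in> A"
      and y: "y = (place_on P A, place_on P (insert x (C - A)))" by auto
    have sub: "?B \<subseteq> {1..pat_length P}" using block_starts_range by blast
    have "x \<in> place_on P A ` ?B" "x \<in> place_on P (insert x (C - A)) ` ?B"
      unfolding in1(2)[OF m] in1(4)[OF m] using m by auto
    hence "x \<in> range_of P (place_on P A) \<inter> range_of P (place_on P (insert x (C - A)))"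
      using image_mono[OF sub] by (meson IntI subsetD)
    thus "y \<in> overlapping_pairs P (n + k)" unfolding y overlapping_pairs_def
      using in1(1)[OF m] in1(3)[OF m] by blast
  qed
  ultimately have le: "card ?T \<le> card (overlapping_pairs P (n + k))"
    by (intro card_inj_on_le[OF _ _ finite_overlapping_pairs])
  have "card ?T = (\<Sum>C\<in>?S. card (SIGMA A:?A C. A))"
  proof (rule card_SigmaI[OF finite_sparse_sets], rule ballI)
    fix C assume C: "C \<in> ?S"
    show "finite (SIGMA A:?A C. A)" by (rule finite_SigmaI[OF finA[OF C] finA'[OF _ C]])
  qed
  also have "\<dots> = (\<Sum>C\<in>?S. (?q choose j) * j)"
  proof (rule sum.cong[OF refl])
    fix C assume C: "C \<in> ?S"
    have "card (SIGMA A:?A C. A) = (\<Sum>A\<in>?A C. card A)"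
      by (rule card_SigmaI[OF finA[OF C]], rule ballI, rule finA'[OF _ C])
    also have "\<dots> = (\<Sum>A\<in>?A C. j)" by (intro sum.cong) auto
    also have "\<dots> = (?q choose j) * j" using n_subsets[OF finC(1)[OF C], of j] finC(2)[OF C] by simp
    finally show "card (SIGMA A:?A C. A) = (?q choose j) * j" .
  qed
  finally have eqT: "card ?T = card ?S * ((?q choose j) * j)" by simp
  have "((n - ?q * k) choose ?q) * ((?q choose j) * j) \<le> card ?S * ((?q choose j) * j)"
    by (intro mult_le_mono1 card_sparse_sets_ge)
  also have "\<dots> \<le> card (overlapping_pairs P (n + k))" using le unfolding eqT .
  finally show ?thesis .
qed

section \<open>Merges in which the two copies overlap\<close>

text \<open>A common link between two adjacent positions needs both of them in the common range \<open>D\<close>, and the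
  largest element of \<open>D\<close> has no successor in \<open>D\<close>. If \<open>card D - 1\<close> links are common, then every
  other element of \<open>D\<close> is linked to its successor, so \<open>D\<close> is an interval that comes from a single
  block.\<close>

lemma overlapping_embeddings_adj:
  assumes P: "is_vincular_pattern P" and u: "u \<in> embeddings P n" and v: "v \<in> embeddings P n"
    and ne: "range_of P u \<inter> range_of P v \<noteq> {}"
  defines "D \<equiv> range_of P u \<inter> range_of P v" and "J \<equiv> u ` pat_adj P \<inter> v ` pat_adj P"
  shows "card J + 1 \<le> card D" "card J + 1 = card D \<Longrightarrow> card D \<le> max_block_size P"
proof -
  have fD: "finite D" unfolding D_def by simp
  have D0: "D \<noteq> {}" using ne unfolding D_def .
  have MaxD: "Max D \<in> D" and MinD: "Min D \<in> D" using fD D0 by auto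
  have succ: "y \<in> range_of P w" "y + 1 \<in> range_of P w" if w: "w \<in> embeddings P n" "y \<in> w ` pat_adj P" for w y
  proof -
    obtain i where i: "i \<in> pat_adj P" "y = w i" using w(2) by blast
    have "y + 1 = w (i + 1)" using embedding_adj[OF w(1) i(1)] i by simp
    thus "y \<in> range_of P w" "y + 1 \<in> range_of P w" using pattern_adj_range[OF P i(1)] i by blast+
  qed
  have J: "y \<in> D" "y + 1 \<in> D" if "y \<in> J" for y
    using that succ[OF u] succ[OF v] unfolding J_def D_def by blast+
  have JD: "J \<subseteq> D - {Max D}"
  proof
    fix y assume y: "y \<in> J"
    have "y + 1 \<le> Max D" using J(2)[OF y] fD by simp
    thus "y \<in> D - {Max D}" using J(1)[OF y] by auto
  qed
  have cD: "card (D - {Max D}) + 1 = card D" using fD MaxD by (metis Suc_eq_plus1 card_Suc_Diff1)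
  have "card J \<le> card (D - {Max D})" using JD fD by (intro card_mono) auto
  thus "card J + 1 \<le> card D" using cD by simp
  assume eq: "card J + 1 = card D"
  have JDeq: "J = D - {Max D}" using JD fD eq cD by (intro card_subset_eq) auto
  \<comment> \<open>Starting from \<open>Min D\<close>, links lead through all of \<open>D\<close>.\<close>
  define d where "d = Max D - Min D"
  have le: "Min D \<le> Max D" using fD MaxD by simp
  have in_D: "Min D + t \<in> D" if "t \<le> d" for t
    using that
  proof (induction t)
    case (Suc t)
    hence "Min D + t \<in> D - {Max D}" using le unfolding d_def by auto
    thus ?case using J(2)[of "Min D + t"] JDeq by simp
  qed (use MinD in simp)
  have "D = {Min D..Max D}"
  proof (intro equalityI subsetI)
    fix y assume "y \<in> {Min D..Max D}"
    thus "y \<in> D" using in_D[of "y - Min D"] unfolding d_def by auto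
  qed (use fD in auto)
  hence cardD: "card D = d + 1" using le unfolding d_def by (metis Suc_diff_le Suc_eq_plus1 card_atLeastAtMost)
  obtain a where a: "a \<in> {1..pat_length P}" "u a = Min D" using MinD unfolding D_def by fastforce
  have adj: "a + t \<in> pat_adj P" if at: "t < d" "a + t \<in> {1..pat_length P}" "u (a + t) = Min D + t" for t
  proof -
    have "Min D + t \<noteq> Max D" using at(1) unfolding d_def by linarith
    hence "Min D + t \<in> J" using in_D[of t] at(1) JDeq by simp
    then obtain i where i: "i \<in> pat_adj P" "u i = Min D + t" unfolding J_def by auto
    have "i = a + t" using inj_onD[OF embedding_inj[OF u]] i at pattern_adj_range(1)[OF P i(1)] by metis
    thus ?thesis using i by simp
  qed
  have steps: "a + t \<in> {1..pat_length P} \<and> u (a + t) = Min D + t" if "t \<le> d" for t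
    using that
  proof (induction t)
    case (Suc t)
    hence "a + t \<in> pat_adj P" using adj[of t] by simp
    thus ?case using pattern_adj_range(2)[OF P, of "a + t"] embedding_adj[OF u, of "a + t"] Suc by simp
  qed (use a in simp)
  have "{a..<a + d} \<subseteq> pat_adj P"
  proof
    fix i assume "i \<in> {a..<a + d}"
    hence "i - a < d" "a + (i - a) = i" by auto
    thus "i \<in> pat_adj P" using adj[of "i - a"] steps[of "i - a"] by simp
  qed
  hence "(a + d) - a + 1 \<le> max_block_size P"
    using a(1) steps[of d] by (intro linked_le_max_block_size[OF P]) auto
  thus "card D \<le> max_block_size P" using cardD by simp
qed

text \<open>A merge is stated in terms of values; this is the corresponding map between positions.\<close>

definition merge_positions :: "vincular_pattern \<Rightarrow> vincular_pattern \<Rightarrow> (nat \<Rightarrow> nat) \<Rightarrow> nat \<Rightarrow> nat" where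
  "merge_positions P P\<^sub>3 m = (\<lambda>i\<in>{1..pat_length P}. inv (pat_perm P\<^sub>3) (m (pat_perm P i)))"

text \<open>Each half of a merge is an embedding of the pattern into the positions of the merged pattern.\<close>

lemma merge_positions_embedding:
  assumes P: "is_vincular_pattern P" and P3: "is_vincular_pattern P\<^sub>3"
    and m: "m \<in> {1..pat_length P} \<rightarrow>\<^sub>E {1..pat_length P\<^sub>3}"
    and ord: "\<forall>a\<in>{1..pat_length P}. \<forall>b\<in>{1..pat_length P}.
         (m a, m b) \<in> appearance_order (pat_length P\<^sub>3) (pat_perm P\<^sub>3) \<longleftrightarrow> (a, b) \<in> appearance_order (pat_length P) (pat_perm P)"
    and adj: "\<forall>i\<in>pat_adj P. inv (pat_perm P\<^sub>3) (m (pat_perm P (i + 1))) = inv (pat_perm P\<^sub>3) (m (pat_perm P i)) + 1"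
  shows "merge_positions P P\<^sub>3 m \<in> embeddings P (pat_length P\<^sub>3)"
    "range_of P (merge_positions P P\<^sub>3 m) = inv (pat_perm P\<^sub>3) ` m ` {1..pat_length P}"
proof -
  let ?k = "pat_length P" and ?p = "pat_length P\<^sub>3" and ?x = "pat_perm P" and ?z = "pat_perm P\<^sub>3"
  let ?w = "merge_positions P P\<^sub>3 m"
  note x = pattern_perm[OF P] and z = pattern_perm[OF P3]
  have xin: "?x i \<in> {1..?k} \<longleftrightarrow> i \<in> {1..?k}" for i by (rule permutes_in_image[OF x])
  have zin: "inv ?z i \<in> {1..?p} \<longleftrightarrow> i \<in> {1..?p}" for i by (rule permutes_in_image[OF permutes_inv[OF z]])
  have mi: "m a \<in> {1..?p}" if "a \<in> {1..?k}" for a using m that by blast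
  have wi: "?w i = inv ?z (m (?x i))" if "i \<in> {1..?k}" for i using that unfolding merge_positions_def by simp
  have "?w i \<in> {1..?p}" if "i \<in> {1..?k}" for i
    unfolding wi[OF that] zin using that xin by (intro mi) blast
  moreover have "?w \<in> extensional {1..?k}" unfolding merge_positions_def by simp
  ultimately have "?w \<in> {1..?k} \<rightarrow>\<^sub>E {1..?p}" unfolding PiE_def by blast
  moreover have "strict_mono_on {1..?k} ?w"
  proof (rule strict_mono_onI)
    fix i i' assume i: "i \<in> {1..?k}" "i' \<in> {1..?k}" "i < i'"
    have xi: "?x i \<in> {1..?k}" "?x i' \<in> {1..?k}" using i xin by blast+
    have "(?x i, ?x i') \<in> appearance_order ?k ?x" unfolding appearance_order_iff[OF x xi]
      using i(3) permutes_inverses(2)[OF x] by simp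
    hence "(m (?x i), m (?x i')) \<in> appearance_order ?p ?z" using ord xi by blast
    thus "?w i < ?w i'" unfolding appearance_order_iff[OF z mi[OF xi(1)] mi[OF xi(2)]] wi[OF i(1)] wi[OF i(2)] .
  qed
  moreover have "?w (i + 1) = ?w i + 1" if "i \<in> pat_adj P" for i
    using adj that wi pattern_adj_range[OF P that] by simp
  ultimately show "?w \<in> embeddings P ?p" unfolding embeddings_def by blast
  have "range_of P ?w = (\<lambda>i. inv ?z (m (?x i))) ` {1..?k}" by (intro image_cong refl wi)
  also have "\<dots> = inv ?z ` m ` ?x ` {1..?k}" by auto
  finally show "range_of P ?w = inv ?z ` m ` {1..?k}" unfolding permutes_image[OF x] .
qed

lemma is_mergeD:
  assumes "is_merge P\<^sub>1 P\<^sub>2 P\<^sub>3 m\<^sub>1 m\<^sub>2"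
  shows "m\<^sub>1 \<in> {1..pat_length P\<^sub>1} \<rightarrow>\<^sub>E {1..pat_length P\<^sub>3}"
    and "m\<^sub>2 \<in> {1..pat_length P\<^sub>2} \<rightarrow>\<^sub>E {1..pat_length P\<^sub>3}"
    and "\<forall>a\<in>{1..pat_length P\<^sub>1}. \<forall>b\<in>{1..pat_length P\<^sub>1}.
      (m\<^sub>1 a, m\<^sub>1 b) \<in> appearance_order (pat_length P\<^sub>3) (pat_perm P\<^sub>3) \<longleftrightarrow> (a, b) \<in> appearance_order (pat_length P\<^sub>1) (pat_perm P\<^sub>1)"
    and "\<forall>a\<in>{1..pat_length P\<^sub>2}. \<forall>b\<in>{1..pat_length P\<^sub>2}.
      (m\<^sub>2 a, m\<^sub>2 b) \<in> appearance_order (pat_length P\<^sub>3) (pat_perm P\<^sub>3) \<longleftrightarrow> (a, b) \<in> appearance_order (pat_length P\<^sub>2) (pat_perm P\<^sub>2)"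
    and "\<forall>i\<in>pat_adj P\<^sub>1. inv (pat_perm P\<^sub>3) (m\<^sub>1 (pat_perm P\<^sub>1 (i + 1))) = inv (pat_perm P\<^sub>3) (m\<^sub>1 (pat_perm P\<^sub>1 i)) + 1"
    and "\<forall>i\<in>pat_adj P\<^sub>2. inv (pat_perm P\<^sub>3) (m\<^sub>2 (pat_perm P\<^sub>2 (i + 1))) = inv (pat_perm P\<^sub>3) (m\<^sub>2 (pat_perm P\<^sub>2 i)) + 1"
    and "m\<^sub>1 ` {1..pat_length P\<^sub>1} \<union> m\<^sub>2 ` {1..pat_length P\<^sub>2} = {1..pat_length P\<^sub>3}"
    and "pat_adj P\<^sub>3 = (\<lambda>i. inv (pat_perm P\<^sub>3) (m\<^sub>1 (pat_perm P\<^sub>1 i))) ` pat_adj P\<^sub>1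
      \<union> (\<lambda>i. inv (pat_perm P\<^sub>3) (m\<^sub>2 (pat_perm P\<^sub>2 i))) ` pat_adj P\<^sub>2"
  using assms unfolding is_merge_def Let_def by - (elim conjE, assumption)+

text \<open>If \<open>l\<close> letters are shared and \<open>i\<close> links are common, the merged pattern has \<open>2 * k - l\<close> letters and
  \<open>2 * (k - j) - i\<close> links, hence \<open>2 * j - l + i\<close> blocks. Now \<open>i \<le> l - 1\<close>, with equality only for a
  run inside one block.\<close>

lemma merge_num_blocks:
  assumes P: "is_vincular_pattern P" and P3: "is_vincular_pattern P\<^sub>3"
    and merge: "is_merge P P P\<^sub>3 m\<^sub>1 m\<^sub>2" and short: "pat_length P\<^sub>3 < 2 * pat_length P"
  shows "num_blocks P\<^sub>3 \<le> 2 * num_blocks P - 1"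
    "num_blocks P\<^sub>3 = 2 * num_blocks P - 1 \<Longrightarrow> 2 * pat_length P - pat_length P\<^sub>3 \<le> max_block_size P"
proof -
  let ?k = "pat_length P" and ?p = "pat_length P\<^sub>3" and ?x = "pat_perm P" and ?z = "pat_perm P\<^sub>3"
  define u where "u = merge_positions P P\<^sub>3 m\<^sub>1"
  define v where "v = merge_positions P P\<^sub>3 m\<^sub>2"
  note mm = is_mergeD[OF merge]
  have u: "u \<in> embeddings P ?p" "range_of P u = inv ?z ` m\<^sub>1 ` {1..?k}"
    unfolding u_def by (rule merge_positions_embedding[OF P P3 mm(1,3,5)])+
  have v: "v \<in> embeddings P ?p" "range_of P v = inv ?z ` m\<^sub>2 ` {1..?k}"
    unfolding v_def by (rule merge_positions_embedding[OF P P3 mm(2,4,6)])+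
  have zi: "inv ?z ` {1..?p} = {1..?p}" by (rule permutes_image[OF permutes_inv[OF pattern_perm[OF P3]]])
  have "range_of P u \<union> range_of P v = inv ?z ` (m\<^sub>1 ` {1..?k} \<union> m\<^sub>2 ` {1..?k})" unfolding u v by blast
  also have "\<dots> = {1..?p}" unfolding mm(7) zi ..
  finally have un: "range_of P u \<union> range_of P v = {1..?p}" .
  have cu: "card (range_of P u) = ?k" "card (range_of P v) = ?k"
    using card_image[OF embedding_inj[OF u(1)]] card_image[OF embedding_inj[OF v(1)]] by simp_all
  let ?D = "range_of P u \<inter> range_of P v" and ?J = "u ` pat_adj P \<inter> v ` pat_adj P"
  have cD: "?p + card ?D = 2 * ?k"
    using card_Un_Int[of "range_of P u" "range_of P v"] cu un by simp
  have "card ?D > 0" using cD short by simp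
  hence ne: "?D \<noteq> {}" by auto
  note ov = overlapping_embeddings_adj[OF P u(1) v(1) ne]
  have sub: "pat_adj P \<subseteq> {1..?k}" using pattern_adj_range(1)[OF P] by blast
  have ca: "card (u ` pat_adj P) = card (pat_adj P)" "card (v ` pat_adj P) = card (pat_adj P)"
    using card_image[OF inj_on_subset[OF embedding_inj[OF u(1)] sub]] card_image[OF inj_on_subset[OF embedding_inj[OF v(1)] sub]]
    by simp_all
  have ui: "u i = inv ?z (m\<^sub>1 (?x i))" "v i = inv ?z (m\<^sub>2 (?x i))" if "i \<in> pat_adj P" for i
    using that sub unfolding u_def v_def merge_positions_def by auto
  have "u ` pat_adj P = (\<lambda>i. inv ?z (m\<^sub>1 (?x i))) ` pat_adj P" "v ` pat_adj P = (\<lambda>i. inv ?z (m\<^sub>2 (?x i))) ` pat_adj P"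
    by (intro image_cong refl ui; assumption)+
  hence "pat_adj P\<^sub>3 = u ` pat_adj P \<union> v ` pat_adj P" unfolding mm(8) by simp
  hence "card (pat_adj P\<^sub>3) + card ?J = 2 * card (pat_adj P)"
    using card_Un_Int[of "u ` pat_adj P" "v ` pat_adj P"] finite_adj[OF P] ca by simp
  moreover note num_blocks_adj[OF P] num_blocks_adj[OF P3] num_blocks_pos[OF P] cD ov(1)
  ultimately have q: "num_blocks P\<^sub>3 + card ?D = 2 * num_blocks P + card ?J" "num_blocks P \<ge> 1" by linarith+
  show "num_blocks P\<^sub>3 \<le> 2 * num_blocks P - 1" using q ov(1) by linarith
  assume "num_blocks P\<^sub>3 = 2 * num_blocks P - 1"
  hence "card ?J + 1 = card ?D" using q by linarith
  from ov(2)[OF this] show "2 * ?k - ?p \<le> max_block_size P" using cD by linarith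
qed

definition short_merges :: "vincular_pattern \<Rightarrow> (vincular_pattern \<times> (nat \<Rightarrow> nat) \<times> (nat \<Rightarrow> nat)) set" where
  "short_merges P = {(P\<^sub>3, m\<^sub>1, m\<^sub>2). is_vincular_pattern P\<^sub>3 \<and> is_merge P P P\<^sub>3 m\<^sub>1 m\<^sub>2 \<and> pat_length P\<^sub>3 < 2 * pat_length P}"

lemma finite_short_merges: "finite (short_merges P)"
proof -
  let ?k = "pat_length P"
  let ?V = "(\<lambda>(p, z, C). Vincular p z C) ` (SIGMA p:{..<2 * ?k}. {z. z permutes {1..p}} \<times> Pow {1..p - 1})"
  let ?M = "{1..?k} \<rightarrow>\<^sub>E {1..2 * ?k}"
  have "finite (?V \<times> ?M \<times> ?M)"
    by (intro finite_cartesian_product finite_imageI finite_SigmaI finite_PiE finite_perms) auto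
  moreover have "short_merges P \<subseteq> ?V \<times> ?M \<times> ?M"
  proof
    fix t assume t: "t \<in> short_merges P"
    obtain P3 m1 m2 where [simp]: "t = (P3, m1, m2)" by (cases t)
    have *: "is_vincular_pattern P3" "is_merge P P P3 m1 m2" "pat_length P3 < 2 * ?k"
      using t unfolding short_merges_def by auto
    obtain p z C where [simp]: "P3 = Vincular p z C" by (cases P3)
    have "z permutes {1..p}" "C \<subseteq> {1..p - 1}" "p < 2 * ?k" using * unfolding is_vincular_pattern_def by auto
    hence "P3 \<in> ?V" by force
    moreover have "m1 \<in> {1..?k} \<rightarrow>\<^sub>E {1..p}" "m2 \<in> {1..?k} \<rightarrow>\<^sub>E {1..p}" using is_mergeD(1,2)[OF *(2)] by simp_all
    moreover have "({1..?k} \<rightarrow>\<^sub>E {1..p}) \<subseteq> ?M" using \<open>p < 2 * ?k\<close> by (intro PiE_mono) auto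
    ultimately show "t \<in> ?V \<times> ?M \<times> ?M" by auto
  qed
  ultimately show ?thesis by (rule finite_subset[rotated])
qed

section \<open>Overlapping pairs of occurrences are counted by merges\<close>

lemma rank_in_Suc:
  assumes "finite V" "x \<in> V" "x + 1 \<in> V"
  shows "rank_in V (x + 1) = rank_in V x + 1"
proof -
  have "{y \<in> V. y \<le> x + 1} = insert (x + 1) {y \<in> V. y \<le> x}" using assms by auto
  thus ?thesis unfolding rank_in_def using assms(1) by simp
qed

text \<open>The pattern that \<open>\<pi>\<close> induces on the union of the ranges of \<open>u\<close> and \<open>v\<close>, with exactly the links
  demanded by \<open>u\<close> or \<open>v\<close>.\<close>

definition union_pattern ::
  "vincular_pattern \<Rightarrow> (nat \<Rightarrow> nat) \<Rightarrow> (nat \<Rightarrow> nat) \<Rightarrow> (nat \<Rightarrow> nat) \<Rightarrow> vincular_pattern" where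
  "union_pattern P \<pi> u v =
     (let I = range_of P u \<union> range_of P v in
      Vincular (card I)
        (\<lambda>d. if d \<in> {1..card I} then rank_in (\<pi> ` I) (\<pi> (enum_of I d)) else d)
        (rank_in I ` (u ` pat_adj P \<union> v ` pat_adj P)))"

text \<open>The last two claims recover \<open>u\<close> and \<open>v\<close> from the merge and from the embedding \<open>e\<close> of the merged
  pattern; they make the passage from pairs to merges injective.\<close>

lemma pattern_of_union:
  assumes P: "is_vincular_pattern P" and \<pi>: "\<pi> permutes {1..n}"
    and u: "u \<in> embeddings P n" "occurs_at P u \<pi>" and v: "v \<in> embeddings P n" "occurs_at P v \<pi>"
  defines "I \<equiv> range_of P u \<union> range_of P v"
  defines "Q \<equiv> union_pattern P \<pi> u v"
    and "m \<equiv> \<lambda>w. \<lambda>a\<in>{1..pat_length P}. rank_in (\<pi> ` I) (\<pi> (w (inv (pat_perm P) a)))"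
    and "e \<equiv> restrict (enum_of I) {1..card I}"
  shows "is_vincular_pattern Q" "is_merge P P Q (m u) (m v)" "pat_length Q = card I"
    "e \<in> embeddings Q n" "occurs_at Q e \<pi>"
    "u = (\<lambda>i\<in>{1..pat_length P}. e (inv (pat_perm Q) (m u (pat_perm P i))))"
    "v = (\<lambda>i\<in>{1..pat_length P}. e (inv (pat_perm Q) (m v (pat_perm P i))))"
proof -
  let ?k = "pat_length P" and ?s = "pat_perm P" and ?A = "u ` pat_adj P \<union> v ` pat_adj P"
  define p where "p = card I"
  define V where "V = \<pi> ` I"
  define z where "z = (\<lambda>d. if d \<in> {1..p} then rank_in V (\<pi> (enum_of I d)) else d)"
  have Q: "Q = Vincular p z (rank_in I ` ?A)"
    unfolding Q_def union_pattern_def Let_def I_def[symmetric] z_def p_def V_def ..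
  have Qs: "pat_length Q = p" "pat_perm Q = z" "pat_adj Q = rank_in I ` ?A" unfolding Q by simp_all
  thus "pat_length Q = card I" unfolding p_def by simp
  have fI: "finite I" and fV: "finite V" unfolding I_def V_def by auto
  have inj: "inj \<pi>" using \<pi> by (rule permutes_inj)
  have cV: "card V = p" unfolding V_def p_def by (rule card_image[OF inj_on_subset[OF inj subset_UNIV]])
  have s: "?s permutes {1..?k}" by (rule pattern_perm[OF P])
  have sin: "?s i \<in> {1..?k} \<longleftrightarrow> i \<in> {1..?k}" "inv ?s i \<in> {1..?k} \<longleftrightarrow> i \<in> {1..?k}" for i
    by (rule permutes_in_image[OF s], rule permutes_in_image[OF permutes_inv[OF s]])
  have sinv: "?s (inv ?s a) = a" "inv ?s (?s a) = a" for a using permutes_inverses[OF s] by auto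
  have In: "I \<subseteq> {1..n}" unfolding I_def using embedding_in[OF u(1)] embedding_in[OF v(1)] by blast
  have enI: "enum_of I d \<in> I" "rank_in I (enum_of I d) = d" if "d \<in> {1..p}" for d
    using that enum_of_mem[OF fI] rank_enum[OF fI] unfolding p_def by auto
  have rkI: "rank_in I y \<in> {1..p}" "enum_of I (rank_in I y) = y" if "y \<in> I" for y
    using that rank_in_range[OF fI] enum_rank[OF fI] unfolding p_def by auto
  have zr: "z (rank_in I y) = rank_in V (\<pi> y)" if "y \<in> I" for y
    using rkI[OF that] unfolding z_def by simp
  have z: "z permutes {1..p}"
  proof (rule bij_imp_permutes)
    have "bij_betw (enum_of I) {1..p} I" unfolding p_def by (rule enum_of_bij[OF fI])
    moreover have "bij_betw \<pi> I V" unfolding V_def bij_betw_def using inj_on_subset[OF inj subset_UNIV] by blast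
    moreover have "bij_betw (rank_in V) V {1..p}" using rank_in_bij[OF fV] unfolding cV .
    ultimately have "bij_betw (rank_in V \<circ> (\<pi> \<circ> enum_of I)) {1..p} {1..p}" by (meson bij_betw_trans)
    thus "bij_betw z {1..p} {1..p}" by (rule bij_betw_cong[THEN iffD1, rotated]) (simp add: z_def)
  qed (unfold z_def, rule if_not_P)
  have zi: "inv z (rank_in V (\<pi> y)) = rank_in I y" if "y \<in> I" for y
    using zr[OF that] permutes_inverses(2)[OF z] by metis
  have zin: "inv z a \<in> {1..p}" if "a \<in> {1..p}" for a
    using that permutes_in_image[OF permutes_inv[OF z]] by blast
  have \<pi>V: "\<pi> y \<in> V" if "y \<in> I" for y using that unfolding V_def by blast
  have single: "m w \<in> {1..?k} \<rightarrow>\<^sub>E {1..p} \<and> strict_mono_on {1..?k} (m w)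
      \<and> (\<forall>a\<in>{1..?k}. \<forall>b\<in>{1..?k}. (m w a, m w b) \<in> appearance_order p z \<longleftrightarrow> (a, b) \<in> appearance_order ?k ?s)
      \<and> (\<forall>i\<in>{1..?k}. inv z (m w (?s i)) = rank_in I (w i))
      \<and> (\<forall>i\<in>pat_adj P. rank_in I (w (i + 1)) = rank_in I (w i) + 1)
      \<and> m w ` {1..?k} = rank_in V ` \<pi> ` range_of P w
      \<and> w = (\<lambda>i\<in>{1..?k}. e (inv z (m w (?s i))))"
    if w: "w \<in> embeddings P n" "occurs_at P w \<pi>" and wI: "range_of P w \<subseteq> I" for w
  proof -
    have wi: "w i \<in> I" if "i \<in> {1..?k}" for i using wI that by blast
    have wsi: "w (inv ?s a) \<in> I" if "a \<in> {1..?k}" for a using wi sin(2) that by blast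
    have mw: "m w a = rank_in V (\<pi> (w (inv ?s a)))" if "a \<in> {1..?k}" for a
      using that unfolding m_def V_def by simp
    have mwin: "m w a \<in> {1..p}" if "a \<in> {1..?k}" for a
      unfolding mw[OF that] using rank_in_range[OF fV \<pi>V[OF wsi[OF that]]] cV by simp
    have "m w \<in> extensional {1..?k}" unfolding m_def by simp
    hence 1: "m w \<in> {1..?k} \<rightarrow>\<^sub>E {1..p}" using mwin unfolding PiE_def by blast
    have 2: "strict_mono_on {1..?k} (m w)"
    proof (rule strict_mono_onI)
      fix a b assume ab: "a \<in> {1..?k}" "b \<in> {1..?k}" "a < b"
      have "\<pi> (w (inv ?s a)) < \<pi> (w (inv ?s b))" using w(2) ab unfolding occurs_at_def strict_mono_on_def by blast
      thus "m w a < m w b"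
        unfolding mw[OF ab(1)] mw[OF ab(2)] using rank_in_less_iff[OF fV \<pi>V[OF wsi[OF ab(1)]] \<pi>V[OF wsi[OF ab(2)]]] by blast
    qed
    have zm: "inv z (m w a) = rank_in I (w (inv ?s a))" if "a \<in> {1..?k}" for a
      unfolding mw[OF that] by (rule zi[OF wsi[OF that]])
    have 3: "(m w a, m w b) \<in> appearance_order p z \<longleftrightarrow> (a, b) \<in> appearance_order ?k ?s"
      if a: "a \<in> {1..?k}" and b: "b \<in> {1..?k}" for a b
      unfolding appearance_order_iff[OF z mwin[OF a] mwin[OF b]] appearance_order_iff[OF s a b] zm[OF a] zm[OF b]
        rank_in_less_iff[OF fI wsi[OF a] wsi[OF b]]
      using embedding_less_iff[OF w(1)] sin(2) a b by blast
    have 4: "inv z (m w (?s i)) = rank_in I (w i)" if "i \<in> {1..?k}" for i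
      using zm[of "?s i"] sin(1)[of i] that sinv by simp
    have 5: "rank_in I (w (i + 1)) = rank_in I (w i) + 1" if "i \<in> pat_adj P" for i
      using rank_in_Suc[OF fI, of "w i"] wi[OF pattern_adj_range(1)[OF P that]]
        wi[OF pattern_adj_range(2)[OF P that]] embedding_adj[OF w(1) that] by simp
    have "m w ` {1..?k} = (\<lambda>a. rank_in V (\<pi> (w a))) ` inv ?s ` {1..?k}"
      unfolding image_image by (intro image_cong refl mw)
    also have "inv ?s ` {1..?k} = {1..?k}" by (rule permutes_image[OF permutes_inv[OF s]])
    finally have 6: "m w ` {1..?k} = rank_in V ` \<pi> ` range_of P w" by (simp add: image_image)
    have 7: "w = (\<lambda>i\<in>{1..?k}. e (inv z (m w (?s i))))"
    proof (rule extensionalityI[of _ "{1..?k}"])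
      show "w \<in> extensional {1..?k}" using w(1) unfolding embeddings_def PiE_def by blast
      fix i assume i: "i \<in> {1..?k}"
      have "e (inv z (m w (?s i))) = enum_of I (rank_in I (w i))"
        unfolding 4[OF i] e_def using rkI(1)[OF wi[OF i]] p_def by simp
      also have "\<dots> = w i" by (rule rkI(2)[OF wi[OF i]])
      finally show "w i = (\<lambda>i\<in>{1..?k}. e (inv z (m w (?s i)))) i" using i by simp
    qed simp
    from 1 2 3 4 5 6 7 show ?thesis by blast
  qed
  have uI: "range_of P u \<subseteq> I" and vI: "range_of P v \<subseteq> I" unfolding I_def by auto
  note c1 = conjunct1 and c2 = conjunct2
  note U = single[OF u uI, THEN c1] single[OF u uI, THEN c2, THEN c1] single[OF u uI, THEN c2, THEN c2, THEN c1]
    single[OF u uI, THEN c2, THEN c2, THEN c2, THEN c1] single[OF u uI, THEN c2, THEN c2, THEN c2, THEN c2, THEN c1]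
    single[OF u uI, THEN c2, THEN c2, THEN c2, THEN c2, THEN c2, THEN c1]
    single[OF u uI, THEN c2, THEN c2, THEN c2, THEN c2, THEN c2, THEN c2]
  note V' = single[OF v vI, THEN c1] single[OF v vI, THEN c2, THEN c1] single[OF v vI, THEN c2, THEN c2, THEN c1]
    single[OF v vI, THEN c2, THEN c2, THEN c2, THEN c1] single[OF v vI, THEN c2, THEN c2, THEN c2, THEN c2, THEN c1]
    single[OF v vI, THEN c2, THEN c2, THEN c2, THEN c2, THEN c2, THEN c1]
    single[OF v vI, THEN c2, THEN c2, THEN c2, THEN c2, THEN c2, THEN c2]
  show "u = (\<lambda>i\<in>{1..?k}. e (inv (pat_perm Q) (m u (?s i))))" unfolding Qs by (rule U(7))
  show "v = (\<lambda>i\<in>{1..?k}. e (inv (pat_perm Q) (m v (?s i))))" unfolding Qs by (rule V'(7))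
  have "m u ` {1..?k} \<union> m v ` {1..?k} = rank_in V ` \<pi> ` I" unfolding U(6) V'(6) I_def by (simp only: image_Un)
  also have "\<dots> = {1..p}" using rank_in_bij[OF fV] cV unfolding V_def[symmetric] bij_betw_def by simp
  finally have un: "m u ` {1..?k} \<union> m v ` {1..?k} = {1..p}" .
  have adjr: "i \<in> {1..?k}" if "i \<in> pat_adj P" for i using pattern_adj_range(1)[OF P that] .
  have adjw: "\<forall>i\<in>pat_adj P. inv z (m w (?s (i + 1))) = inv z (m w (?s i)) + 1"
    if w: "\<forall>i\<in>{1..?k}. inv z (m w (?s i)) = rank_in I (w i)" "\<forall>i\<in>pat_adj P. rank_in I (w (i + 1)) = rank_in I (w i) + 1" for w
  proof
    fix i assume i: "i \<in> pat_adj P"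
    have "inv z (m w (?s (i + 1))) = rank_in I (w (i + 1))" "inv z (m w (?s i)) = rank_in I (w i)"
      using w(1) pattern_adj_range[OF P i] by blast+
    thus "inv z (m w (?s (i + 1))) = inv z (m w (?s i)) + 1" using w(2) i by simp
  qed
  have adjQ: "rank_in I ` ?A = (\<lambda>i. inv z (m u (?s i))) ` pat_adj P \<union> (\<lambda>i. inv z (m v (?s i))) ` pat_adj P"
  proof -
    have "(\<lambda>i. inv z (m u (?s i))) ` pat_adj P = (\<lambda>i. rank_in I (u i)) ` pat_adj P"
      by (intro image_cong refl) (use U(4) adjr in blast)
    moreover have "(\<lambda>i. inv z (m v (?s i))) ` pat_adj P = (\<lambda>i. rank_in I (v i)) ` pat_adj P"
      by (intro image_cong refl) (use V'(4) adjr in blast)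
    ultimately show ?thesis by (simp only: image_Un image_image)
  qed
  show merge: "is_merge P P Q (m u) (m v)"
    unfolding is_merge_def Let_def Qs
    by (intro conjI U(1,2,3) V'(1,2,3) un adjw[OF U(4,5)] adjw[OF V'(4,5)] adjQ)
  have adj_step: "\<exists>y. c = rank_in I y \<and> y \<in> I \<and> y + 1 \<in> I \<and> rank_in I (y + 1) = c + 1" if c: "c \<in> rank_in I ` ?A" for c
  proof -
    obtain y where y: "c = rank_in I y" "y \<in> ?A" using c by blast
    then obtain w i where w: "i \<in> pat_adj P" "y = w i" "w = u \<or> w = v" by blast
    have we: "w \<in> embeddings P n" and wI: "range_of P w \<subseteq> I" using w(3) u v uI vI by auto
    have "y + 1 = w (i + 1)" using embedding_adj[OF we w(1)] w(2) by simp
    hence "y \<in> I" "y + 1 \<in> I" using pattern_adj_range[OF P w(1)] wI w(2) by auto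
    thus ?thesis using rank_in_Suc[OF fI] y by blast
  qed
  show vQ: "is_vincular_pattern Q" unfolding is_vincular_pattern_def Qs
  proof (intro conjI z)
    have "?k \<ge> 1" using P unfolding is_vincular_pattern_def by blast
    hence "u 1 \<in> I" unfolding I_def by auto
    thus "1 \<le> p" using rkI(1)[of "u 1"] by simp
    show "rank_in I ` ?A \<subseteq> {1..p - 1}"
    proof
      fix c assume "c \<in> rank_in I ` ?A"
      then obtain y where y: "c = rank_in I y" "y \<in> I" "y + 1 \<in> I" "rank_in I (y + 1) = c + 1" using adj_step by blast
      have "c \<in> {1..p}" "c + 1 \<in> {1..p}" using rkI(1)[OF y(2)] rkI(1)[OF y(3)] y by simp_all
      thus "c \<in> {1..p - 1}" by auto
    qed
  qed
  have ei: "e d = enum_of I d" if "d \<in> {1..p}" for d using that unfolding e_def p_def by simp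
  show "e \<in> embeddings Q n"
  proof -
    have "e d \<in> {1..n}" if "d \<in> {1..p}" for d unfolding ei[OF that] using enI(1)[OF that] In by blast
    moreover have "e \<in> extensional {1..p}" unfolding e_def p_def by simp
    ultimately have "e \<in> {1..p} \<rightarrow>\<^sub>E {1..n}" unfolding PiE_def by blast
    moreover have "strict_mono_on {1..p} e"
      using enum_of_strict_mono[OF fI] ei unfolding p_def[symmetric] strict_mono_on_def by simp
    moreover have "e (c + 1) = e c + 1" if c: "c \<in> rank_in I ` ?A" for c
    proof -
      obtain y where y: "c = rank_in I y" "y \<in> I" "y + 1 \<in> I" "rank_in I (y + 1) = c + 1" using adj_step[OF c] by blast
      have "e c = y" using ei rkI[OF y(2)] y(1) by simp
      moreover have "e (c + 1) = y + 1" using ei rkI[OF y(3)] y(4) by simp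
      ultimately show ?thesis by simp
    qed
    ultimately show ?thesis unfolding embeddings_def Qs by blast
  qed
  have "\<pi> (e (inv z a)) = enum_of V a" if a: "a \<in> {1..p}" for a
  proof -
    let ?y = "enum_of I (inv z a)"
    have y: "?y \<in> I" "rank_in I ?y = inv z a" using enI[OF zin[OF a]] .
    have "rank_in V (\<pi> ?y) = a" using zr[OF y(1)] y(2) permutes_inverses(1)[OF z] by simp
    hence "\<pi> ?y = enum_of V a" using enum_rank[OF fV \<pi>V[OF y(1)]] by simp
    thus ?thesis using ei[OF zin[OF a]] by simp
  qed
  thus "occurs_at Q e \<pi>"
    using enum_of_strict_mono[OF fV] unfolding occurs_at_def Qs cV strict_mono_on_def by simp
qed

text \<open>A triple \<open>(u, v, \<pi>)\<close> with \<open>u\<close> and \<open>v\<close> occurring in \<open>\<pi>\<close> is determined by its merge, by the embedding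
  of the merged pattern and by \<open>\<pi>\<close>. Counting the possible data by merge gives the bound.\<close>

lemma sum_overlapping_prob_le:
  assumes P: "is_vincular_pattern P"
  shows "(\<Sum>(u, v)\<in>overlapping_pairs P n. perm_prob n (\<lambda>\<pi>. occurs_at P u \<pi> \<and> occurs_at P v \<pi>))
     \<le> (\<Sum>(Q, m\<^sub>1, m\<^sub>2)\<in>short_merges P. real (card (embeddings Q n)) / fact (pat_length Q))"
proof -
  let ?k = "pat_length P"
  let ?O = "\<lambda>(u, v). {\<pi>. \<pi> permutes {1..n} \<and> (occurs_at P u \<pi> \<and> occurs_at P v \<pi>)}"
  let ?T = "Sigma (overlapping_pairs P n) ?O"
  let ?E = "\<lambda>(Q, m1, m2). SIGMA e:embeddings Q n. {\<pi>. \<pi> permutes {1..n} \<and> occurs_at Q e \<pi>}"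
  let ?S = "Sigma (short_merges P) ?E"
  let ?g = "\<lambda>Q m e. \<lambda>i\<in>{1..?k}. e (inv (pat_perm Q) (m (pat_perm P i)))"
  let ?f = "\<lambda>((Q, m1, m2), e, \<pi>). ((?g Q m1 e, ?g Q m2 e), \<pi>)"
  have finE: "finite (?E t)" for t
    by (cases t) (auto intro!: finite_SigmaI finite_embeddings finite_perm_set simp del: One_nat_def)
  have finS: "finite ?S" using finite_short_merges finE by (rule finite_SigmaI)
  have "?T \<subseteq> ?f ` ?S"
  proof
    fix t assume t: "t \<in> ?T"
    obtain u v \<pi> where [simp]: "t = ((u, v), \<pi>)" by (metis prod.collapse)
    have ov: "u \<in> embeddings P n" "v \<in> embeddings P n" "range_of P u \<inter> range_of P v \<noteq> {}"
      and \<pi>: "\<pi> permutes {1..n}" "occurs_at P u \<pi>" "occurs_at P v \<pi>"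
      using t unfolding overlapping_pairs_def by auto
    let ?I = "range_of P u \<union> range_of P v"
    define Q where "Q = union_pattern P \<pi> u v"
    define m where "m = (\<lambda>w. \<lambda>a\<in>{1..?k}. rank_in (\<pi> ` ?I) (\<pi> (w (inv (pat_perm P) a))))"
    define e where "e = restrict (enum_of ?I) {1..card ?I}"
    note pu = pattern_of_union[OF P \<pi>(1) ov(1) \<pi>(2) ov(2) \<pi>(3)]
    have Q: "is_vincular_pattern Q" "is_merge P P Q (m u) (m v)" "pat_length Q = card ?I"
      "e \<in> embeddings Q n" "occurs_at Q e \<pi>" "u = ?g Q (m u) e" "v = ?g Q (m v) e"
      unfolding Q_def m_def e_def by (rule pu)+
    have "card ?I + card (range_of P u \<inter> range_of P v) = 2 * ?k"
      using card_Un_Int[of "range_of P u" "range_of P v"] card_image[OF embedding_inj[OF ov(1)]]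
        card_image[OF embedding_inj[OF ov(2)]] by simp
    moreover have "card (range_of P u \<inter> range_of P v) > 0" using ov(3) by (simp add: card_gt_0_iff)
    ultimately have "pat_length Q < 2 * ?k" using Q(3) by linarith
    hence "(Q, m u, m v) \<in> short_merges P" using Q(1,2) unfolding short_merges_def by blast
    hence "((Q, m u, m v), e, \<pi>) \<in> ?S" using Q(4,5) \<pi>(1) by simp
    moreover have "t = ?f ((Q, m u, m v), e, \<pi>)" using Q(6,7) by simp
    ultimately show "t \<in> ?f ` ?S" by blast
  qed
  hence "card ?T \<le> card ?S" by (rule surj_card_le[OF finS])
  moreover have "card ?T = (\<Sum>x\<in>overlapping_pairs P n. card (?O x))"
    by (rule card_SigmaI[OF finite_overlapping_pairs], rule ballI) (simp add: case_prod_unfold finite_perm_set del: One_nat_def)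
  moreover have "card ?S = (\<Sum>t\<in>short_merges P. card (?E t))"
    by (rule card_SigmaI[OF finite_short_merges], rule ballI, rule finE)
  ultimately have "real (\<Sum>x\<in>overlapping_pairs P n. card (?O x)) \<le> real (\<Sum>t\<in>short_merges P. card (?E t))"
    by linarith
  hence le: "(\<Sum>x\<in>overlapping_pairs P n. real (card (?O x))) / fact n \<le> (\<Sum>t\<in>short_merges P. real (card (?E t))) / fact n"
    by (simp add: divide_right_mono)
  have "real (card (?E (Q, m1, m2))) / fact n = real (card (embeddings Q n)) / fact (pat_length Q)"
    if "(Q, m1, m2) \<in> short_merges P" for Q m1 m2
  proof -
    have Q: "is_vincular_pattern Q" using that unfolding short_merges_def by blast
    have "card (?E (Q, m1, m2)) = (\<Sum>e\<in>embeddings Q n. card {\<pi>. \<pi> permutes {1..n} \<and> occurs_at Q e \<pi>})"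
      unfolding prod.case by (rule card_SigmaI[OF finite_embeddings], rule ballI, rule finite_perm_set)
    hence "real (card (?E (Q, m1, m2))) / fact n = (\<Sum>e\<in>embeddings Q n. perm_prob n (occurs_at Q e))"
      unfolding perm_prob_def by (simp add: sum_divide_distrib)
    also have "\<dots> = (\<Sum>e\<in>embeddings Q n. 1 / fact (pat_length Q))"
      by (intro sum.cong refl perm_prob_occurs[OF Q])
    finally show ?thesis by simp
  qed
  hence "(\<Sum>t\<in>short_merges P. real (card (?E t))) / fact n
      = (\<Sum>(Q, m1, m2)\<in>short_merges P. real (card (embeddings Q n)) / fact (pat_length Q))"
    unfolding sum_divide_distrib by (intro sum.cong refl) auto
  moreover have "(\<Sum>x\<in>overlapping_pairs P n. real (card (?O x))) / fact n
     = (\<Sum>(u, v)\<in>overlapping_pairs P n. perm_prob n (\<lambda>\<pi>. occurs_at P u \<pi> \<and> occurs_at P v \<pi>))"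
    unfolding sum_divide_distrib perm_prob_def by (intro sum.cong refl) auto
  ultimately show ?thesis using le by simp
qed

section \<open>Growth of the variance forces the inequality between merge numbers\<close>

lemma falling_factorial_fact: "l \<le> n \<Longrightarrow> falling_factorial n l * fact (n - l) = fact n"
proof (induction l)
  case (Suc l)
  have "fact (n - l) = (n - l) * fact (n - Suc l)" using Suc.prems by (subst fact_reduce) auto
  thus ?case using Suc unfolding falling_factorial_def by (simp add: mult.assoc)
qed (simp add: falling_factorial_def)

lemma binomial_ge_power:
  assumes "q \<le> n"
  shows "(real n - real q) ^ q / fact q \<le> real (n choose q)"
proof -
  have "(real n - real q) ^ q = (\<Prod>i = 0..<q. real n - real q)" by simp
  also have "\<dots> \<le> (\<Prod>i = 0..<q. real n - real i)" using assms by (intro prod_mono) auto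
  finally show ?thesis by (simp add: binomial_gbinomial gbinomial_prod_rev divide_right_mono)
qed

text \<open>Grouping the merges with \<open>2 * j - 1\<close> blocks by the number \<open>l\<close> of shared letters. By
  \<open>merge_num_blocks\<close> no \<open>l\<close> beyond the maximal block size occurs.\<close>

lemma sum_merges_losing_one_block:
  assumes P: "is_vincular_pattern P" and k: "pat_length P = k" and j: "num_blocks P = j"
  shows "(\<Sum>t | t \<in> short_merges P \<and> num_blocks (fst t) = 2 * j - 1. 1 / fact (pat_length (fst t)))
     = (\<Sum>l = 1..max_block_size P. real (num_self_merges P (2 * k - l) (2 * j - 1)) / fact (2 * k - l))"
proof -
  let ?q = "2 * j - 1" and ?M = "max_block_size P"
  let ?S = "{t \<in> short_merges P. num_blocks (fst t) = ?q}"
  let ?g = "\<lambda>t :: vincular_pattern \<times> (nat \<Rightarrow> nat) \<times> (nat \<Rightarrow> nat). 2 * k - pat_length (fst t)"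
  let ?h = "\<lambda>t :: vincular_pattern \<times> (nat \<Rightarrow> nat) \<times> (nat \<Rightarrow> nat). 1 / fact (pat_length (fst t)) :: real"
  have finS: "finite ?S" using finite_short_merges by simp
  have Mk: "?M \<le> k" using max_block_size_le[OF P] k by simp
  have gS: "?g ` ?S \<subseteq> {1..?M}"
  proof
    fix l assume "l \<in> ?g ` ?S"
    then obtain Q m1 m2 where t: "(Q, m1, m2) \<in> short_merges P" "num_blocks Q = ?q" "l = 2 * k - pat_length Q" by auto
    have *: "is_vincular_pattern Q" "is_merge P P Q m1 m2" "pat_length Q < 2 * k"
      using t(1) k unfolding short_merges_def by auto
    have "l \<le> ?M" using merge_num_blocks(2)[OF P *(1,2)] *(3) t k j by simp
    thus "l \<in> {1..?M}" using *(3) t(3) by simp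
  qed
  have "sum ?h ?S = (\<Sum>l = 1..?M. sum ?h {t \<in> ?S. ?g t = l})"
    by (rule sum.group[symmetric, OF finS _ gS]) simp
  also have "\<dots> = (\<Sum>l = 1..?M. real (num_self_merges P (2 * k - l) ?q) / fact (2 * k - l))"
  proof (rule sum.cong[OF refl])
    fix l assume l: "l \<in> {1..?M}"
    let ?R = "{(Q, m1, m2). is_vincular_pattern Q \<and> is_merge P P Q m1 m2 \<and> pat_length Q = 2 * k - l \<and> num_blocks Q = ?q}"
    have eq: "{t \<in> ?S. ?g t = l} = ?R"
    proof (intro equalityI subsetI)
      fix t assume "t \<in> {t \<in> ?S. ?g t = l}"
      thus "t \<in> ?R" using k by (cases t) (auto simp: short_merges_def)
    next
      fix t assume "t \<in> ?R"
      thus "t \<in> {t \<in> ?S. ?g t = l}" using k l Mk by (cases t) (auto simp: short_merges_def)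
    qed
    have "sum ?h ?R = (\<Sum>t\<in>?R. 1 / fact (2 * k - l))" by (intro sum.cong refl) auto
    thus "sum ?h {t \<in> ?S. ?g t = l} = real (num_self_merges P (2 * k - l) ?q) / fact (2 * k - l)"
      unfolding eq num_self_merges_def by simp
  qed
  finally show ?thesis .
qed

text \<open>Merges with fewer than \<open>2 * j - 1\<close> blocks have \<open>O(n^(2 * j - 2))\<close> embeddings each, so only those
  with \<open>2 * j - 1\<close> blocks enter the leading term.\<close>

lemma occurrence_variance_le:
  assumes P: "is_vincular_pattern P" and k: "pat_length P = k" and j: "num_blocks P = j"
    and n: "n \<ge> 1"
  shows "occurrence_variance P n \<le>
     real n ^ (2 * j - 1) / fact (2 * j - 1) *
       (\<Sum>l = 1..max_block_size P. real (num_self_merges P (2 * k - l) (2 * j - 1)) / fact (2 * k - l))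
     + real (card (short_merges P)) * real n ^ (2 * j - 2)
     - real (card (overlapping_pairs P n)) / (fact k)\<^sup>2"
proof -
  let ?q = "2 * j - 1"
  let ?S = "{t \<in> short_merges P. num_blocks (fst t) = ?q}"
  let ?N = "real n ^ ?q / fact ?q"
  have term_le: "real (card (embeddings Q n)) / fact (pat_length Q)
      \<le> (if num_blocks Q = ?q then ?N * (1 / fact (pat_length Q)) else 0) + real n ^ (2 * j - 2)"
    if t: "(Q, m1, m2) \<in> short_merges P" for Q m1 m2
  proof -
    have Q: "is_vincular_pattern Q" "is_merge P P Q m1 m2" "pat_length Q < 2 * pat_length P"
      using t unfolding short_merges_def by auto
    have h: "num_blocks Q \<le> ?q" using merge_num_blocks(1)[OF P Q] j by simp
    have le: "card (embeddings Q n) \<le> n choose num_blocks Q" by (rule card_embeddings_le_choose[OF Q(1)])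
    show ?thesis
    proof (cases "num_blocks Q = ?q")
      case True
      have "(n choose ?q) * fact ?q \<le> n ^ ?q" by (rule binomial_fact_pow)
      hence "real ((n choose ?q) * fact ?q) \<le> real (n ^ ?q)" by (rule of_nat_mono)
      hence "real (n choose ?q) * fact ?q \<le> real n ^ ?q" by simp
      hence "real (n choose ?q) \<le> ?N" by (simp add: field_simps)
      moreover have "real (card (embeddings Q n)) \<le> real (n choose ?q)" using le unfolding True by (rule of_nat_mono)
      ultimately have "real (card (embeddings Q n)) \<le> ?N" by (rule order_trans[rotated])
      hence "real (card (embeddings Q n)) / fact (pat_length Q) \<le> ?N / fact (pat_length Q)"
        by (rule divide_right_mono) simp
      thus ?thesis using True by (simp add: add_increasing2)
    next
      case False
      have "n choose num_blocks Q \<le> n ^ num_blocks Q"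
        using binomial_fact_pow[of n "num_blocks Q"] fact_ge_1[of "num_blocks Q"]
        by (metis le_trans mult.right_neutral mult_le_mono2)
      also have "\<dots> \<le> n ^ (2 * j - 2)" using h False n by (intro power_increasing) auto
      finally have "real (card (embeddings Q n)) \<le> real n ^ (2 * j - 2)" using le
        by (metis le_trans of_nat_mono of_nat_power)
      moreover have "real (card (embeddings Q n)) / fact (pat_length Q) \<le> real (card (embeddings Q n)) / 1"
        by (intro divide_left_mono) auto
      ultimately have "real (card (embeddings Q n)) / fact (pat_length Q) \<le> real n ^ (2 * j - 2)" by linarith
      thus ?thesis using False by simp
    qed
  qed
  let ?f = "\<lambda>t :: vincular_pattern \<times> (nat \<Rightarrow> nat) \<times> (nat \<Rightarrow> nat).
    (if num_blocks (fst t) = ?q then ?N * (1 / fact (pat_length (fst t))) else 0) + real n ^ (2 * j - 2)"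
  have "occurrence_variance P n =
      (\<Sum>(u, v)\<in>overlapping_pairs P n. perm_prob n (\<lambda>\<pi>. occurs_at P u \<pi> \<and> occurs_at P v \<pi>))
      - real (card (overlapping_pairs P n)) / (fact k)\<^sup>2"
    unfolding occurrence_variance_overlapping[OF P] k
    by (simp add: case_prod_unfold sum_subtractf power_one_over divide_inverse power_inverse)
  also have "(\<Sum>(u, v)\<in>overlapping_pairs P n. perm_prob n (\<lambda>\<pi>. occurs_at P u \<pi> \<and> occurs_at P v \<pi>))
     \<le> (\<Sum>(Q, m\<^sub>1, m\<^sub>2)\<in>short_merges P. real (card (embeddings Q n)) / fact (pat_length Q))"
    by (rule sum_overlapping_prob_le[OF P])
  also have "\<dots> \<le> sum ?f (short_merges P)"
  proof (rule sum_mono)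
    fix t assume t: "t \<in> short_merges P"
    obtain Q m1 m2 where [simp]: "t = (Q, m1, m2)" by (cases t)
    show "(case t of (Q, m\<^sub>1, m\<^sub>2) \<Rightarrow> real (card (embeddings Q n)) / fact (pat_length Q)) \<le> ?f t"
      using term_le[of Q m1 m2] t by (simp only: prod.case fst_conv \<open>t = _\<close>)
  qed
  also have "\<dots> = ?N * (\<Sum>t\<in>?S. 1 / fact (pat_length (fst t))) + real (card (short_merges P)) * real n ^ (2 * j - 2)"
    unfolding sum.distrib sum_distrib_left
    by (simp add: sum.If_cases[OF finite_short_merges] Int_def)
  also have "(\<Sum>t\<in>?S. 1 / fact (pat_length (fst t))) =
     (\<Sum>l = 1..max_block_size P. real (num_self_merges P (2 * k - l) ?q) / fact (2 * k - l))"
    by (rule sum_merges_losing_one_block[OF P k j])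
  finally show ?thesis by simp
qed

text \<open>The strict inequality is the comparison of leading coefficients in \<open>occurrence_variance_le\<close>; it is
  strict because \<open>c > 0\<close> survives in the limit.\<close>

lemma merge_inequality_if_variance_growth:
  assumes P: "is_vincular_pattern P" and k: "pat_length P = k" and j: "num_blocks P = j"
    and c: "c > 0" and var: "\<And>n. n \<ge> k \<Longrightarrow> c * real n ^ (2 * j - 1) \<le> occurrence_variance P n"
  shows "((2 * k) choose k) * ((2 * j - 1) choose j) * j <
    (\<Sum>l = 1..max_block_size P. falling_factorial (2 * k) l * num_self_merges P (2 * k - l) (2 * j - 1))"
proof -
  let ?q = "2 * j - 1"
  define \<alpha> where "\<alpha> = (\<Sum>l = 1..max_block_size P. real (num_self_merges P (2 * k - l) ?q) / fact (2 * k - l))"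
  define \<beta> where "\<beta> = real ((?q choose j) * j)"
  define K where "K = real (card (short_merges P))"
  \<comment> \<open>\<open>A\<close> is the room lost by keeping block starts apart and by \<open>(n choose q) \<ge> (n - q)^q / q!\<close>.\<close>
  define A where "A = k + ?q * k + ?q"
  have j1: "j \<ge> 1" using num_blocks_pos[OF P] j by simp
  have k1: "k \<ge> 1" using P k unfolding is_vincular_pattern_def by simp
  have main: "c \<le> \<alpha> / fact ?q + K / real n - \<beta> / (fact ?q * (fact k)\<^sup>2) * (1 - real A / real n) ^ ?q"
    if n: "n \<ge> A" for n
  proof -
    have n1: "n \<ge> 1" "n \<ge> k" "k + ?q * k + ?q \<le> n" using n k1 unfolding A_def by auto
    have n0: "real n > 0" using n1 by simp
    let ?N = "n - k - ?q * k"
    have "(?N choose ?q) * ((?q choose j) * j) \<le> card (overlapping_pairs P (n - k + k))"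
      using card_overlapping_pairs_ge[OF P k j, of "n - k"] by simp
    hence ov: "real (?N choose ?q) * \<beta> \<le> real (card (overlapping_pairs P n))"
      unfolding \<beta>_def using n1(2) by (metis le_add_diff_inverse2 of_nat_le_iff of_nat_mult)
    have "(real ?N - real ?q) ^ ?q / fact ?q \<le> real (?N choose ?q)"
      using n1(3) by (intro binomial_ge_power) linarith
    moreover have "real ?N - real ?q = real n - real A"
      using n1 unfolding A_def by (simp add: of_nat_diff)
    ultimately have "(real n - real A) ^ ?q / fact ?q \<le> real (?N choose ?q)" by simp
    hence "(real n - real A) ^ ?q / fact ?q * \<beta> \<le> real (?N choose ?q) * \<beta>"
      by (rule mult_right_mono) (simp add: \<beta>_def)
    hence "(real n - real A) ^ ?q / fact ?q * \<beta> \<le> real (card (overlapping_pairs P n))" using ov by linarith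
    hence "(real n - real A) ^ ?q / fact ?q * \<beta> / (fact k)\<^sup>2 \<le> real (card (overlapping_pairs P n)) / (fact k)\<^sup>2"
      by (rule divide_right_mono) simp
    moreover have "c * real n ^ ?q \<le> real n ^ ?q / fact ?q * \<alpha> + K * real n ^ (2 * j - 2)
        - real (card (overlapping_pairs P n)) / (fact k)\<^sup>2"
      using var[OF n1(2)] occurrence_variance_le[OF P k j n1(1)] unfolding \<alpha>_def K_def by linarith
    ultimately have le: "c * real n ^ ?q \<le> real n ^ ?q / fact ?q * \<alpha> + K * real n ^ (2 * j - 2)
        - (real n - real A) ^ ?q / fact ?q * \<beta> / (fact k)\<^sup>2" by linarith
    have "?q = Suc (2 * j - 2)" using j1 by simp
    hence p1: "real n ^ ?q = real n * real n ^ (2 * j - 2)" by (simp only: power_Suc)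
    have p2: "(real n - real A) ^ ?q = real n ^ ?q * (1 - real A / real n) ^ ?q"
      unfolding power_mult_distrib[symmetric] using n0 by (simp add: right_diff_distrib)
    have "real n ^ ?q * c \<le> real n ^ ?q * (\<alpha> / fact ?q + K / real n - \<beta> / (fact ?q * (fact k)\<^sup>2) * (1 - real A / real n) ^ ?q)"
    proof -
      have "real n ^ ?q * (K / real n) = K * real n ^ (2 * j - 2)" unfolding p1 using n0 by simp
      thus ?thesis using le unfolding p2 by (simp add: algebra_simps)
    qed
    moreover have "real n ^ ?q > 0" using n0 by simp
    ultimately show ?thesis by (simp only: mult_le_cancel_left_pos)
  qed
  have "(\<lambda>n. \<alpha> / fact ?q + K / real n - \<beta> / (fact ?q * (fact k)\<^sup>2) * (1 - real A / real n) ^ ?q)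
      \<longlonglongrightarrow> \<alpha> / fact ?q + 0 - \<beta> / (fact ?q * (fact k)\<^sup>2) * (1 - 0) ^ ?q"
    by (intro tendsto_intros lim_const_over_n)
  moreover have "\<forall>\<^sub>F n in sequentially. c \<le> \<alpha> / fact ?q + K / real n - \<beta> / (fact ?q * (fact k)\<^sup>2) * (1 - real A / real n) ^ ?q"
    using main unfolding eventually_sequentially by blast
  ultimately have "c \<le> \<alpha> / fact ?q + 0 - \<beta> / (fact ?q * (fact k)\<^sup>2) * (1 - 0) ^ ?q"
    by (intro tendsto_lowerbound) auto
  hence "0 < \<alpha> / fact ?q - \<beta> / (fact ?q * (fact k)\<^sup>2)" using c by simp
  hence "0 < (\<alpha> - \<beta> / (fact k)\<^sup>2) / fact ?q" by (simp add: diff_divide_distrib mult.commute)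
  hence "\<beta> / (fact k)\<^sup>2 < \<alpha>" by (simp add: zero_less_divide_iff)
  hence lt: "fact (2 * k) * (\<beta> / (fact k)\<^sup>2) < fact (2 * k) * \<alpha>"
    by (rule mult_strict_left_mono) simp
  have "fact (2 * k) * \<alpha> = real (\<Sum>l = 1..max_block_size P. falling_factorial (2 * k) l * num_self_merges P (2 * k - l) ?q)"
    unfolding \<alpha>_def sum_distrib_left of_nat_sum
  proof (rule sum.cong[OF refl])
    fix l assume "l \<in> {1..max_block_size P}"
    hence "l \<le> 2 * k" using max_block_size_le[OF P] k by simp
    from arg_cong[OF falling_factorial_fact[OF this], of real]
    have "real (falling_factorial (2 * k) l) * fact (2 * k - l) = fact (2 * k)" by simp
    hence "real (falling_factorial (2 * k) l) = fact (2 * k) / fact (2 * k - l)" by (simp add: field_simps)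
    thus "fact (2 * k) * (real (num_self_merges P (2 * k - l) ?q) / fact (2 * k - l)) =
      real (falling_factorial (2 * k) l * num_self_merges P (2 * k - l) ?q)" by simp
  qed
  moreover have "fact (2 * k) * (\<beta> / (fact k)\<^sup>2) = real (((2 * k) choose k) * (?q choose j) * j)"
  proof -
    have "fact (2 * k) / (fact k)\<^sup>2 = real ((2 * k) choose k)"
      by (simp add: binomial_fact power2_eq_square)
    thus ?thesis unfolding \<beta>_def by (simp add: field_simps)
  qed
  ultimately show ?thesis using lt by (simp only: of_nat_less_iff)
qed

section \<open>Small values in early positions\<close>

text \<open>Composing with the transposition of \<open>p\<close> and \<open>v\<close> makes \<open>p\<close> a fixed point.\<close>

lemma card_permutes_point:
  assumes S: "finite S" "p \<in> S" "v \<in> S"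
    and Q: "\<And>\<pi>. Q \<pi> \<Longrightarrow> \<pi> p = v"
  shows "card {\<pi>. \<pi> permutes S \<and> Q \<pi>} = card {\<rho>. \<rho> permutes (S - {p}) \<and> Q (Transposition.transpose p v \<circ> \<rho>)}"
proof -
  let ?t = "Transposition.transpose p v"
  have t: "?t permutes S" using S by (intro permutes_swap_id)
  have tt: "?t \<circ> (?t \<circ> f) = f" for f :: "'a \<Rightarrow> 'a" by (simp add: fun_eq_iff)
  have "bij_betw (\<lambda>\<pi>. ?t \<circ> \<pi>) {\<pi>. \<pi> permutes S \<and> Q \<pi>} {\<rho>. \<rho> permutes (S - {p}) \<and> Q (?t \<circ> \<rho>)}"
  proof (rule bij_betw_byWitness[where f' = "\<lambda>\<rho>. ?t \<circ> \<rho>"])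
    show "(\<lambda>\<pi>. ?t \<circ> \<pi>) ` {\<pi>. \<pi> permutes S \<and> Q \<pi>} \<subseteq> {\<rho>. \<rho> permutes (S - {p}) \<and> Q (?t \<circ> \<rho>)}"
    proof (rule image_subsetI)
      fix \<pi> assume "\<pi> \<in> {\<pi>. \<pi> permutes S \<and> Q \<pi>}"
      hence \<pi>: "\<pi> permutes S" "Q \<pi>" by auto
      have "?t \<circ> \<pi> permutes S" by (rule permutes_compose[OF \<pi>(1) t])
      hence "?t \<circ> \<pi> permutes (S - {p})" by (rule permutes_superset) (use Q[OF \<pi>(2)] in auto)
      thus "?t \<circ> \<pi> \<in> {\<rho>. \<rho> permutes (S - {p}) \<and> Q (?t \<circ> \<rho>)}" using \<pi>(2) tt by simp
    qed
    show "(\<lambda>\<rho>. ?t \<circ> \<rho>) ` {\<rho>. \<rho> permutes (S - {p}) \<and> Q (?t \<circ> \<rho>)} \<subseteq> {\<pi>. \<pi> permutes S \<and> Q \<pi>}"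
    proof (rule image_subsetI)
      fix \<rho> assume "\<rho> \<in> {\<rho>. \<rho> permutes (S - {p}) \<and> Q (?t \<circ> \<rho>)}"
      hence \<rho>: "\<rho> permutes (S - {p})" "Q (?t \<circ> \<rho>)" by auto
      have "\<rho> permutes S" using \<rho>(1) by (rule permutes_subset) auto
      thus "?t \<circ> \<rho> \<in> {\<pi>. \<pi> permutes S \<and> Q \<pi>}" using \<rho>(2) permutes_compose[OF _ t] by blast
    qed
  qed (simp_all add: tt)
  thus ?thesis by (rule bij_betw_same_card)
qed

lemma card_permutes_one_value:
  assumes "finite S" "p \<in> S" "v \<in> S"
  shows "card {\<pi>. \<pi> permutes S \<and> \<pi> p = v} = fact (card S - 1)"
proof -
  have "card {\<pi>. \<pi> permutes S \<and> \<pi> p = v} = card {\<rho>. \<rho> permutes (S - {p}) \<and> (Transposition.transpose p v \<circ> \<rho>) p = v}"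
    by (rule card_permutes_point[OF assms])
  also have "{\<rho>. \<rho> permutes (S - {p}) \<and> (Transposition.transpose p v \<circ> \<rho>) p = v} = {\<rho>. \<rho> permutes (S - {p})}"
    by (auto simp: permutes_not_in)
  also have "card \<dots> = fact (card S - 1)" using assms by (intro card_permutations) auto
  finally show ?thesis .
qed

lemma card_permutes_two_values:
  assumes S: "finite S" "p \<in> S" "v \<in> S" and S': "p' \<in> S" "v' \<in> S" "p \<noteq> p'" "v \<noteq> v'"
  shows "card {\<pi>. \<pi> permutes S \<and> (\<pi> p = v \<and> \<pi> p' = v')} = fact (card S - 2)"
proof -
  let ?t = "Transposition.transpose p v"
  have "card {\<pi>. \<pi> permutes S \<and> (\<pi> p = v \<and> \<pi> p' = v')}
     = card {\<rho>. \<rho> permutes (S - {p}) \<and> ((?t \<circ> \<rho>) p = v \<and> (?t \<circ> \<rho>) p' = v')}"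
    by (rule card_permutes_point[OF S]) simp
  also have "{\<rho>. \<rho> permutes (S - {p}) \<and> ((?t \<circ> \<rho>) p = v \<and> (?t \<circ> \<rho>) p' = v')}
     = {\<rho>. \<rho> permutes (S - {p}) \<and> \<rho> p' = ?t v'}"
    by (auto simp: permutes_not_in)
  also have "card \<dots> = fact (card (S - {p}) - 1)"
  proof (rule card_permutes_one_value)
    show "?t v' \<in> S - {p}" using S S' by (auto simp: Transposition.transpose_def)
  qed (use S S' in auto)
  finally show ?thesis using S by (simp add: numeral_2_eq_2)
qed

lemma perm_prob_le:
  assumes p: "p \<in> {1..n}" and m: "m \<le> n"
  shows "perm_prob n (\<lambda>\<pi>. \<pi> p \<le> m) = real m / real n"
proof -
  let ?S = "\<lambda>v. {\<pi>. \<pi> permutes {1..n} \<and> \<pi> p = v}"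
  have "{\<pi>. \<pi> permutes {1..n} \<and> \<pi> p \<le> m} = (\<Union>v\<in>{1..m}. ?S v)"
  proof (intro equalityI subsetI)
    fix \<pi> assume "\<pi> \<in> {\<pi>. \<pi> permutes {1..n} \<and> \<pi> p \<le> m}"
    hence \<pi>: "\<pi> permutes {1..n}" "\<pi> p \<le> m" by auto
    have "\<pi> p \<in> {1..n}" using permutes_in_image[OF \<pi>(1), of p] p by simp
    hence "\<pi> p \<in> {1..m}" using \<pi>(2) by simp
    thus "\<pi> \<in> (\<Union>v\<in>{1..m}. ?S v)" using \<pi>(1) by simp
  qed auto
  hence "card {\<pi>. \<pi> permutes {1..n} \<and> \<pi> p \<le> m} = (\<Sum>v\<in>{1..m}. card (?S v))"
    by (simp only:) (rule card_UN_disjoint, simp, intro ballI finite_perm_set, blast)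
  also have "\<dots> = (\<Sum>v\<in>{1..m}. fact (n - 1))"
    using card_permutes_one_value[of "{1..n}" p] p m by (intro sum.cong refl) auto
  finally have "card {\<pi>. \<pi> permutes {1..n} \<and> \<pi> p \<le> m} = m * fact (n - 1)" by simp
  moreover have "fact n = real n * fact (n - 1)" using p by (subst fact_reduce) auto
  ultimately show ?thesis unfolding perm_prob_def by simp
qed

text \<open>The exact value is \<open>m (m - 1) / (n (n - 1))\<close>: small values at different positions are
  negatively correlated.\<close>

lemma perm_prob_both_le:
  assumes p: "p \<in> {1..n}" "p' \<in> {1..n}" "p \<noteq> p'" and m: "m \<le> n"
  shows "perm_prob n (\<lambda>\<pi>. \<pi> p \<le> m \<and> \<pi> p' \<le> m) \<le> (real m / real n)\<^sup>2"
proof -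
  have n2: "n \<ge> 2" using p by auto
  let ?V = "SIGMA v:{1..m}. {1..m} - {v}"
  let ?S = "\<lambda>x. {\<pi>. \<pi> permutes {1..n} \<and> (\<pi> p = fst x \<and> \<pi> p' = snd x)}"
  have "{\<pi>. \<pi> permutes {1..n} \<and> (\<pi> p \<le> m \<and> \<pi> p' \<le> m)} \<subseteq> (\<Union>x\<in>?V. ?S x)"
  proof
    fix \<pi> assume "\<pi> \<in> {\<pi>. \<pi> permutes {1..n} \<and> (\<pi> p \<le> m \<and> \<pi> p' \<le> m)}"
    hence \<pi>: "\<pi> permutes {1..n}" "\<pi> p \<le> m" "\<pi> p' \<le> m" by auto
    have "\<pi> p \<noteq> \<pi> p'" using permutes_inj[OF \<pi>(1)] p(3) by (auto dest: injD)
    moreover have "\<pi> p \<in> {1..n}" "\<pi> p' \<in> {1..n}"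
      using permutes_in_image[OF \<pi>(1), of p] permutes_in_image[OF \<pi>(1), of p'] p by simp_all
    ultimately have V: "(\<pi> p, \<pi> p') \<in> ?V" using \<pi> by simp
    have "\<pi> \<in> ?S (\<pi> p, \<pi> p')" using \<pi>(1) by simp
    with V show "\<pi> \<in> (\<Union>x\<in>?V. ?S x)" by (rule UN_I)
  qed
  hence "card {\<pi>. \<pi> permutes {1..n} \<and> (\<pi> p \<le> m \<and> \<pi> p' \<le> m)} \<le> card (\<Union>x\<in>?V. ?S x)"
    by (intro card_mono finite_UN_I finite_SigmaI finite_perm_set) auto
  also have "\<dots> \<le> (\<Sum>x\<in>?V. card (?S x))" by (rule card_UN_le) auto
  also have "\<dots> = (\<Sum>x\<in>?V. fact (n - 2))"
    using p m by (intro sum.cong refl, subst card_permutes_two_values) auto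
  also have "\<dots> = m * (m - 1) * fact (n - 2)" by (simp add: card_SigmaI)
  finally have le: "card {\<pi>. \<pi> permutes {1..n} \<and> (\<pi> p \<le> m \<and> \<pi> p' \<le> m)} \<le> m * (m - 1) * fact (n - 2)" .
  have f: "fact n = real n * (real n - 1) * fact (n - 2)"
  proof -
    have "fact n = real n * fact (n - 1)" using n2 by (subst fact_reduce) auto
    also have "fact (n - 1) = (real n - 1) * fact (n - 2)" using n2
      by (subst fact_reduce) (auto simp: of_nat_diff numeral_2_eq_2)
    finally show ?thesis by simp
  qed
  have "perm_prob n (\<lambda>\<pi>. \<pi> p \<le> m \<and> \<pi> p' \<le> m) \<le> real (m * (m - 1) * fact (n - 2)) / fact n"
    unfolding perm_prob_def by (intro divide_right_mono of_nat_mono le) simp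
  also have "\<dots> = (real m * real (m - 1)) / (real n * (real n - 1))" unfolding f by simp
  also have "\<dots> \<le> (real m / real n)\<^sup>2"
  proof (cases "m = 0")
    case False
    have "real (m - 1) * real n \<le> real m * (real n - 1)" using False m by (simp add: of_nat_diff algebra_simps)
    hence "real (m - 1) / (real n - 1) \<le> real m / real n" using n2 by (simp add: divide_simps mult.commute)
    hence "(real m / real n) * (real (m - 1) / (real n - 1)) \<le> (real m / real n) * (real m / real n)"
      by (rule mult_left_mono) simp
    thus ?thesis by (simp add: power2_eq_square)
  qed simp
  finally show ?thesis .
qed

definition small_values :: "nat \<Rightarrow> (nat \<Rightarrow> nat) \<Rightarrow> real" where
  "small_values m \<pi> = (\<Sum>p\<in>{1..m}. of_bool (\<pi> p \<le> m))"

lemma mean_small_values: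
  assumes "m \<le> n"
  shows "perm_mean n (small_values m) = real m * (real m / real n)"
proof -
  have "perm_mean n (small_values m) = (\<Sum>p\<in>{1..m}. perm_prob n (\<lambda>\<pi>. \<pi> p \<le> m))"
    unfolding small_values_def by (simp only: perm_mean_sum perm_mean_of_bool)
  also have "\<dots> = (\<Sum>p\<in>{1..m}. real m / real n)"
    using assms by (intro sum.cong refl perm_prob_le) auto
  finally show ?thesis by simp
qed

text \<open>By negative correlation only the diagonal terms can contribute positively.\<close>

lemma variance_small_values:
  assumes m: "m \<le> n"
  shows "perm_mean n (\<lambda>\<pi>. (small_values m \<pi> - perm_mean n (small_values m))\<^sup>2) \<le> real m"
proof -
  let ?Y = "small_values m" and ?\<mu> = "real m / real n"
  have YY: "?Y \<pi> * ?Y \<pi> = (\<Sum>p\<in>{1..m}. \<Sum>p'\<in>{1..m}. of_bool (\<pi> p \<le> m \<and> \<pi> p' \<le> m))" for \<pi>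
    unfolding small_values_def sum_product by (simp only: of_bool_conj)
  have \<mu>: "0 \<le> ?\<mu>" "?\<mu> \<le> 1" using m by (auto simp: divide_simps)
  have "perm_mean n (\<lambda>\<pi>. ?Y \<pi> * ?Y \<pi>)
     = (\<Sum>p\<in>{1..m}. \<Sum>p'\<in>{1..m}. perm_prob n (\<lambda>\<pi>. \<pi> p \<le> m \<and> \<pi> p' \<le> m))"
    by (simp only: YY perm_mean_sum perm_mean_of_bool)
  also have "\<dots> \<le> (\<Sum>p\<in>{1..m}. 1 + real m * ?\<mu>\<^sup>2)"
  proof (rule sum_mono)
    fix p assume p: "p \<in> {1..m}"
    have "(\<Sum>p'\<in>{1..m}. perm_prob n (\<lambda>\<pi>. \<pi> p \<le> m \<and> \<pi> p' \<le> m))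
       \<le> (\<Sum>p'\<in>{1..m}. (if p' = p then 1 else 0) + ?\<mu>\<^sup>2)"
    proof (rule sum_mono)
      fix p' assume p': "p' \<in> {1..m}"
      show "perm_prob n (\<lambda>\<pi>. \<pi> p \<le> m \<and> \<pi> p' \<le> m) \<le> (if p' = p then 1 else 0) + ?\<mu>\<^sup>2"
      proof (cases "p' = p")
        case True
        have "perm_prob n (\<lambda>\<pi>. \<pi> p \<le> m \<and> \<pi> p' \<le> m) \<le> perm_prob n (\<lambda>\<pi>. True)"
          by (rule perm_prob_mono) simp
        thus ?thesis using True by (simp add: perm_prob_True add_increasing2)
      next
        case False
        thus ?thesis using perm_prob_both_le[of p n p' m] p p' m by auto
      qed
    qed
    also have "\<dots> = 1 + real m * ?\<mu>\<^sup>2" using p by (simp add: sum.distrib)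
    finally show "(\<Sum>p'\<in>{1..m}. perm_prob n (\<lambda>\<pi>. \<pi> p \<le> m \<and> \<pi> p' \<le> m)) \<le> 1 + real m * ?\<mu>\<^sup>2" .
  qed
  finally have "perm_mean n (\<lambda>\<pi>. ?Y \<pi> * ?Y \<pi>) \<le> real m + (real m * ?\<mu>)\<^sup>2"
    by (simp add: algebra_simps power2_eq_square)
  thus ?thesis using perm_mean_centered[of n ?Y ?Y] mean_small_values[OF m]
    by (simp add: power2_eq_square)
qed

text \<open>A position outside the range of \<open>u\<close> is uncorrelated with the occurrence of \<open>u\<close>.\<close>

lemma prob_small_position_zero_cov:
  assumes P: "is_vincular_pattern P" and u: "u \<in> embeddings P n" and m: "m \<le> n"
    and p: "p \<in> {1..n}" "p \<notin> range_of P u"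
  shows "perm_prob n (\<lambda>\<pi>. \<pi> p \<le> m \<and> occurs_at P u \<pi>) = real m / real n / fact (pat_length P)"
proof -
  have "perm_prob n (\<lambda>\<pi>. \<pi> p \<le> m \<and> occurs_at P u \<pi>)
     = perm_prob n (\<lambda>\<pi>. \<pi> p \<le> m) / fact (pat_length P)"
    by (rule perm_prob_occurs_and[OF P u]) (use p(2) in \<open>simp add: permutes_not_in\<close>)
  thus ?thesis using perm_prob_le[OF p(1) m] by simp
qed

text \<open>If the position of a letter other than the lowest carries a value \<open>\<le> m\<close>, then so does the position
  of the lowest letter, which is a second rare event.\<close>

lemma prob_small_not_lowest:
  assumes P: "is_vincular_pattern P" and u: "u \<in> embeddings P n" and m: "m \<le> n"
    and i: "i \<in> {1..pat_length P}" "pat_perm P i \<noteq> 1"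
  shows "perm_prob n (\<lambda>\<pi>. \<pi> (u i) \<le> m \<and> occurs_at P u \<pi>) \<le> (real m / real n)\<^sup>2"
proof -
  let ?s = "pat_perm P" and ?k = "pat_length P"
  have s: "?s permutes {1..?k}" by (rule pattern_perm[OF P])
  define i1 where "i1 = inv ?s 1"
  have k1: "1 \<in> {1..?k}" using i(1) by simp
  have i1: "i1 \<in> {1..?k}" unfolding i1_def using permutes_in_image[OF permutes_inv[OF s]] k1 by blast
  have "?s i1 = 1" unfolding i1_def using permutes_inverses(1)[OF s] .
  hence ne: "i1 \<noteq> i" using i(2) by auto
  have si: "?s i \<in> {1..?k}" using permutes_in_image[OF s] i(1) by blast
  have "perm_prob n (\<lambda>\<pi>. \<pi> (u i) \<le> m \<and> occurs_at P u \<pi>)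
     \<le> perm_prob n (\<lambda>\<pi>. \<pi> (u i) \<le> m \<and> \<pi> (u i1) \<le> m)"
  proof (rule perm_prob_mono)
    fix \<pi> assume \<pi>: "\<pi> (u i) \<le> m \<and> occurs_at P u \<pi>"
    have "1 < ?s i" using si i(2) by auto
    hence "\<pi> (u (inv ?s 1)) < \<pi> (u (inv ?s (?s i)))"
      using \<pi> k1 si unfolding occurs_at_def strict_mono_on_def by blast
    hence "\<pi> (u i1) < \<pi> (u i)" unfolding i1_def permutes_inverses(2)[OF s] .
    thus "\<pi> (u i) \<le> m \<and> \<pi> (u i1) \<le> m" using \<pi> by simp
  qed
  also have "\<dots> \<le> (real m / real n)\<^sup>2"
  proof (rule perm_prob_both_le[OF _ _ _ m])
    show "u i \<in> {1..n}" "u i1 \<in> {1..n}" using embedding_in[OF u] i(1) i1 by blast+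
    show "u i \<noteq> u i1" using inj_onD[OF embedding_inj[OF u] _ i(1) i1] ne by blast
  qed
  finally show ?thesis .
qed

text \<open>If a value \<open>\<le> m\<close> stands at the position of the lowest letter and the other letters are in the right
  order, then the pattern occurs unless the second lowest letter falls below the lowest one, and in
  that case its value is also \<open>\<le> m\<close>.\<close>

lemma prob_small_lowest:
  assumes P: "is_vincular_pattern P" and u: "u \<in> embeddings P n" and m: "m \<le> n"
    and k2: "pat_length P \<ge> 2" and i: "i \<in> {1..pat_length P}" "pat_perm P i = 1"
  shows "real m / real n / fact (pat_length P - 1) - (real m / real n)\<^sup>2
    \<le> perm_prob n (\<lambda>\<pi>. \<pi> (u i) \<le> m \<and> occurs_at P u \<pi>)"
proof -
  let ?s = "pat_perm P" and ?k = "pat_length P"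
  define w where "w = (\<lambda>a. u (inv ?s a))"
  have s: "?s permutes {1..?k}" by (rule pattern_perm[OF P])
  have w1: "w 1 = u i" unfolding w_def using permutes_inverses(2)[OF s, of i] i(2) by simp
  have winj: "inj_on w {1..?k}" and wim: "w ` {1..?k} = range_of P u"
    using embedding_values_inj[OF P u] unfolding w_def by auto
  have win: "w a \<in> {1..n}" if "a \<in> {1..?k}" for a
  proof -
    have "w a \<in> range_of P u" using that wim by blast
    moreover have "range_of P u \<subseteq> {1..n}" by (rule image_subsetI) (rule embedding_in[OF u])
    ultimately show ?thesis by (rule subsetD[rotated])
  qed
  have ne: "w (b + 1) \<noteq> u i" if "b \<in> {1..?k - 1}" for b
  proof
    assume "w (b + 1) = u i"
    hence "w (b + 1) = w 1" using w1 by simp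
    moreover have "b + 1 \<in> {1..?k}" "1 \<in> {1..?k}" using that by auto
    ultimately have "b + 1 = 1" by (rule inj_onD[OF winj])
    thus False using that by simp
  qed
  have "perm_prob n (\<lambda>\<pi>. \<pi> (u i) \<le> m \<and> strict_mono_on {1..?k - 1} (\<lambda>b. \<pi> (w (b + 1))))
     = perm_prob n (\<lambda>\<pi>. \<pi> (u i) \<le> m) / fact (?k - 1)"
  proof (rule perm_prob_increasing_along)
    show "inj_on (\<lambda>b. w (b + 1)) {1..?k - 1}"
    proof (rule inj_onI)
      fix b b' assume b: "b \<in> {1..?k - 1}" "b' \<in> {1..?k - 1}" "w (b + 1) = w (b' + 1)"
      have r: "b + 1 \<in> {1..?k}" "b' + 1 \<in> {1..?k}" using b by auto
      from inj_onD[OF winj b(3) r] show "b = b'" by simp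
    qed
    show "(\<lambda>b. w (b + 1)) ` {1..?k - 1} \<subseteq> {1..n}"
    proof (rule image_subsetI)
      fix b assume "b \<in> {1..?k - 1}" thus "w (b + 1) \<in> {1..n}" by (intro win) auto
    qed
    fix \<pi> \<rho> assume *: "\<pi> (u i) \<le> m" "\<rho> permutes (\<lambda>b. w (b + 1)) ` {1..?k - 1}"
    have "u i \<notin> (\<lambda>b. w (b + 1)) ` {1..?k - 1}" using ne by fastforce
    hence "\<rho> (u i) = u i" by (rule permutes_not_in[OF *(2)])
    thus "(\<pi> \<circ> \<rho>) (u i) \<le> m" using *(1) by simp
  qed
  also have "perm_prob n (\<lambda>\<pi>. \<pi> (u i) \<le> m) = real m / real n"
    by (rule perm_prob_le[OF embedding_in[OF u i(1)] m])
  finally have eq: "perm_prob n (\<lambda>\<pi>. \<pi> (u i) \<le> m \<and> strict_mono_on {1..?k - 1} (\<lambda>b. \<pi> (w (b + 1))))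
     = real m / real n / fact (?k - 1)" .
  have "perm_prob n (\<lambda>\<pi>. \<pi> (u i) \<le> m \<and> strict_mono_on {1..?k - 1} (\<lambda>b. \<pi> (w (b + 1))))
     \<le> perm_prob n (\<lambda>\<pi>. (\<pi> (u i) \<le> m \<and> occurs_at P u \<pi>) \<or> (\<pi> (u i) \<le> m \<and> \<pi> (w 2) \<le> m))"
  proof (rule perm_prob_mono)
    fix \<pi> assume \<pi>: "\<pi> permutes {1..n}" "\<pi> (u i) \<le> m \<and> strict_mono_on {1..?k - 1} (\<lambda>b. \<pi> (w (b + 1)))"
    show "(\<pi> (u i) \<le> m \<and> occurs_at P u \<pi>) \<or> (\<pi> (u i) \<le> m \<and> \<pi> (w 2) \<le> m)"
    proof (cases "\<pi> (w 1) < \<pi> (w 2)")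
      case True
      have mono: "\<pi> (w (b + 1)) < \<pi> (w (b' + 1))" if "b \<in> {1..?k - 1}" "b' \<in> {1..?k - 1}" "b < b'" for b b'
        using \<pi>(2) that unfolding strict_mono_on_def by blast
      have "strict_mono_on {1..?k} (\<lambda>a. \<pi> (w a))"
      proof (rule strict_mono_onI)
        fix a a' assume a: "a \<in> {1..?k}" "a' \<in> {1..?k}" "a < a'"
        have ge2: "\<pi> (w b) < \<pi> (w b')" if "2 \<le> b" "b < b'" "b' \<le> ?k" for b b'
          using mono[of "b - 1" "b' - 1"] that by simp
        show "\<pi> (w a) < \<pi> (w a')"
        proof (cases "a = 1")
          case one: True
          show ?thesis
          proof (cases "a' = 2")
            case False
            hence "\<pi> (w 2) < \<pi> (w a')" using a one by (intro ge2) auto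
            thus ?thesis using True one by simp
          qed (use True one in simp)
        next
          case False thus ?thesis using a by (intro ge2) auto
        qed
      qed
      thus ?thesis using \<pi>(2) unfolding occurs_at_def w_def by blast
    next
      case False
      thus ?thesis using \<pi>(2) w1 by simp
    qed
  qed
  also have "\<dots> \<le> perm_prob n (\<lambda>\<pi>. \<pi> (u i) \<le> m \<and> occurs_at P u \<pi>)
      + perm_prob n (\<lambda>\<pi>. \<pi> (u i) \<le> m \<and> \<pi> (w 2) \<le> m)"
    by (rule perm_prob_disj)
  also have "perm_prob n (\<lambda>\<pi>. \<pi> (u i) \<le> m \<and> \<pi> (w 2) \<le> m) \<le> (real m / real n)\<^sup>2"
  proof (rule perm_prob_both_le[OF _ _ _ m])
    show "u i \<in> {1..n}" by (rule embedding_in[OF u i(1)])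
    show "w 2 \<in> {1..n}" using k2 by (intro win) auto
    have "1 \<in> {1..?k - 1}" using k2 by auto
    from ne[OF this] show "u i \<noteq> w 2" by (metis one_add_one)
  qed
  finally show ?thesis using eq by simp
qed

section \<open>Covariance with the number of small values in early positions\<close>

definition second_start :: "vincular_pattern \<Rightarrow> nat" where
  "second_start P = Min (block_starts P - {1})"

lemma second_start_props:
  assumes P: "is_vincular_pattern P" and j: "num_blocks P \<ge> 2"
  shows "second_start P \<in> block_starts P" "1 < second_start P" "second_start P \<le> pat_length P"
    "start_of P (second_start P - 1) = 1"
proof -
  let ?B = "block_starts P" and ?f = "second_start P"
  have "card (?B - {1}) = num_blocks P - 1"
    using num_blocks_eq[OF P] one_block_start[OF P] by simp
  hence "?B - {1} \<noteq> {}" using j by (metis One_nat_def Suc_1 Suc_diff_le card.empty diff_is_0_eq not_less_eq_eq diff_Suc_1 Suc_leD le_zero_eq nat.distinct(1))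
  hence f: "?f \<in> ?B - {1}" unfolding second_start_def using finite_block_starts[of P] by (intro Min_in) auto
  thus 1: "?f \<in> ?B" by blast
  have r: "?f \<in> {1..pat_length P}" using block_starts_range[OF 1] .
  thus "1 < ?f" "?f \<le> pat_length P" using f by auto
  have r': "?f - 1 \<in> {1..pat_length P}" using r f by auto
  note s = start_of_props[OF P r']
  show "start_of P (?f - 1) = 1"
  proof (rule ccontr)
    assume "start_of P (?f - 1) \<noteq> 1"
    hence "start_of P (?f - 1) \<in> ?B - {1}" using s(1) by blast
    hence "?f \<le> start_of P (?f - 1)" unfolding second_start_def using finite_block_starts[of P] by (intro Min_le) auto
    thus False using s(2) \<open>1 < ?f\<close> by linarith
  qed
qed

text \<open>The embeddings that place exactly their first block in \<open>{1..m}\<close>; since \<open>second_start P - 1\<close> is the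
  last position of the first block, two comparisons suffice.\<close>

definition first_block_low :: "vincular_pattern \<Rightarrow> nat \<Rightarrow> nat \<Rightarrow> (nat \<Rightarrow> nat) set" where
  "first_block_low P n m = {u \<in> embeddings P n. u (second_start P - 1) \<le> m \<and> m < u (second_start P)}"

definition other_low :: "vincular_pattern \<Rightarrow> nat \<Rightarrow> nat \<Rightarrow> (nat \<Rightarrow> nat) set" where
  "other_low P n m = {u \<in> embeddings P n. u 1 \<le> m} - first_block_low P n m"

lemma covariance_sum:
  assumes P: "is_vincular_pattern P" and m: "m \<le> n"
  shows "perm_mean n (\<lambda>\<pi>. num_occurring P n \<pi> * small_values m \<pi>)
      - perm_mean n (num_occurring P n) * perm_mean n (small_values m)
    = (\<Sum>u\<in>embeddings P n. \<Sum>i | i \<in> {1..pat_length P} \<and> u i \<le> m.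
        perm_prob n (\<lambda>\<pi>. \<pi> (u i) \<le> m \<and> occurs_at P u \<pi>) - real m / real n / fact (pat_length P))"
proof -
  let ?k = "pat_length P" and ?U = "embeddings P n"
  let ?p = "\<lambda>u p. perm_prob n (\<lambda>\<pi>. \<pi> p \<le> m \<and> occurs_at P u \<pi>)"
  let ?c = "real m / real n / fact ?k"
  have XY: "num_occurring P n \<pi> * small_values m \<pi>
      = (\<Sum>u\<in>?U. \<Sum>p\<in>{1..m}. of_bool (\<pi> p \<le> m \<and> occurs_at P u \<pi>))" for \<pi>
    unfolding num_occurring_def small_values_def sum_product
    by (simp only: of_bool_conj mult.commute)
  have "perm_mean n (\<lambda>\<pi>. num_occurring P n \<pi> * small_values m \<pi>) = (\<Sum>u\<in>?U. \<Sum>p\<in>{1..m}. ?p u p)"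
    by (simp only: XY perm_mean_sum perm_mean_of_bool)
  moreover have "perm_mean n (num_occurring P n) * perm_mean n (small_values m) = (\<Sum>u\<in>?U. \<Sum>p\<in>{1..m}. ?c)"
    by (simp add: mean_num_occurring[OF P] mean_small_values[OF m])
  ultimately have "perm_mean n (\<lambda>\<pi>. num_occurring P n \<pi> * small_values m \<pi>)
      - perm_mean n (num_occurring P n) * perm_mean n (small_values m)
    = (\<Sum>u\<in>?U. \<Sum>p\<in>{1..m}. ?p u p - ?c)" by (simp only: sum_subtractf)
  also have "\<dots> = (\<Sum>u\<in>?U. \<Sum>i | i \<in> {1..?k} \<and> u i \<le> m. ?p u (u i) - ?c)"
  proof (rule sum.cong[OF refl])
    fix u assume u: "u \<in> ?U"
    let ?S = "{i. i \<in> {1..?k} \<and> u i \<le> m}"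
    have inj: "inj_on u ?S" by (rule inj_on_subset[OF embedding_inj[OF u]]) auto
    have "(\<Sum>p\<in>{1..m}. ?p u p - ?c) = (\<Sum>p\<in>u ` ?S. ?p u p - ?c)"
    proof (rule sum.mono_neutral_right)
      have "u i \<in> {1..m}" if "i \<in> ?S" for i using embedding_in[OF u, of i] that by simp
      thus "u ` ?S \<subseteq> {1..m}" by blast
      show "\<forall>p\<in>{1..m} - u ` ?S. ?p u p - ?c = 0"
      proof
        fix p assume p: "p \<in> {1..m} - u ` ?S"
        have "p \<notin> range_of P u" using p by fastforce
        moreover have "p \<in> {1..n}" using p m by auto
        ultimately show "?p u p - ?c = 0" using prob_small_position_zero_cov[OF P u m] by simp
      qed
    qed simp
    also have "\<dots> = (\<Sum>i\<in>?S. ?p u (u i) - ?c)" using sum.reindex[OF inj] by simp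
    finally show "(\<Sum>p\<in>{1..m}. ?p u p - ?c) = (\<Sum>i\<in>?S. ?p u (u i) - ?c)" .
  qed
  finally show ?thesis .
qed

text \<open>Write \<open>T u\<close> for the contribution of \<open>u\<close> to the covariance. There is a sign \<open>e\<close>, determined by
  whether the lowest letter belongs to the first block, such that \<open>e * T u\<close> is at least
  \<open>\<mu> / k! - k \<mu>\<^sup>2\<close> for all \<open>u\<close> in \<open>first_block_low\<close>. On \<open>other_low\<close> only the crude bound \<open>k \<mu>\<close> is used, and elsewhere
  \<open>T u\<close> vanishes.\<close>

lemma covariance_bound:
  assumes P: "is_vincular_pattern P" and j: "num_blocks P \<ge> 2" and m: "m \<le> n"
  defines "\<mu> \<equiv> real m / real n" and "k \<equiv> pat_length P"
  shows "real (card (first_block_low P n m)) * (\<mu> / fact k - real k * \<mu>\<^sup>2) - real (card (other_low P n m)) * (real k * \<mu>)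
    \<le> \<bar>perm_mean n (\<lambda>\<pi>. num_occurring P n \<pi> * small_values m \<pi>)
      - perm_mean n (num_occurring P n) * perm_mean n (small_values m)\<bar>"
proof -
  let ?U = "embeddings P n" and ?A = "first_block_low P n m" and ?B = "other_low P n m"
  let ?f = "second_start P" and ?s = "pat_perm P"
  define c where "c = (\<lambda>u i. perm_prob n (\<lambda>\<pi>. \<pi> (u i) \<le> m \<and> occurs_at P u \<pi>) - \<mu> / fact k)"
  define S where "S = (\<lambda>u :: nat \<Rightarrow> nat. {i. i \<in> {1..k} \<and> u i \<le> m})"
  define T where "T = (\<lambda>u. \<Sum>i\<in>S u. c u i)"
  define \<alpha> where "\<alpha> = \<mu> / fact k - real k * \<mu>\<^sup>2"
  have cov: "perm_mean n (\<lambda>\<pi>. num_occurring P n \<pi> * small_values m \<pi>)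
      - perm_mean n (num_occurring P n) * perm_mean n (small_values m) = sum T ?U"
    unfolding covariance_sum[OF P m] T_def c_def S_def k_def \<mu>_def ..
  note f = second_start_props[OF P j]
  have k2: "2 \<le> k" using f unfolding k_def by linarith
  have fk: "?f \<le> k" "1 < ?f" using f unfolding k_def by auto
  have \<mu>: "0 \<le> \<mu>" "\<mu> \<le> 1" using m unfolding \<mu>_def by (auto simp: divide_simps)
  have \<mu>k: "\<mu> / fact k \<le> \<mu>" using \<mu> by (simp add: divide_le_eq mult_le_cancel_left1)
  have \<mu>0: "0 \<le> \<mu> / fact k" using \<mu> by simp
  have fact_k: "fact k = real k * fact (k - 1)" using k2 by (subst fact_reduce) auto
  have \<mu>1: "\<mu> / fact (k - 1) = real k * (\<mu> / fact k)" unfolding fact_k using k2 by simp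
  have \<mu>2: "\<mu>\<^sup>2 \<le> real k * \<mu>\<^sup>2" using k2 by (simp add: mult_le_cancel_right1)
  have finS: "finite (S u)" and cardS: "card (S u) \<le> k" for u
  proof -
    show "finite (S u)" unfolding S_def by simp
    have "S u \<subseteq> {1..k}" unfolding S_def by blast
    thus "card (S u) \<le> k" using card_mono[of "{1..k}" "S u"] by simp
  qed
  have c_lower: "- (\<mu> / fact k) \<le> c u i" for u i unfolding c_def using perm_prob_nonneg by simp
  have c_upper: "c u i \<le> \<mu>" if u: "u \<in> ?U" and i: "i \<in> {1..k}" for u i
  proof -
    have "perm_prob n (\<lambda>\<pi>. \<pi> (u i) \<le> m \<and> occurs_at P u \<pi>) \<le> perm_prob n (\<lambda>\<pi>. \<pi> (u i) \<le> m)"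
      by (rule perm_prob_mono) blast
    also have "\<dots> = \<mu>" unfolding \<mu>_def using perm_prob_le[OF embedding_in[OF u] m] i unfolding k_def by blast
    finally show ?thesis unfolding c_def using \<mu>0 by linarith
  qed
  have T_abs: "\<bar>T u\<bar> \<le> real k * \<mu>" if u: "u \<in> ?U" for u
  proof -
    have "\<bar>T u\<bar> \<le> (\<Sum>i\<in>S u. \<bar>c u i\<bar>)" unfolding T_def by (rule sum_abs)
    also have "\<dots> \<le> (\<Sum>i\<in>S u. \<mu>)"
    proof (rule sum_mono)
      fix i assume "i \<in> S u"
      hence "i \<in> {1..k}" unfolding S_def by blast
      thus "\<bar>c u i\<bar> \<le> \<mu>" using c_lower[of u i] c_upper[OF u, of i] \<mu>k by linarith
    qed
    also have "\<dots> = real (card (S u)) * \<mu>" by simp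
    also have "\<dots> \<le> real k * \<mu>" using cardS[of u] \<mu> by (intro mult_right_mono) auto
    finally show ?thesis .
  qed
  have T_zero: "T u = 0" if u: "u \<in> ?U" and "u \<notin> ?A" "u \<notin> ?B" for u
  proof -
    have "\<not> u 1 \<le> m" using that unfolding other_low_def by blast
    moreover have "u 1 \<le> u i" if "i \<in> {1..k}" for i
    proof (cases "i = 1")
      case False
      hence "u 1 < u i" using embedding_less_iff[OF u, of 1 i] that unfolding k_def by simp
      thus ?thesis by simp
    qed simp
    ultimately have "S u = {}" unfolding S_def by fastforce
    thus ?thesis unfolding T_def by simp
  qed
  have SA: "S u = {1..?f - 1}" if uA: "u \<in> ?A" for u
  proof -
    have u: "u \<in> ?U" and le: "u (?f - 1) \<le> m" and gt: "m < u ?f" using uA unfolding first_block_low_def by auto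
    have mono: "u i \<le> u i'" if "1 \<le> i" "i \<le> i'" "i' \<le> k" for i i'
    proof (cases "i = i'")
      case False
      hence "u i < u i'" using embedding_less_iff[OF u, of i i'] that unfolding k_def by simp
      thus ?thesis by simp
    qed simp
    show ?thesis
    proof (intro equalityI subsetI)
      fix i assume "i \<in> S u"
      hence i: "1 \<le> i" "i \<le> k" "u i \<le> m" unfolding S_def by auto
      have "\<not> ?f \<le> i" using mono[of ?f i] i gt fk by fastforce
      thus "i \<in> {1..?f - 1}" using i by auto
    next
      fix i assume i: "i \<in> {1..?f - 1}"
      have "u i \<le> u (?f - 1)" using i fk by (intro mono) auto
      thus "i \<in> S u" unfolding S_def using i le fk by auto
    qed
  qed
  have lower: "of_bool (u \<in> ?A) * \<alpha> + of_bool (u \<in> ?B) * (- (real k * \<mu>)) \<le> e * T u"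
    if e: "e = 1 \<or> e = -1" and u: "u \<in> ?U" and A: "\<And>u. u \<in> ?A \<Longrightarrow> \<alpha> \<le> e * T u" for e u
  proof (cases "u \<in> ?A")
    case True
    hence "u \<notin> ?B" unfolding other_low_def by blast
    thus ?thesis using A[OF True] True by simp
  next
    case False
    have "- (real k * \<mu>) \<le> e * T u" using T_abs[OF u] e by auto
    thus ?thesis using False T_zero[OF u False] by (cases "u \<in> ?B") auto
  qed
  \<comment> \<open>The sign \<open>e\<close> treats the two positions of the lowest letter at once.\<close>
  have total: "real (card ?A) * \<alpha> - real (card ?B) * (real k * \<mu>) \<le> e * sum T ?U"
    if e: "e = 1 \<or> e = -1" and A: "\<And>u. u \<in> ?A \<Longrightarrow> \<alpha> \<le> e * T u" for e
  proof -
    have sub: "?A \<subseteq> ?U" "?B \<subseteq> ?U" unfolding other_low_def first_block_low_def by auto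
    have cnt: "(\<Sum>u\<in>?U. of_bool (u \<in> C)) = real (card C)" if "C \<subseteq> ?U" for C
      using that finite_embeddings[of P n] by (simp add: Int_absorb1)
    have "real (card ?A) * \<alpha> - real (card ?B) * (real k * \<mu>)
       = (\<Sum>u\<in>?U. of_bool (u \<in> ?A) * \<alpha> + of_bool (u \<in> ?B) * (- (real k * \<mu>)))"
      unfolding sum.distrib sum_distrib_right[symmetric] cnt[OF sub(1)] cnt[OF sub(2)] by simp
    also have "\<dots> \<le> (\<Sum>u\<in>?U. e * T u)" by (intro sum_mono lower[OF e _ A])
    finally show ?thesis by (simp add: sum_distrib_left)
  qed
  have s: "?s permutes {1..k}" unfolding k_def by (rule pattern_perm[OF P])
  define i1 where "i1 = inv ?s 1"
  have si1: "?s i1 = 1" unfolding i1_def using permutes_inverses(1)[OF s] .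
  have i1: "i1 \<in> {1..k}" unfolding i1_def using permutes_in_image[OF permutes_inv[OF s], of 1] k2 by simp
  have "real (card ?A) * \<alpha> - real (card ?B) * (real k * \<mu>) \<le> \<bar>sum T ?U\<bar>"
  proof (cases "i1 < ?f")
    case True
    have "\<alpha> \<le> 1 * T u" if uA: "u \<in> ?A" for u
    proof -
      have u: "u \<in> ?U" using uA unfolding first_block_low_def by blast
      have mem: "i1 \<in> S u" using SA[OF uA] True i1 by auto
      have c1: "\<mu> / fact (k - 1) - \<mu>\<^sup>2 - \<mu> / fact k \<le> c u i1"
        unfolding c_def using prob_small_lowest[OF P u m, of i1] k2 i1 si1 unfolding k_def \<mu>_def by simp
      have "(\<Sum>i\<in>S u - {i1}. - (\<mu> / fact k)) \<le> (\<Sum>i\<in>S u - {i1}. c u i)" by (intro sum_mono c_lower)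
      hence "- (real (card (S u - {i1})) * (\<mu> / fact k)) \<le> (\<Sum>i\<in>S u - {i1}. c u i)" by simp
      moreover have "card (S u - {i1}) \<le> k - 2" using mem SA[OF uA] fk by simp
      hence "real (card (S u - {i1})) \<le> real k - 2" using k2 by (simp add: of_nat_diff le_diff_conv2)
      hence "real (card (S u - {i1})) * (\<mu> / fact k) \<le> (real k - 2) * (\<mu> / fact k)" using \<mu>0 by (rule mult_right_mono)
      moreover have "T u = c u i1 + (\<Sum>i\<in>S u - {i1}. c u i)" unfolding T_def using sum.remove[OF finS mem] .
      ultimately have "T u \<ge> real k * (\<mu> / fact k) - \<mu>\<^sup>2 - \<mu> / fact k - (real k - 2) * (\<mu> / fact k)"
        using c1 unfolding \<mu>1 by linarith
      hence "T u \<ge> \<mu> / fact k - \<mu>\<^sup>2" unfolding left_diff_distrib by linarith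
      thus ?thesis unfolding \<alpha>_def using \<mu>2 by linarith
    qed
    from total[of 1, OF _ this] show ?thesis by simp
  next
    case False
    have "\<alpha> \<le> (-1) * T u" if uA: "u \<in> ?A" for u
    proof -
      have u: "u \<in> ?U" using uA unfolding first_block_low_def by blast
      have "T u \<le> (\<Sum>i\<in>S u. \<mu>\<^sup>2 - \<mu> / fact k)" unfolding T_def
      proof (rule sum_mono)
        fix i assume "i \<in> S u"
        hence i: "i \<in> {1..k}" "i < ?f" using SA[OF uA] fk by auto
        have "?s i \<noteq> 1" using False i(2) permutes_inverses(2)[OF s, of i] unfolding i1_def by auto
        thus "c u i \<le> \<mu>\<^sup>2 - \<mu> / fact k"
          unfolding c_def using prob_small_not_lowest[OF P u m, of i] i unfolding k_def \<mu>_def by simp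
      qed
      also have "\<dots> = real (card (S u)) * \<mu>\<^sup>2 - real (card (S u)) * (\<mu> / fact k)" by (simp add: right_diff_distrib)
      finally have "T u \<le> real (card (S u)) * \<mu>\<^sup>2 - real (card (S u)) * (\<mu> / fact k)" .
      moreover have "real (card (S u)) * \<mu>\<^sup>2 \<le> real k * \<mu>\<^sup>2" using cardS[of u] by (intro mult_right_mono) auto
      moreover have "1 \<le> real (card (S u))" using SA[OF uA] fk by simp
      hence "1 * (\<mu> / fact k) \<le> real (card (S u)) * (\<mu> / fact k)" using \<mu>0 by (rule mult_right_mono)
      ultimately show ?thesis unfolding \<alpha>_def by linarith
    qed
    from total[of "-1", OF _ this] show ?thesis by simp
  qed
  thus ?thesis unfolding cov \<alpha>_def .
qed

section \<open>Growth of the variance for several blocks\<close>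

text \<open>Such an embedding either starts its second block in \<open>{1..m}\<close> as well, or has its first block
  straddling \<open>m\<close>; in the latter case there are at most \<open>k\<close> choices for the first start.\<close>

lemma card_other_low_le:
  assumes P: "is_vincular_pattern P" and j: "num_blocks P = j" "j \<ge> 2"
  shows "card (other_low P n m) \<le> m ^ 2 * n ^ (j - 2) + pat_length P * n ^ (j - 1)"
proof -
  let ?U = "embeddings P n" and ?B = "block_starts P" and ?f = "second_start P" and ?k = "pat_length P"
  have f: "?f \<in> ?B" "1 < ?f" "?f \<le> ?k" "start_of P (?f - 1) = 1"
    using second_start_props[OF P] j by auto
  have one: "1 \<in> ?B" by (rule one_block_start[OF P])
  have fB: "finite ?B" by (rule finite_block_starts)
  have cB: "card ?B = j" using num_blocks_eq[OF P] j by simp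
  \<comment> \<open>\<open>?F\<close>: the second block also starts low; \<open>?G\<close>: the first block straddles \<open>m\<close>.\<close>
  let ?F = "\<lambda>b::nat. if b \<in> {1, ?f} then {1..m} else {1..n}"
  let ?G = "\<lambda>b::nat. if b = 1 then {m - ?k<..m} else {1..n}"
  let ?UF = "{u \<in> ?U. \<forall>b\<in>?B. u b \<in> ?F b}" and ?UG = "{u \<in> ?U. \<forall>b\<in>?B. u b \<in> ?G b}"
  have uB: "u b \<in> {1..n}" if "u \<in> ?U" "b \<in> ?B" for u b
    by (rule embedding_in[OF that(1) block_starts_range[OF that(2)]])
  have "other_low P n m \<subseteq> ?UF \<union> ?UG"
  proof
    fix u assume u': "u \<in> other_low P n m"
    hence u: "u \<in> ?U" "u 1 \<le> m" and not: "\<not> (u (?f - 1) \<le> m \<and> m < u ?f)"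
      unfolding other_low_def first_block_low_def by auto
    show "u \<in> ?UF \<union> ?UG"
    proof (cases "u ?f \<le> m")
      case True
      hence "u b \<in> ?F b" if "b \<in> ?B" for b using uB[OF u(1) that] u(2) by auto
      thus ?thesis using u(1) by blast
    next
      case False
      have "?f - 1 \<in> {1..?k}" using f by auto
      from embedding_start_of[OF P u(1) this] have "u (?f - 1) = u 1 + (?f - 1 - 1)" unfolding f(4) .
      moreover have "m < u (?f - 1)" using not False by simp
      ultimately have "u 1 \<in> {m - ?k<..m}" using u(2) f uB[OF u(1) one] by auto
      hence "u b \<in> ?G b" if "b \<in> ?B" for b using uB[OF u(1) that] by auto
      thus ?thesis using u(1) by blast
    qed
  qed
  hence "card (other_low P n m) \<le> card (?UF \<union> ?UG)" using finite_embeddings[of P n] by (intro card_mono) auto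
  also have "\<dots> \<le> card ?UF + card ?UG" by (rule card_Un_le)
  also have "card ?UF \<le> (\<Prod>b\<in>?B. card (?F b))" by (rule card_embeddings_le_prod[OF P]) auto
  also have "(\<Prod>b\<in>?B. card (?F b)) = (\<Prod>b\<in>?B. if b \<in> {1, ?f} then m else n)" by (intro prod.cong) auto
  also have "\<dots> = m ^ card (?B \<inter> {1, ?f}) * n ^ card (?B \<inter> - {1, ?f})"
    by (simp only: prod.If_cases[OF fB] Collect_mem_eq prod_constant)
  also have "?B \<inter> {1, ?f} = {1, ?f}" using one f(1) by auto
  also have "card {1, ?f} = 2" using f(2) by simp
  also have "card (?B \<inter> - {1, ?f}) = j - 2"
  proof -
    have "?B \<inter> - {1, ?f} = ?B - {1, ?f}" by blast
    thus ?thesis using one f(1,2) cB fB by (simp add: card_Diff_subset)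
  qed
  also have "card ?UG \<le> (\<Prod>b\<in>?B. card (?G b))" by (rule card_embeddings_le_prod[OF P]) auto
  also have "(\<Prod>b\<in>?B. card (?G b)) = card (?G 1) * (\<Prod>b\<in>?B - {1}. card (?G b))" by (rule prod.remove[OF fB one])
  also have "(\<Prod>b\<in>?B - {1}. card (?G b)) = n ^ (j - 1)" using one cB fB by (simp add: card_Diff_singleton)
  also have "card (?G 1) * n ^ (j - 1) \<le> ?k * n ^ (j - 1)" by (intro mult_le_mono1) simp
  finally show ?thesis by simp
qed

text \<open>The first block is put into \<open>{1..m}\<close>, and the \<open>r\<close>-th of the other blocks into the \<open>r\<close>-th further
  window of length \<open>n div j\<close>. Keeping \<open>k\<close> positions free at the end of each window keeps the blocks
  apart.\<close>

lemma card_first_block_low_ge: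
  assumes P: "is_vincular_pattern P" and j: "num_blocks P = j" "j \<ge> 2" and m: "m \<le> n div j"
  shows "(m - pat_length P) * (n div j - pat_length P) ^ (j - 1) \<le> card (first_block_low P n m)"
proof -
  let ?U = "embeddings P n" and ?B = "block_starts P" and ?f = "second_start P" and ?k = "pat_length P"
  define D where "D = n div j"
  have f: "?f \<in> ?B" "1 < ?f" "?f \<le> ?k" "start_of P (?f - 1) = 1"
    using second_start_props[OF P] j by auto
  have one: "1 \<in> ?B" by (rule one_block_start[OF P])
  have fB: "finite ?B" by (rule finite_block_starts)
  have cB: "card ?B = j" using num_blocks_eq[OF P] j by simp
  define r where "r = (\<lambda>b. card {b' \<in> ?B. b' < b})"
  have r_less: "r b + 1 \<le> r b'" if "b \<in> ?B" "b' \<in> ?B" "b < b'" for b b'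
  proof -
    have "insert b {x \<in> ?B. x < b} \<subseteq> {x \<in> ?B. x < b'}" using that by auto
    hence "card (insert b {x \<in> ?B. x < b}) \<le> r b'" unfolding r_def using fB by (intro card_mono) auto
    thus ?thesis unfolding r_def using fB by simp
  qed
  have r_le: "r b + 1 \<le> j" if "b \<in> ?B" for b
  proof -
    have "insert b {x \<in> ?B. x < b} \<subseteq> ?B" using that by auto
    hence "card (insert b {x \<in> ?B. x < b}) \<le> card ?B" using fB by (intro card_mono) auto
    thus ?thesis unfolding r_def using fB cB by simp
  qed
  have Dj: "D * j \<le> n" unfolding D_def by simp
  have rD: "r b * D + D \<le> n" if "b \<in> ?B" for b
  proof -
    have "(r b + 1) * D \<le> j * D" using r_le[OF that] by (rule mult_le_mono1)
    thus ?thesis using Dj by (simp add: algebra_simps)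
  qed
  define G where "G = (\<lambda>b. if b = 1 then {1..m - ?k} else {r b * D + 1..r b * D + (D - ?k)})"
  let ?E = "Pi\<^sub>E ?B G"
  have e_props: "embedding_with P e \<in> first_block_low P n m" if e: "e \<in> ?E" for e
  proof -
    have eG: "e b \<in> G b" if "b \<in> ?B" for b using e that by blast
    have e1: "1 \<le> e 1" "e 1 + ?k \<le> m" using eG[OF one] unfolding G_def by auto
    have eb: "r b * D + 1 \<le> e b" "e b + ?k \<le> r b * D + D" if "b \<in> ?B" "b \<noteq> 1" for b
      using eG[OF that(1)] that(2) unfolding G_def by auto
    have mD: "m \<le> D" using m unfolding D_def .
    have b1: "1 \<le> b" if "b \<in> ?B" for b using block_starts_range[OF that] by simp
    have low: "D < e b" if "b \<in> ?B" "b \<noteq> 1" for b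
    proof -
      have "1 \<le> r b" using r_less[OF one that(1)] b1[OF that(1)] that(2) by simp
      hence "1 * D \<le> r b * D" by (rule mult_le_mono1)
      thus ?thesis using eb(1)[OF that] by linarith
    qed
    have U: "embedding_with P e \<in> ?U"
    proof (rule embedding_with_in[OF P])
      fix b assume b: "b \<in> ?B"
      show "1 \<le> e b \<and> e b + ?k \<le> n + 1"
      proof (cases "b = 1")
        case True
        have "D \<le> n" unfolding D_def by simp
        thus ?thesis using True e1 mD by simp
      next
        case False thus ?thesis using eb[OF b False] rD[OF b] by simp
      qed
    next
      fix b b' assume b: "b \<in> ?B" "b' \<in> ?B" "b < b'"
      have b': "b' \<noteq> 1" using b b1[OF b(1)] by simp
      show "e b + ?k \<le> e b'"
      proof (cases "b = 1")
        case True
        thus ?thesis using e1 mD low[OF b(2) b'] by simp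
      next
        case False
        have "(r b + 1) * D \<le> r b' * D" using r_less[OF b] by (rule mult_le_mono1)
        thus ?thesis using eb[OF b(1) False] eb[OF b(2) b'] by (simp add: algebra_simps)
      qed
    qed
    have fr: "?f - 1 \<in> {1..?k}" using f by auto
    have "embedding_with P e (?f - 1) = embedding_with P e 1 + (?f - 1 - 1)"
      using embedding_start_of[OF P U fr] unfolding f(4) .
    hence "embedding_with P e (?f - 1) \<le> m" using e1 f embedding_with_starts[OF P one, of e] by simp
    moreover have "m < embedding_with P e ?f"
      using low[OF f(1)] f(2) mD embedding_with_starts[OF P f(1), of e] by simp
    ultimately show ?thesis using U unfolding first_block_low_def by blast
  qed
  have "inj_on (embedding_with P) ?E"
  proof (rule inj_onI)
    fix e e' assume e: "e \<in> ?E" "e' \<in> ?E" and eq: "embedding_with P e = embedding_with P e'"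
    have "e b = e' b" if "b \<in> ?B" for b
      using fun_cong[OF eq, of b] embedding_with_starts[OF P that] by simp
    thus "e = e'" by (rule PiE_ext[OF e])
  qed
  hence le: "card ?E \<le> card (first_block_low P n m)"
    using e_props finite_embeddings[of P n] unfolding first_block_low_def
    by (intro card_inj_on_le[of "embedding_with P"]) auto
  have "card ?E = (\<Prod>b\<in>?B. card (G b))" by (rule card_PiE[OF fB])
  also have "\<dots> = card (G 1) * (\<Prod>b\<in>?B - {1}. card (G b))" by (rule prod.remove[OF fB one])
  also have "(\<Prod>b\<in>?B - {1}. card (G b)) = (\<Prod>b\<in>?B - {1}. D - ?k)" by (intro prod.cong refl) (simp add: G_def)
  also have "\<dots> = (D - ?k) ^ (j - 1)" using one cB fB by (simp add: card_Diff_singleton)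
  also have "card (G 1) = m - ?k" unfolding G_def by simp
  finally show ?thesis using le unfolding D_def by simp
qed

text \<open>With \<open>m\<close> about \<open>n / R\<close> there are, up to constants, at least \<open>n^j / R\<close> favourable embeddings and at
  most \<open>n^j / R\<^sup>2\<close> others, so for large \<open>R\<close> the main term of \<open>covariance_bound\<close> prevails.\<close>

lemma variance_growth_several_blocks:
  assumes P: "is_vincular_pattern P" and k: "pat_length P = k" and j: "num_blocks P = j" "j \<ge> 2"
  shows "\<exists>c>0. \<exists>N. \<forall>n\<ge>N. c * real n ^ (2 * j - 1) \<le> occurrence_variance P n"
proof -
  \<comment> \<open>With \<open>C\<close> as below there are at least \<open>2 k! C n^j / R\<close> favourable embeddings. The choice of \<open>R\<close>
     gives \<open>R C = 4 k\<close>, so that the others cancel at most half of the main term.\<close>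
  define R where "R = 32 * k * fact k * (2 * j) ^ (j - 1)"
  define C where "C = 1 / (8 * fact k * (2 * real j) ^ (j - 1))"
  \<comment> \<open>Each summand of \<open>N\<close> absorbs one lower order term.\<close>
  define N where "N = R * R * k + 2 * j * (k + 1) + 4 * R * k + 2 * R"
  define d where "d = C\<^sup>2 / (16 * real R ^ 4)"
  have k1: "k \<ge> 1" using P k unfolding is_vincular_pattern_def by simp
  have C0: "C > 0" unfolding C_def using j by simp
  have RC: "real R * C = 4 * real k" unfolding R_def C_def using j by simp
  have jpow: "2 * j \<le> (2 * j) ^ (j - 1)" using j power_increasing[of 1 "j - 1" "2 * j"] by simp
  have f1: "fact k \<ge> (1::nat)" by (rule fact_ge_1)
  have "1 * 1 * (2 * j) \<le> 32 * k * fact k * (2 * j) ^ (j - 1)"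
    using jpow k1 f1 by (intro mult_le_mono) auto
  hence "2 * j \<le> R" unfolding R_def by (simp only: mult_1_left)
  hence Rj: "j \<le> R" by simp
  have R0: "R > 0" using Rj j by simp
  have "2 * k * fact k * 1 \<le> 32 * k * fact k * (2 * j) ^ (j - 1)"
    using j by (intro mult_le_mono) auto
  hence Rk: "2 * k * fact k \<le> R" unfolding R_def by (simp only: mult_1_right)
  have d0: "d > 0" unfolding d_def using C0 R0 by simp
  have "d * real n ^ (2 * j - 1) \<le> occurrence_variance P n" if n: "n \<ge> N" for n
  proof -
    define m where "m = n div R"
    define \<mu> where "\<mu> = real m / real n"
    have nR: "2 * R \<le> n" "4 * R * k \<le> n" "2 * j * (k + 1) \<le> n" "R * R * k \<le> n"
      using n unfolding N_def by auto
    have n0: "real n > 0" using nR R0 by simp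
    have mj: "m \<le> n div j" unfolding m_def using Rj j by (intro div_le_mono2) auto
    have mn: "m \<le> n" unfolding m_def by simp
    have m_upper: "real m \<le> real n / real R" unfolding m_def by (rule of_nat_div_le_of_nat)
    have div_lower: "real n / real q - 1 \<le> real (n div q)" if "q > 0" for q
      using real_of_int_div3[of "int n" "int q"] by (simp flip: of_nat_div)
    have m_lower: "real n / (2 * real R) \<le> real m"
    proof -
      have "1 \<le> real n / (2 * real R)" using nR(1) R0 by (simp add: divide_simps flip: of_nat_mult of_nat_le_iff)
      thus ?thesis using div_lower[OF R0] unfolding m_def by (simp add: field_simps)
    qed
    have mk: "real n / (4 * real R) \<le> real (m - k)"
    proof -
      have "real (4 * R * k) \<le> real n" using nR(2) by (rule of_nat_mono)
      hence "real k \<le> real n / (4 * real R)" using R0 by (simp add: field_simps)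
      hence "real n / (4 * real R) \<le> real m - real k" using m_lower by simp
      thus ?thesis by linarith
    qed
    have Dk: "real n / (2 * real j) \<le> real (n div j - k)"
    proof -
      have "real (2 * j * (k + 1)) \<le> real n" using nR(3) by (rule of_nat_mono)
      hence "real k + 1 \<le> real n / (2 * real j)" using j by (simp add: field_simps)
      moreover have "real n / real j - 1 \<le> real (n div j)" using div_lower j by simp
      ultimately have "real n / (2 * real j) \<le> real (n div j) - real k" by (simp add: field_simps)
      thus ?thesis by linarith
    qed
    have \<mu>0: "0 < \<mu>" and \<mu>_lower: "1 / (2 * real R) \<le> \<mu>" and \<mu>_upper: "\<mu> \<le> 1 / real R"
    proof -
      show l: "1 / (2 * real R) \<le> \<mu>" unfolding \<mu>_def using m_lower n0 R0 by (simp add: field_simps)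
      have "0 < 1 / (2 * real R)" using R0 by simp
      thus "0 < \<mu>" using l by linarith
      show "\<mu> \<le> 1 / real R" unfolding \<mu>_def using m_upper n0 R0 by (simp add: field_simps)
    qed
    let ?A = "real (card (first_block_low P n m))" and ?B = "real (card (other_low P n m))"
    let ?cov = "perm_mean n (\<lambda>\<pi>. num_occurring P n \<pi> * small_values m \<pi>)
      - perm_mean n (num_occurring P n) * perm_mean n (small_values m)"
    have A_lower: "2 * fact k * real n ^ j * C / real R \<le> ?A"
    proof -
      have "real n / (4 * real R) * (real n / (2 * real j)) ^ (j - 1)
          \<le> real (m - k) * real (n div j - k) ^ (j - 1)"
        using mk Dk by (intro mult_mono power_mono) auto
      also have "\<dots> = real ((m - k) * (n div j - k) ^ (j - 1))" by simp
      also have "\<dots> \<le> ?A" using card_first_block_low_ge[OF P j mj] unfolding k by (rule of_nat_mono)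
      finally have 1: "real n / (4 * real R) * (real n / (2 * real j)) ^ (j - 1) \<le> ?A" .
      have "real n ^ j = real n * real n ^ (j - 1)" using j by (metis Suc_1 Suc_le_D diff_Suc_1 power_Suc)
      hence "2 * fact k * real n ^ j * C / real R = real n / (4 * real R) * (real n / (2 * real j)) ^ (j - 1)"
        unfolding C_def by (simp add: power_divide field_simps)
      thus ?thesis using 1 by simp
    qed
    have B_upper: "real k * ?B \<le> real n ^ j * C / (2 * real R)"
    proof -
      have "?B \<le> real (m ^ 2 * n ^ (j - 2) + k * n ^ (j - 1))"
        using card_other_low_le[OF P j, of n m] unfolding k by (rule of_nat_mono)
      hence "?B \<le> real m ^ 2 * real n ^ (j - 2) + real k * real n ^ (j - 1)" by simp
      also have "real m ^ 2 * real n ^ (j - 2) \<le> (real n / real R) ^ 2 * real n ^ (j - 2)"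
        using m_upper by (intro mult_right_mono power_mono) auto
      also have "\<dots> = real n ^ j / real R ^ 2"
      proof -
        have "real n ^ j = real n ^ 2 * real n ^ (j - 2)"
          by (metis power_add le_add_diff_inverse j(2))
        thus ?thesis by (simp add: power_divide)
      qed
      finally have "?B \<le> real n ^ j / real R ^ 2 + real k * real n ^ (j - 1)" by simp
      hence "real k * ?B \<le> real k * (real n ^ j / real R ^ 2 + real k * real n ^ (j - 1))"
        by (rule mult_left_mono) simp
      also have "\<dots> = real k / real R * (real n ^ j / real R) + real k ^ 2 * real n ^ (j - 1)"
        by (simp add: distrib_left power2_eq_square)
      also have "real k / real R = C / 4" using RC R0 by (simp add: field_simps)
      also have "real k ^ 2 * real n ^ (j - 1) \<le> C / 4 * (real n ^ j / real R)"
      proof -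
        have nj: "real n ^ j = real n * real n ^ (j - 1)" using j by (metis Suc_1 Suc_le_D diff_Suc_1 power_Suc)
        have "real (R * R * k) \<le> real n" using nR(4) by (rule of_nat_mono)
        hence "real R * real R * real k * C \<le> real n * C" using C0 by simp
        moreover have "real R * real R * real k * C = 4 * real k ^ 2 * real R"
        proof -
          have "real R * real R * real k * C = real R * real k * (real R * C)" by simp
          thus ?thesis unfolding RC by (simp add: power2_eq_square)
        qed
        ultimately have "4 * real k ^ 2 * real R \<le> real n * C" by linarith
        hence "real k ^ 2 \<le> C / 4 * (real n / real R)" using R0 by (simp add: field_simps)
        hence "real k ^ 2 * real n ^ (j - 1) \<le> C / 4 * (real n / real R) * real n ^ (j - 1)"
          by (rule mult_right_mono) simp
        thus ?thesis unfolding nj by simp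
      qed
      finally show ?thesis by (simp add: mult.commute)
    qed
    have kmu: "real k * \<mu> \<le> 1 / (2 * fact k)"
    proof -
      have "real (2 * k * fact k) \<le> real R" using Rk by (rule of_nat_mono)
      hence "real k * (1 / real R) \<le> 1 / (2 * fact k)" using R0 by (simp add: field_simps)
      moreover have "real k * \<mu> \<le> real k * (1 / real R)" using \<mu>_upper by (rule mult_left_mono) simp
      ultimately show ?thesis by linarith
    qed
    have "?A * (\<mu> / fact k - real k * \<mu>\<^sup>2) - ?B * (real k * \<mu>) = \<mu> * (?A * (1 / fact k - real k * \<mu>) - real k * ?B)"
      by (simp add: power2_eq_square algebra_simps)
    also have "\<dots> \<ge> \<mu> * (real n ^ j * C / (2 * real R))"
    proof (rule mult_left_mono)
      have "1 / (2 * fact k) \<le> 1 / fact k - real k * \<mu>" using kmu by (simp add: field_simps)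
      hence "2 * fact k * real n ^ j * C / real R * (1 / (2 * fact k)) \<le> ?A * (1 / fact k - real k * \<mu>)"
        using A_lower by (intro mult_mono) auto
      moreover have "2 * fact k * real n ^ j * C / real R * (1 / (2 * fact k)) = 2 * (real n ^ j * C / (2 * real R))"
        by simp
      ultimately have "2 * (real n ^ j * C / (2 * real R)) \<le> ?A * (1 / fact k - real k * \<mu>)" by (simp only:)
      moreover have "x \<le> a - b" if "2 * x \<le> a" "b \<le> x" for x a b :: real using that by linarith
      ultimately show "real n ^ j * C / (2 * real R) \<le> ?A * (1 / fact k - real k * \<mu>) - real k * ?B"
        using B_upper by blast
    qed (use \<mu>0 in simp)
    finally have "\<mu> * (real n ^ j * C / (2 * real R)) \<le> ?A * (\<mu> / fact k - real k * \<mu>\<^sup>2) - ?B * (real k * \<mu>)" .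
    moreover have "?A * (\<mu> / fact k - real k * \<mu>\<^sup>2) - ?B * (real k * \<mu>) \<le> \<bar>?cov\<bar>"
      using covariance_bound[OF P _ mn] j unfolding k \<mu>_def by simp
    moreover have "1 / (2 * real R) * (real n ^ j * C / (2 * real R)) \<le> \<mu> * (real n ^ j * C / (2 * real R))"
      using \<mu>_lower C0 by (intro mult_right_mono) auto
    ultimately have cov: "real n ^ j * C / (4 * real R ^ 2) \<le> \<bar>?cov\<bar>" by (simp add: power2_eq_square)
    let ?X = "num_occurring P n" and ?Y = "small_values m"
    let ?vy = "perm_mean n (\<lambda>\<pi>. (?Y \<pi> - perm_mean n ?Y)\<^sup>2)"
    have vX0: "0 \<le> occurrence_variance P n"
      unfolding occurrence_variance_centered[OF P] perm_mean_def by (intro divide_nonneg_pos sum_nonneg) auto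
    have "?cov\<^sup>2 \<le> occurrence_variance P n * ?vy"
      using perm_mean_Cauchy_Schwarz[of n "\<lambda>\<pi>. ?X \<pi> - perm_mean n ?X" "\<lambda>\<pi>. ?Y \<pi> - perm_mean n ?Y"]
      unfolding perm_mean_centered occurrence_variance_centered[OF P] .
    also have "\<dots> \<le> occurrence_variance P n * real n"
      using variance_small_values[OF mn] mn vX0 by (intro mult_left_mono) auto
    finally have "?cov\<^sup>2 \<le> occurrence_variance P n * real n" .
    moreover have "(real n ^ j * C / (4 * real R ^ 2))\<^sup>2 \<le> \<bar>?cov\<bar>\<^sup>2"
      using cov C0 by (intro power_mono) auto
    ultimately have "(real n ^ j * C / (4 * real R ^ 2))\<^sup>2 \<le> occurrence_variance P n * real n" by simp
    moreover have "(real n ^ j * C / (4 * real R ^ 2))\<^sup>2 = d * real n ^ (2 * j - 1) * real n"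
    proof -
      have "real n ^ (2 * j - 1) * real n = (real n ^ j)\<^sup>2"
      proof -
        have "Suc (2 * j - 1) = j * 2" using j by simp
        thus ?thesis by (metis power_Suc2 power_mult)
      qed
      thus ?thesis unfolding d_def by (simp add: power_divide power_mult_distrib flip: power_mult)
    qed
    ultimately show ?thesis using n0 by simp
  qed
  thus ?thesis using d0 by blast
qed

section \<open>Growth of the variance for one block, and its positivity\<close>

lemma one_block_starts:
  assumes P: "is_vincular_pattern P" and j: "num_blocks P = 1"
  shows "block_starts P = {1}"
proof -
  have "card (block_starts P) = 1" using num_blocks_eq[OF P] j by simp
  then obtain b where b: "block_starts P = {b}" by (rule card_1_singletonE)
  thus ?thesis using one_block_start[OF P] by simp
qed

lemma embedding_exists:
  assumes P: "is_vincular_pattern P" and j: "num_blocks P = 1"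
    and s: "1 \<le> s" "s + pat_length P \<le> n + 1"
  shows "\<exists>u\<in>embeddings P n. u 1 = s"
proof -
  have "embedding_with P (\<lambda>_. s) \<in> embeddings P n"
    by (rule embedding_with_in[OF P]) (use s in \<open>auto simp: one_block_starts[OF P j]\<close>)
  moreover have "embedding_with P (\<lambda>_. s) 1 = s" by (rule embedding_with_starts[OF P one_block_start[OF P]])
  ultimately show ?thesis by blast
qed

lemma card_embeddings_one_block_ge:
  assumes P: "is_vincular_pattern P" and j: "num_blocks P = 1" and k: "pat_length P = k"
  shows "n + 1 - k \<le> card (embeddings P n)"
proof -
  have "{1..n + 1 - k} \<subseteq> (\<lambda>u. u 1) ` embeddings P n"
  proof
    fix s assume s: "s \<in> {1..n + 1 - k}"
    have "1 \<le> s" "s + pat_length P \<le> n + 1" using s k by auto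
    from embedding_exists[OF P j this] obtain u where "u \<in> embeddings P n" "u 1 = s" by blast
    thus "s \<in> (\<lambda>u. u 1) ` embeddings P n" by blast
  qed
  hence "card {1..n + 1 - k} \<le> card (embeddings P n)" by (rule surj_card_le[OF finite_embeddings])
  thus ?thesis by simp
qed

lemma card_overlapping_one_block_le:
  assumes P: "is_vincular_pattern P" and j: "num_blocks P = 1" and k: "pat_length P = k"
  shows "card (overlapping_pairs P n) \<le> card (embeddings P n) * (2 * k - 1)"
proof -
  let ?U = "embeddings P n"
  let ?V = "\<lambda>u. {v \<in> ?U. \<forall>b\<in>block_starts P. v b \<in> {u 1 + 1 - k..u 1 + k - 1}}"
  have k1: "k \<ge> 1" using P k unfolding is_vincular_pattern_def by simp
  have off: "w i = w 1 + (i - 1)" if "w \<in> ?U" "i \<in> {1..k}" for w i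
  proof -
    have i: "i \<in> {1..pat_length P}" using that(2) k by simp
    have "start_of P i = 1" using start_of_props(1)[OF P i] one_block_starts[OF P j] by simp
    thus ?thesis using embedding_start_of[OF P that(1) i] by simp
  qed
  have "overlapping_pairs P n \<subseteq> Sigma ?U ?V"
  proof
    fix x assume x: "x \<in> overlapping_pairs P n"
    obtain u v where [simp]: "x = (u, v)" by (cases x)
    have uv: "u \<in> ?U" "v \<in> ?U" "range_of P u \<inter> range_of P v \<noteq> {}" using x unfolding overlapping_pairs_def by auto
    then obtain y where y: "y \<in> range_of P u" "y \<in> range_of P v" by blast
    obtain i where i: "i \<in> {1..k}" "y = u i" using y(1) unfolding k by (rule imageE)
    obtain i' where i': "i' \<in> {1..k}" "y = v i'" using y(2) unfolding k by (rule imageE)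
    have "u 1 + (i - 1) = v 1 + (i' - 1)" using off[OF uv(1) i(1)] off[OF uv(2) i'(1)] i i' by simp
    hence "v 1 \<in> {u 1 + 1 - k..u 1 + k - 1}" using i(1) i'(1) by auto
    thus "x \<in> Sigma ?U ?V" using uv one_block_starts[OF P j] by simp
  qed
  hence "card (overlapping_pairs P n) \<le> card (Sigma ?U ?V)"
    by (rule card_mono[rotated]) (intro finite_SigmaI finite_embeddings, simp add: finite_embeddings)
  also have "\<dots> = (\<Sum>u\<in>?U. card (?V u))"
    by (rule card_SigmaI[OF finite_embeddings]) (simp add: finite_embeddings)
  also have "\<dots> \<le> (\<Sum>u\<in>?U. 2 * k - 1)"
  proof (rule sum_mono)
    fix u assume "u \<in> ?U"
    have "card (?V u) \<le> (\<Prod>b\<in>block_starts P. card {u 1 + 1 - k..u 1 + k - 1})"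
      by (rule card_embeddings_le_prod[OF P]) simp
    also have "\<dots> = card {u 1 + 1 - k..u 1 + k - 1}" unfolding one_block_starts[OF P j] by simp
    also have "\<dots> \<le> 2 * k - 1" using k1 by simp
    finally show "card (?V u) \<le> 2 * k - 1" .
  qed
  finally show ?thesis by simp
qed

lemma diagonal_overlapping:
  assumes "is_vincular_pattern P" "u \<in> embeddings P n"
  shows "(u, u) \<in> overlapping_pairs P n"
  using assms unfolding overlapping_pairs_def is_vincular_pattern_def by auto

lemma fact_ge_double: "k \<ge> 3 \<Longrightarrow> 2 * k \<le> (fact k :: nat)"
proof (induction k rule: nat_induct_at_least)
  case base show ?case by (simp add: eval_nat_numeral)
next
  case (Suc k)
  have "2 * Suc k \<le> 2 * (2 * k)" using Suc by simp
  also have "\<dots> \<le> 2 * fact k" using Suc by simp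
  also have "\<dots> \<le> Suc k * fact k" using Suc.hyps by (intro mult_le_mono1) simp
  finally show ?case by simp
qed

text \<open>Keeping only the diagonal terms of the sum over overlapping pairs leaves, up to the factor
  \<open>1 / k!\<^sup>2\<close>, at least \<open>k! - (2 * k - 1) \<ge> 1\<close> for each embedding.\<close>

lemma variance_growth_one_block_long:
  assumes P: "is_vincular_pattern P" and k: "pat_length P = k" and j: "num_blocks P = 1" and k3: "k \<ge> 3"
  shows "\<exists>c>0. \<exists>N. \<forall>n\<ge>N. c * real n \<le> occurrence_variance P n"
proof -
  define c where "c = 1 / (2 * (fact k)\<^sup>2 :: real)"
  have "c * real n \<le> occurrence_variance P n" if n: "n \<ge> 2 * k" for n
  proof -
    let ?U = "embeddings P n" and ?O = "overlapping_pairs P n"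
    let ?p = "\<lambda>(u, v). perm_prob n (\<lambda>\<pi>. occurs_at P u \<pi> \<and> occurs_at P v \<pi>)"
    have "real (card ?U) / fact k = (\<Sum>u\<in>?U. ?p (u, u))"
      using perm_prob_occurs[OF P] k by simp
    also have "\<dots> = (\<Sum>x\<in>(\<lambda>u. (u, u)) ` ?U. ?p x)"
      by (subst sum.reindex) (auto intro: inj_onI)
    also have "\<dots> \<le> (\<Sum>x\<in>?O. ?p x)"
      using diagonal_overlapping[OF P] finite_overlapping_pairs
      by (intro sum_mono2) (auto simp: perm_prob_nonneg)
    finally have "real (card ?U) / fact k \<le> (\<Sum>x\<in>?O. ?p x)" .
    moreover have "occurrence_variance P n = (\<Sum>x\<in>?O. ?p x) - real (card ?O) / (fact k)\<^sup>2"
      unfolding occurrence_variance_overlapping[OF P] k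
      by (simp add: case_prod_unfold sum_subtractf power_one_over divide_inverse power_inverse)
    moreover have "real (card ?O) / (fact k)\<^sup>2 \<le> real (card ?U) * (2 * real k - 1) / (fact k)\<^sup>2"
    proof (rule divide_right_mono)
      have "real (card ?O) \<le> real (card ?U * (2 * k - 1))"
        using card_overlapping_one_block_le[OF P j k] by (rule of_nat_mono)
      thus "real (card ?O) \<le> real (card ?U) * (2 * real k - 1)" using k3 by (simp add: of_nat_diff)
    qed simp
    ultimately have "real (card ?U) / fact k - real (card ?U) * (2 * real k - 1) / (fact k)\<^sup>2 \<le> occurrence_variance P n"
      by linarith
    moreover have "real (card ?U) / fact k - real (card ?U) * (2 * real k - 1) / (fact k)\<^sup>2
       = real (card ?U) * (fact k - (2 * real k - 1)) / (fact k)\<^sup>2"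
      by (simp add: power2_eq_square field_simps)
    moreover have "real n / 2 * 1 / (fact k)\<^sup>2 \<le> real (card ?U) * (fact k - (2 * real k - 1)) / (fact k)\<^sup>2"
    proof (intro divide_right_mono mult_mono)
      have "real (n + 1 - k) \<le> real (card ?U)" using card_embeddings_one_block_ge[OF P j k] by (rule of_nat_mono)
      thus "real n / 2 \<le> real (card ?U)" using n by linarith
      have "real (2 * k) \<le> real (fact k)" using fact_ge_double[OF k3] by (rule of_nat_mono)
      thus "1 \<le> fact k - (2 * real k - 1)" by simp
    qed auto
    ultimately show ?thesis unfolding c_def by simp
  qed
  moreover have "c > 0" unfolding c_def by simp
  ultimately show ?thesis by blast
qed

text \<open>Here the diagonal alone gives \<open>n / 2\<close>, less than the \<open>3 n / 4\<close> that is subtracted. Two embeddings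
  shifted by one occur together iff three consecutive entries are monotone in the given direction;
  the two off-diagonals add \<open>n / 3\<close>.\<close>

lemma variance_growth_adjacent_pair:
  assumes P: "is_vincular_pattern P" and k: "pat_length P = 2" and j: "num_blocks P = 1"
  shows "\<exists>c>0. \<exists>N. \<forall>n\<ge>N. c * real n \<le> occurrence_variance P n"
proof -
  have s: "pat_perm P permutes {1..2}" using pattern_perm[OF P] k by simp
  have "1 / 24 * real n \<le> occurrence_variance P n" if n: "n \<ge> 10" for n
  proof -
    let ?U = "embeddings P n" and ?O = "overlapping_pairs P n"
    let ?p = "\<lambda>(u, v). perm_prob n (\<lambda>\<pi>. occurs_at P u \<pi> \<and> occurs_at P v \<pi>)"
    define e where "e = (\<lambda>s. embedding_with P (\<lambda>_. s))"
    have e: "e s \<in> ?U" "e s 1 = s" "e s 2 = s + 1" if "s \<in> {1..n - 1}" for s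
    proof -
      show U: "e s \<in> ?U" unfolding e_def
        by (rule embedding_with_in[OF P]) (use that k n in \<open>auto simp: one_block_starts[OF P j]\<close>)
      show 1: "e s 1 = s" unfolding e_def by (rule embedding_with_starts[OF P one_block_start[OF P]])
      have "2 \<in> {1..pat_length P}" using k by simp
      moreover have "start_of P 2 = 1" using start_of_props(1)[OF P, of 2] k one_block_starts[OF P j] by simp
      ultimately show "e s 2 = s + 1" using embedding_start_of[OF P U, of 2] 1 by simp
    qed
    have einj: "inj_on e {1..n - 1}" using e(2) by (metis inj_onI)
    have cU: "card ?U \<le> n - 1"
    proof -
      have "u 1 \<in> {1..n - 1}" if "u \<in> ?U" for u
        using embedding_in[OF that, of 1] embedding_in[OF that, of 2] embedding_less_iff[OF that, of 1 2] k by auto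
      hence "?U \<subseteq> {u \<in> ?U. \<forall>b\<in>block_starts P. u b \<in> {1..n - 1}}" using one_block_starts[OF P j] by auto
      hence "card ?U \<le> card {u \<in> ?U. \<forall>b\<in>block_starts P. u b \<in> {1..n - 1}}"
        using finite_embeddings[of P n] by (intro card_mono) auto
      also have "\<dots> \<le> (\<Prod>b\<in>block_starts P. card {1..n - 1})" by (rule card_embeddings_le_prod[OF P]) simp
      finally show ?thesis using one_block_starts[OF P j] by simp
    qed
    have third: "1 / 6 \<le> perm_prob n (\<lambda>\<pi>. occurs_at P (e s) \<pi> \<and> occurs_at P (e (s + 1)) \<pi>)"
      if s': "s \<in> {1..n - 2}" for s
    proof -
      have es: "e s 1 = s" "e s 2 = s + 1" "e (s + 1) 1 = s + 1" "e (s + 1) 2 = s + 2"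
        using e[of s] e[of "s + 1"] s' by auto
      have mono2: "strict_mono_on {1..2} f \<longleftrightarrow> f 1 < f 2" for f :: "nat \<Rightarrow> nat"
      proof
        assume "f 1 < f 2"
        show "strict_mono_on {1..2} f"
        proof (rule strict_mono_onI)
          fix a b :: nat assume "a \<in> {1..2}" "b \<in> {1..2}" "a < b"
          hence "a = 1" "b = 2" by auto
          thus "f a < f b" using \<open>f 1 < f 2\<close> by simp
        qed
      qed (auto simp: strict_mono_on_def)
      have mono3: "f 1 < f 2 \<and> f 2 < f 3" if "strict_mono_on {1..3} f" for f :: "nat \<Rightarrow> nat"
        using that unfolding strict_mono_on_def by auto
      have si: "inv (pat_perm P) permutes {1..2}" by (rule permutes_inv[OF s])
      have vals: "inv (pat_perm P) 1 \<in> {1..2}" "inv (pat_perm P) 2 \<in> {1..2}"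
        using permutes_in_image[OF si, of 1] permutes_in_image[OF si, of 2] by auto
      have "inv (pat_perm P) 1 \<noteq> inv (pat_perm P) 2" using inj_eq[OF permutes_inj[OF si], of 1 2] by simp
      then consider "inv (pat_perm P) 1 = 1 \<and> inv (pat_perm P) 2 = 2" | "inv (pat_perm P) 1 = 2 \<and> inv (pat_perm P) 2 = 1"
        using vals unfolding atLeastAtMost_iff by linarith
      hence "\<exists>w :: nat \<Rightarrow> nat. inj_on w {1..3} \<and> w ` {1..3} \<subseteq> {1..n} \<and>
          (\<forall>\<pi>. strict_mono_on {1..3} (\<lambda>a. \<pi> (w a)) \<longrightarrow> occurs_at P (e s) \<pi> \<and> occurs_at P (e (s + 1)) \<pi>)"
      proof cases
        case 1
        let ?w = "\<lambda>a. s + a - 1"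
        have "inj_on ?w {1..3}" by (auto intro!: inj_onI)
        moreover have "?w ` {1..3} \<subseteq> {1..n}" using s' by auto
        moreover have "\<forall>\<pi>. strict_mono_on {1..3} (\<lambda>a. \<pi> (?w a)) \<longrightarrow> occurs_at P (e s) \<pi> \<and> occurs_at P (e (s + 1)) \<pi>"
        proof (intro allI impI)
          fix \<pi> :: "nat \<Rightarrow> nat" assume "strict_mono_on {1..3} (\<lambda>a. \<pi> (?w a))"
          from mono3[OF this] show "occurs_at P (e s) \<pi> \<and> occurs_at P (e (s + 1)) \<pi>"
            using 1 es unfolding occurs_at_def k mono2 by (simp add: numeral_2_eq_2 numeral_3_eq_3)
        qed
        ultimately show ?thesis by (intro exI[of _ ?w] conjI)
      next
        case 2
        \<comment> \<open>A falling pair: the three entries are read from right to left.\<close>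
        let ?w = "\<lambda>a. s + 3 - a"
        have "inj_on ?w {1..3}" by (auto intro!: inj_onI)
        moreover have "?w ` {1..3} \<subseteq> {1..n}" using s' by auto
        moreover have "\<forall>\<pi>. strict_mono_on {1..3} (\<lambda>a. \<pi> (?w a)) \<longrightarrow> occurs_at P (e s) \<pi> \<and> occurs_at P (e (s + 1)) \<pi>"
        proof (intro allI impI)
          fix \<pi> :: "nat \<Rightarrow> nat" assume "strict_mono_on {1..3} (\<lambda>a. \<pi> (?w a))"
          from mono3[OF this] show "occurs_at P (e s) \<pi> \<and> occurs_at P (e (s + 1)) \<pi>"
            using 2 es unfolding occurs_at_def k mono2 by (simp add: numeral_2_eq_2 numeral_3_eq_3)
        qed
        ultimately show ?thesis by (intro exI[of _ ?w] conjI)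
      qed
      then obtain w :: "nat \<Rightarrow> nat" where w: "inj_on w {1..3}" "w ` {1..3} \<subseteq> {1..n}"
          "\<And>\<pi>. strict_mono_on {1..3} (\<lambda>a. \<pi> (w a)) \<Longrightarrow> occurs_at P (e s) \<pi> \<and> occurs_at P (e (s + 1)) \<pi>" by blast
      have "perm_prob n (\<lambda>\<pi>. True \<and> strict_mono_on {1..3} (\<lambda>a. \<pi> (w a))) = perm_prob n (\<lambda>_. True) / fact 3"
        by (rule perm_prob_increasing_along[OF w(1,2)])
      hence "1 / 6 = perm_prob n (\<lambda>\<pi>. strict_mono_on {1..3} (\<lambda>a. \<pi> (w a)))"
        by (simp add: perm_prob_True fact_numeral)
      also have "\<dots> \<le> perm_prob n (\<lambda>\<pi>. occurs_at P (e s) \<pi> \<and> occurs_at P (e (s + 1)) \<pi>)"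
        by (rule perm_prob_mono) (rule w(3))
      finally show ?thesis .
    qed
    \<comment> \<open>The diagonal and the two off-diagonals of overlapping pairs.\<close>
    let ?D1 = "(\<lambda>s. (e s, e s)) ` {1..n - 1}"
    let ?D2 = "(\<lambda>s. (e s, e (s + 1))) ` {1..n - 2}"
    let ?D3 = "(\<lambda>s. (e (s + 1), e s)) ` {1..n - 2}"
    have D1: "fst x 1 = snd x 1" if "x \<in> ?D1" for x using that by auto
    have D2: "snd x 1 = fst x 1 + 1" if "x \<in> ?D2" for x using that e(2) by auto
    have D3: "fst x 1 = snd x 1 + 1" if "x \<in> ?D3" for x using that e(2) by auto
    have disj: "?D1 \<inter> ?D2 = {}" "(?D1 \<union> ?D2) \<inter> ?D3 = {}"
    proof -
      show "?D1 \<inter> ?D2 = {}"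
      proof (rule equals0I)
        fix x assume x: "x \<in> ?D1 \<inter> ?D2"
        from D1[OF IntD1[OF x]] D2[OF IntD2[OF x]] show False by simp
      qed
      show "(?D1 \<union> ?D2) \<inter> ?D3 = {}"
      proof (rule equals0I)
        fix x assume x: "x \<in> (?D1 \<union> ?D2) \<inter> ?D3"
        from IntD1[OF x] have "snd x 1 = fst x 1 \<or> snd x 1 = fst x 1 + 1"
          by (elim UnE) (simp_all only: D1 D2 simp_thms)
        thus False using D3[OF IntD2[OF x]] by linarith
      qed
    qed
    have sub: "?D1 \<union> ?D2 \<union> ?D3 \<subseteq> ?O"
    proof -
      have "(e s, e s) \<in> ?O" if "s \<in> {1..n - 1}" for s by (rule diagonal_overlapping[OF P e(1)[OF that]])
      moreover have "(e s, e (s + 1)) \<in> ?O \<and> (e (s + 1), e s) \<in> ?O" if "s \<in> {1..n - 2}" for s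
      proof -
        have s1: "s \<in> {1..n - 1}" "s + 1 \<in> {1..n - 1}" using that by auto
        have "s + 1 \<in> range_of P (e s)" unfolding k using e(3)[OF s1(1)] by (intro image_eqI[of _ _ 2]) auto
        moreover have "s + 1 \<in> range_of P (e (s + 1))" unfolding k using e(2)[OF s1(2)] by (intro image_eqI[of _ _ 1]) auto
        ultimately show ?thesis using e(1)[OF s1(1)] e(1)[OF s1(2)] unfolding overlapping_pairs_def by blast
      qed
      ultimately show ?thesis by blast
    qed
    have inj: "inj_on (\<lambda>s. (e s, e s)) {1..n - 1}" "inj_on (\<lambda>s. (e s, e (s + 1))) {1..n - 2}" "inj_on (\<lambda>s. (e (s + 1), e s)) {1..n - 2}"
    proof -
      have *: "e s = e s' \<Longrightarrow> s = s'" if "s \<in> {1..n - 2}" "s' \<in> {1..n - 2}" for s s'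
        using inj_onD[OF einj] that by auto
      show "inj_on (\<lambda>s. (e s, e s)) {1..n - 1}" using einj unfolding inj_on_def by blast
      show "inj_on (\<lambda>s. (e s, e (s + 1))) {1..n - 2}" "inj_on (\<lambda>s. (e (s + 1), e s)) {1..n - 2}"
        using * unfolding inj_on_def by blast+
    qed
    have "(\<Sum>s\<in>{1..n - 1}. 1 / 2) + (\<Sum>s\<in>{1..n - 2}. 1 / 6) + (\<Sum>s\<in>{1..n - 2}. 1 / 6)
       \<le> (\<Sum>s\<in>{1..n - 1}. ?p (e s, e s)) + (\<Sum>s\<in>{1..n - 2}. ?p (e s, e (s + 1))) + (\<Sum>s\<in>{1..n - 2}. ?p (e (s + 1), e s))"
    proof (intro add_mono sum_mono)
      fix s assume "s \<in> {1..n - 1}"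
      thus "1 / 2 \<le> ?p (e s, e s)" using perm_prob_occurs[OF P e(1)] k by simp
    next
      fix s assume "s \<in> {1..n - 2}"
      thus "1 / 6 \<le> ?p (e s, e (s + 1))" using third by simp
    next
      fix s assume "s \<in> {1..n - 2}"
      thus "1 / 6 \<le> ?p (e (s + 1), e s)" using third[of s] by (simp add: conj_commute)
    qed
    also have "\<dots> = sum ?p ?D1 + sum ?p ?D2 + sum ?p ?D3"
      unfolding sum.reindex[OF inj(1)] sum.reindex[OF inj(2)] sum.reindex[OF inj(3)] comp_def ..
    also have "\<dots> = sum ?p (?D1 \<union> ?D2 \<union> ?D3)"
      using disj by (simp only: sum.union_disjoint finite_UnI finite_imageI finite_atLeastAtMost)
    also have "\<dots> \<le> sum ?p ?O"
      using sub finite_overlapping_pairs by (intro sum_mono2) (auto simp: perm_prob_nonneg)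
    finally have "real (n - 1) / 2 + real (n - 2) / 6 + real (n - 2) / 6 \<le> sum ?p ?O" by simp
    moreover have "occurrence_variance P n = sum ?p ?O - real (card ?O) / 4"
      unfolding occurrence_variance_overlapping[OF P] k
      by (simp add: case_prod_unfold sum_subtractf power2_eq_square)
    moreover have "real (card ?O) \<le> 3 * real (n - 1)"
    proof -
      have "card ?O \<le> card ?U * 3" using card_overlapping_one_block_le[OF P j k, of n] by simp
      thus ?thesis using cU by linarith
    qed
    moreover have "real (n - 1) = real n - 1" "real (n - 2) = real n - 2" "10 \<le> real n" using n by auto
    ultimately show ?thesis by linarith
  qed
  thus ?thesis by (intro exI[of _ "1 / 24"] conjI exI[of _ 10]) auto
qed

text \<open>The mean is positive, but the identity or the reversal contains no occurrence: the two lowest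
  letters of the pattern appear in one order only.\<close>

lemma variance_positive:
  assumes P: "is_vincular_pattern P" and k: "pat_length P = k" "k \<ge> 2" and n: "n \<ge> k"
  shows "occurrence_variance P n > 0"
proof (rule ccontr)
  let ?X = "num_occurring P n" and ?m = "perm_mean n (num_occurring P n)"
  let ?S = "{\<pi>. \<pi> permutes {1..n}}"
  assume "\<not> occurrence_variance P n > 0"
  hence "(\<Sum>\<pi>\<in>?S. (?X \<pi> - ?m)\<^sup>2) \<le> 0"
    unfolding occurrence_variance_centered[OF P] perm_mean_def[of n "\<lambda>\<pi>. (_ \<pi>)\<^sup>2"]
    by (simp add: pos_divide_le_eq not_less)
  hence "(\<Sum>\<pi>\<in>?S. (?X \<pi> - ?m)\<^sup>2) = 0" using sum_nonneg[of ?S "\<lambda>\<pi>. (?X \<pi> - ?m)\<^sup>2"] by simp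
  hence const: "?X \<pi> = ?m" if "\<pi> permutes {1..n}" for \<pi>
    using that sum_nonneg_eq_0_iff[OF finite_perms[of n], of "\<lambda>\<pi>. (?X \<pi> - ?m)\<^sup>2"] by simp
  have m_pos: "?m > 0"
  proof -
    let ?u = "restrict (\<lambda>i. i) {1..k}"
    have "?u \<in> embeddings P n"
      unfolding embeddings_def k using n pattern_adj_range[OF P] k by (auto simp: strict_mono_on_def)
    hence "card (embeddings P n) > 0" using finite_embeddings by (auto simp: card_gt_0_iff)
    thus ?thesis unfolding mean_num_occurring[OF P] by simp
  qed
  have none: False if \<pi>: "\<pi> permutes {1..n}" and no: "\<And>u. u \<in> embeddings P n \<Longrightarrow> \<not> occurs_at P u \<pi>" for \<pi>
  proof -
    have "?X \<pi> = 0" unfolding num_occurring_def using no by simp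
    thus False using const[OF \<pi>] m_pos by simp
  qed
  define \<rho> where "\<rho> = (\<lambda>i. if i \<in> {1..n} then n + 1 - i else i)"
  have \<rho>: "\<rho> permutes {1..n}"
  proof (rule bij_imp_permutes)
    show "bij_betw \<rho> {1..n} {1..n}"
      by (rule bij_betw_byWitness[where f' = \<rho>]) (auto simp: \<rho>_def)
  qed (unfold \<rho>_def, rule if_not_P)
  have s: "inv (pat_perm P) permutes {1..k}" using permutes_inv[OF pattern_perm[OF P]] k by simp
  define a b where "a = inv (pat_perm P) 1" and "b = inv (pat_perm P) 2"
  have ab: "a \<in> {1..k}" "b \<in> {1..k}" "a \<noteq> b"
    unfolding a_def b_def using permutes_in_image[OF s, of 1] permutes_in_image[OF s, of 2] k(2)
      inj_eq[OF permutes_inj[OF s], of 1 2] by auto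
  have occ: "\<pi> (u a) < \<pi> (u b)" if "occurs_at P u \<pi>" for u \<pi>
    using that k unfolding occurs_at_def strict_mono_on_def a_def b_def by simp
  show False
  proof (cases "a < b")
    case True
    show False
    proof (rule none[OF \<rho>])
      fix u assume u: "u \<in> embeddings P n"
      have "u a < u b" using embedding_less_iff[OF u, of a b] ab k True by simp
      moreover have "u a \<in> {1..n}" "u b \<in> {1..n}" using embedding_in[OF u] ab k by auto
      ultimately have "\<rho> (u b) < \<rho> (u a)" unfolding \<rho>_def by auto
      thus "\<not> occurs_at P u \<rho>" using occ[of u \<rho>] by linarith
    qed
  next
    case False
    show False
    proof (rule none[OF permutes_id])
      fix u assume u: "u \<in> embeddings P n"
      have "u b < u a" using embedding_less_iff[OF u, of b a] ab k False by simp
      thus "\<not> occurs_at P u id" using occ[of u id] by auto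
    qed
  qed
qed

section \<open>The equivalence\<close>

text \<open>The finitely many small \<open>n\<close> are handled by taking a minimum over positive quotients.\<close>

lemma variance_growth:
  assumes P: "is_vincular_pattern P" and k: "pat_length P = k" "k \<ge> 2" and j: "num_blocks P = j"
  shows "\<exists>c>0. \<forall>n\<ge>k. c * real n ^ (2 * j - 1) \<le> occurrence_variance P n"
proof -
  let ?q = "2 * j - 1"
  have "\<exists>c>0. \<exists>N. \<forall>n\<ge>N. c * real n ^ ?q \<le> occurrence_variance P n"
  proof (cases "j \<ge> 2")
    case True
    show ?thesis by (rule variance_growth_several_blocks[OF P k(1) j True])
  next
    case False
    hence j1: "j = 1" using num_blocks_pos[OF P] j by simp
    hence "num_blocks P = 1" using j by simp
    hence "\<exists>c>0. \<exists>N. \<forall>n\<ge>N. c * real n \<le> occurrence_variance P n"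
      using variance_growth_one_block_long[OF P k(1)] variance_growth_adjacent_pair[OF P] k by (cases "k = 2") auto
    thus ?thesis using j1 by simp
  qed
  then obtain c N where c: "c > 0" "\<And>n. n \<ge> N \<Longrightarrow> c * real n ^ ?q \<le> occurrence_variance P n" by blast
  let ?r = "\<lambda>n. occurrence_variance P n / real n ^ ?q"
  define d where "d = Min (insert c (?r ` {k..<N}))"
  have pos: "real n ^ ?q > 0" if "n \<ge> k" for n using that k(2) by simp
  have "d > 0" unfolding d_def using c(1) variance_positive[OF P k] pos by (subst Min_gr_iff) auto
  moreover have "d * real n ^ ?q \<le> occurrence_variance P n" if n: "n \<ge> k" for n
  proof (cases "n \<ge> N")
    case True
    have "d \<le> c" unfolding d_def by simp
    hence "d * real n ^ ?q \<le> c * real n ^ ?q" by (rule mult_right_mono) simp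
    thus ?thesis using c(2)[OF True] by linarith
  next
    case False
    hence "d \<le> ?r n" unfolding d_def using n by (intro Min_le) auto
    thus ?thesis using pos[OF n] by (simp add: pos_le_divide_eq)
  qed
  ultimately show ?thesis by blast
qed

context
  fixes P
  assumes P: "is_vincular_pattern P" and k: "pat_length P = 1"
begin

lemma length_one_adj: "pat_adj P = {}"
  using P k unfolding is_vincular_pattern_def by simp

lemma length_one_num_blocks: "num_blocks P = 1"
  using num_blocks_adj[OF P] k length_one_adj by simp

lemma length_one_variance: "occurrence_variance P n = 0"
proof -
  have "occurs_at P u \<pi>" for u \<pi> unfolding occurs_at_def k strict_mono_on_def by simp
  hence "num_occurring P n = (\<lambda>\<pi>. real (card (embeddings P n)))" unfolding num_occurring_def by (simp add: fun_eq_iff)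
  thus ?thesis unfolding occurrence_variance_centered[OF P] by (simp add: perm_mean_const)
qed

lemma length_one_merges: "num_self_merges P 1 1 \<le> 1"
proof -
  let ?S = "{(Q, m1, m2). is_vincular_pattern Q \<and> is_merge P P Q m1 m2 \<and> pat_length Q = 1 \<and> num_blocks Q = 1}"
  let ?m = "\<lambda>i\<in>{1..1::nat}. 1::nat"
  have "?S \<subseteq> {(Vincular 1 id {}, ?m, ?m)}"
  proof
    fix t assume t: "t \<in> ?S"
    obtain Q m1 m2 where [simp]: "t = (Q, m1, m2)" by (cases t)
    have Q: "is_vincular_pattern Q" "is_merge P P Q m1 m2" "pat_length Q = 1" using t by auto
    have "pat_perm Q permutes {1}" using pattern_perm[OF Q(1)] Q(3) by simp
    hence "pat_perm Q = id" by simp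
    moreover have "pat_adj Q = {}" using Q unfolding is_vincular_pattern_def by simp
    ultimately have "Q = Vincular 1 id {}" using Q(3) by (cases Q) simp
    moreover have "m = ?m" if m: "m \<in> {1..1::nat} \<rightarrow>\<^sub>E {1..1::nat}" for m
    proof (rule PiE_ext[OF m])
      show "?m \<in> {1..1::nat} \<rightarrow>\<^sub>E {1..1::nat}" by simp
      fix i :: nat assume "i \<in> {1..1}"
      thus "m i = ?m i" using PiE_mem[OF m, of i] by simp
    qed
    ultimately show "t \<in> {(Vincular 1 id {}, ?m, ?m)}" using is_mergeD(1,2)[OF Q(2)] Q(3) k by simp
  qed
  hence "card ?S \<le> card {(Vincular 1 id {}, ?m, ?m)}" by (rule card_mono[rotated]) simp
  thus ?thesis unfolding num_self_merges_def by simp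
qed

text \<open>The right-hand side of the inequality is \<open>2\<close> for length one, and the unique merge of a one-letter
  pattern with itself contributes exactly \<open>2\<close>.\<close>

lemma length_one_inequality_fails:
  "(\<Sum>l = 1..max_block_size P. falling_factorial 2 l * num_self_merges P (2 - l) 1) \<le> 2"
proof -
  have "(\<Sum>l = 1..max_block_size P. falling_factorial 2 l * num_self_merges P (2 - l) 1)
     \<le> (\<Sum>l = 1..1. falling_factorial 2 l * num_self_merges P (2 - l) 1)"
    using max_block_size_le[OF P] k by (intro sum_mono2) auto
  also have "\<dots> = 2 * num_self_merges P 1 1" by (simp add: falling_factorial_def)
  finally show ?thesis using length_one_merges by linarith
qed

end

theorem theorem6p6:
  fixes \<sigma> :: vincular_pattern and k j :: nat
  assumes "is_vincular_pattern \<sigma>"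
    and "pat_length \<sigma> = k"
    and "num_blocks \<sigma> = j"
  shows "(\<exists>c::real. c > 0 \<and> (\<forall>n\<ge>k. occurrence_variance \<sigma> n \<ge> c * real n ^ (2 * j - 1))) \<longleftrightarrow>
         (\<Sum>l = 1..max_block_size \<sigma>. falling_factorial (2 * k) l * num_self_merges \<sigma> (2 * k - l) (2 * j - 1))
           > ((2 * k) choose k) * ((2 * j - 1) choose j) * j"
proof (cases "k = 1")
  case True
  have k1: "pat_length \<sigma> = 1" using assms(2) True by simp
  have j1: "j = 1" using length_one_num_blocks[OF assms(1) k1] assms(3) by simp
  have "\<not> (\<exists>c::real. c > 0 \<and> (\<forall>n\<ge>k. occurrence_variance \<sigma> n \<ge> c * real n ^ (2 * j - 1)))"
    unfolding length_one_variance[OF assms(1) k1] True j1 by (auto simp: not_le intro!: exI[of _ 1])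
  moreover have "\<not> ((2 * k) choose k) * ((2 * j - 1) choose j) * j <
      (\<Sum>l = 1..max_block_size \<sigma>. falling_factorial (2 * k) l * num_self_merges \<sigma> (2 * k - l) (2 * j - 1))"
    using length_one_inequality_fails[OF assms(1) k1] unfolding True j1 by simp
  ultimately show ?thesis by blast
next
  case False
  hence "k \<ge> 2" using assms(1,2) unfolding is_vincular_pattern_def by linarith
  from variance_growth[OF assms(1,2) this assms(3)] obtain c where
    c: "c > 0" "\<And>n. n \<ge> k \<Longrightarrow> c * real n ^ (2 * j - 1) \<le> occurrence_variance \<sigma> n" by blast
  have "((2 * k) choose k) * ((2 * j - 1) choose j) * j <
      (\<Sum>l = 1..max_block_size \<sigma>. falling_factorial (2 * k) l * num_self_merges \<sigma> (2 * k - l) (2 * j - 1))"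
    by (rule merge_inequality_if_variance_growth[OF assms c])
  thus ?thesis using c by blast
qed

end
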